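(* Let $\mathbb{B}$ be the weighted adjacency matrix of the line graph of a countable, simple, locally finite, weighted directed graph with edge index set $J$, and let $X=L^{\infty}([0,1],\ell^1)$. The operator $(A,D(A))$ on $X$ given by $$A:=\mathrm{diag}\left(\frac{d}{dx}\right),\qquad D(A):=\left\{v\in W^{1,\infty}([0,1],\ell^1)\mid v(1)=\mathbb{B}v(0)\right\}$$ generates a contraction bi-continuous semigroup $(T(t))_{t\ge 0}$ on $X$ with respect to the weak$^*$-topology. This semigroup is given by $$T(t)f(s)=\mathbb{B}^n f(t+s-n),\qquad n\le t+s<n+1,\ f\in X,\ n\in\mathbb{N}_0,\ t\ge 0,\ s\in[0,1].$$
   Context: **Graph.** $G=(V,E)$ is a directed graph with vertices $V=\{v_i\mid i\in I\}$ and edges $E=\{e_j\mid j\in J\}\subseteq V\times V$, where $I,J\subseteq\mathbb{N}$. For an edge $(v_i,v_k)$, $v_i$ is its tail and $v_k$ its head. $G$ is simple (no loops or multiple edges) and locally finite (each vertex is incident with only finitely many edges). It carries weights $0\le w_{ij}\le 1$ ($i,j\in J$), with $w_{ij}\ne 0$ only if the head of $e_j$ is the tail of $e_i$, such that $\sum_{i\in J}w_{ij}=1$ for all $j\in J$. The matrix $\mathbb{B}=(\mathbb{B}_{ij})_{i,j\in J}$ is defined by $\mathbb{B}_{ij}=w_{ij}$ if the head of $e_j$ is the tail of $e_i$, and $\mathbb{B}_{ij}=0$ otherwise. It acts as a (column-)stochastic operator on $\ell^1=\ell^1(J)$. **Space.** $X=L^\infty([0,1],\ell^1)$ (Bochner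 space) has norm $\|f\|_X=\operatorname{ess\,sup}_{s\in[0,1]}\|f(s)\|_{\ell^1}$. It is identified with the dual of $L^1([0,1],c_0)$, $c_0=c_0(J)$, via $\langle f,g\rangle=\int_0^1\langle f(s),g(s)\rangle\,ds$; the weak$^*$-topology on $X$ is the one induced by this duality. $W^{1,\infty}([0,1],\ell^1)$ is the Sobolev space of functions in $X$ with weak derivative in $X$; such functions are evaluated at points through their continuous representatives. $\mathrm{diag}(d/dx)$ acts by differentiating each component. **Bi-continuous semigroups.** Let $X$ be a Banach space and $\tau$ a locally convex Hausdorff topology on $X$, coarser than the norm topology, sequentially complete on norm-bounded sets, and such that $(X,\tau)'$ is norming for $X$. A family $(T(t))_{t\ge0}$ of bounded linear operators is a bi-continuous semigroup (with respect to $\tau$) if: (i) $T(0)=I$ and $T(t+s)=T(t)T(s)$ for all $s,t\ge0$; (ii) $t\mapsto T(t)f$ is continuous from $[0,\infty)$ to $(X,\tau)$ for every $f\in X$; (iii) there are $M\ge1$, $\omega\in\mathbb{R}$ with $\|T(t)\|\le Me^{\omega t}$ for all $t\ge0$; (iv) for every norm-bounded sequence $(f_n)$ that is $\tau$-convergent to $0$, $T(s)f_n\to0$ in $\tau$ uniformly for $s\in[0,t_0]$, for each $t_0\ge0$. It is a contraction semigroup if $\|T(t)\|\le1$ for all $t\ge0$. Its generator is $Af:=\tau\text{-}\lim_{t\to0}\frac{T(t)f-f}{t}$ with domain consisting of all $f\in X$ for which this limit exists and $\sup_{t\in(0,1]}\frac{\|T(t)f-f\|}{t}<\infty$. *)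

theory Defs
  imports
    "HOL-Probability.Essential_Supremum"
    "Graph_Theory.Digraph"
begin

section \<open>The sequence spaces $\ell^1$ and $c_0$\<close>

text \<open>
  Sequences are indexed by all of \<open>nat\<close>.  For an index set \<open>J :: nat set\<close> the spaces
  $\ell^1(J)$ and $c_0(J)$ are the closed subspaces of sequences vanishing outside \<open>J\<close>;
  they enter through \<open>Linf J\<close> and \<open>L1_c0 J\<close> below.
\<close>

lemma second_countable_of_dense:
  fixes D :: "'a::metric_space set"
  assumes "countable D" and dense: "\<And>x e. e > 0 \<Longrightarrow> \<exists>d\<in>D. dist x d < e"
  shows "\<exists>B :: 'a set set. countable B \<and> open = generate_topology B"
proof (intro exI conjI)
  let ?B = "(\<lambda>(d, n). ball d (1 / real (Suc n))) ` (D \<times> (UNIV :: nat set))"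
  show "countable ?B" using assms(1) by (intro countable_image) auto
  show "open = generate_topology ?B"
  proof (intro ext iffI)
    fix S :: "'a set" assume S: "open S"
    have "\<exists>U\<in>?B. x \<in> U \<and> U \<subseteq> S" if "x \<in> S" for x
    proof -
      obtain e where e: "e > 0" "ball x e \<subseteq> S" using S \<open>x \<in> S\<close> open_contains_ball by blast
      obtain n where n: "1 / real (Suc n) < e / 2"
        using e(1) nat_approx_posE[of "e/2"] by auto
      obtain d where d: "d \<in> D" "dist x d < 1 / real (Suc n)"
        using dense[of "1 / real (Suc n)" x] by auto
      have "ball d (1 / real (Suc n)) \<subseteq> ball x e"
      proof
        fix y assume "y \<in> ball d (1 / real (Suc n))"
        then show "y \<in> ball x e" using d n dist_triangle[of x y d] by auto
      qed
      then show ?thesis using d e by (auto simp: dist_commute intro!: bexI[of _ "(d, n)"])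
    qed
    then have "S = \<Union>{U \<in> ?B. U \<subseteq> S}" by fast
    also have "generate_topology ?B \<dots>"
      by (rule generate_topology.UN) (auto intro: generate_topology.Basis)
    finally show "generate_topology ?B S" .
  next
    fix S assume "generate_topology ?B S"
    then show "open S" by induct auto
  qed
qed

subsection \<open>The space $\ell^1$\<close>

typedef (overloaded) ('a::real_normed_vector) ell1 =
  "{x :: nat \<Rightarrow> 'a. summable (\<lambda>n. norm (x n))}"
  morphisms ell1_nth Ell1
  by (rule exI[of _ "\<lambda>_. 0"]) simp

setup_lifting type_definition_ell1

lemma summable_ell1: "summable (\<lambda>n. norm (ell1_nth x n))"
  using ell1_nth[of x] by simp

lemma summable_norm_add:
  fixes x y :: "nat \<Rightarrow> 'a::real_normed_vector"
  assumes "summable (\<lambda>n. norm (x n))" "summable (\<lambda>n. norm (y n))"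
  shows "summable (\<lambda>n. norm (x n + y n))"
  using summable_add[OF assms] by (rule summable_comparison_test') (simp add: norm_triangle_ineq)

lemma ell1_eqI: "(\<And>n. ell1_nth x n = ell1_nth y n) \<Longrightarrow> x = y"
  by (simp add: ell1_nth_inject[symmetric] ext)

instantiation ell1 :: (real_normed_vector) real_normed_vector
begin

lift_definition zero_ell1 :: "'a ell1" is "\<lambda>_. 0" by simp

lift_definition plus_ell1 :: "'a ell1 \<Rightarrow> 'a ell1 \<Rightarrow> 'a ell1" is "\<lambda>x y n. x n + y n"
  by (rule summable_norm_add)

lift_definition uminus_ell1 :: "'a ell1 \<Rightarrow> 'a ell1" is "\<lambda>x n. - x n" by simp

lift_definition minus_ell1 :: "'a ell1 \<Rightarrow> 'a ell1 \<Rightarrow> 'a ell1" is "\<lambda>x y n. x n - y n"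
  subgoal for x y using summable_norm_add[of x "\<lambda>n. - y n"] by simp
  done

lift_definition scaleR_ell1 :: "real \<Rightarrow> 'a ell1 \<Rightarrow> 'a ell1" is "\<lambda>r x n. r *\<^sub>R x n"
  by (simp add: summable_mult)

lift_definition norm_ell1 :: "'a ell1 \<Rightarrow> real" is "\<lambda>x. \<Sum>n. norm (x n)" .

definition dist_ell1 :: "'a ell1 \<Rightarrow> 'a ell1 \<Rightarrow> real" where "dist_ell1 x y = norm (x - y)"

definition sgn_ell1 :: "'a ell1 \<Rightarrow> 'a ell1" where "sgn_ell1 x = inverse (norm x) *\<^sub>R x"

definition uniformity_ell1 :: "('a ell1 \<times> 'a ell1) filter" where
  "uniformity_ell1 = (INF e\<in>{0 <..}. principal {(x, y). dist x y < e})"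

definition open_ell1 :: "'a ell1 set \<Rightarrow> bool" where
  "open_ell1 U = (\<forall>x\<in>U. \<forall>\<^sub>F (x', y) in uniformity. x' = x \<longrightarrow> y \<in> U)"

instance
proof
  fix x y z :: "'a ell1" and a b :: real
  show "x + y + z = x + (y + z)" by transfer (simp add: add.assoc)
  show "x + y = y + x" by transfer (simp add: add.commute)
  show "0 + x = x" by transfer simp
  show "- x + x = 0" by transfer simp
  show "x - y = x + - y" by transfer simp
  show "a *\<^sub>R (x + y) = a *\<^sub>R x + a *\<^sub>R y" by transfer (simp add: scaleR_add_right)
  show "(a + b) *\<^sub>R x = a *\<^sub>R x + b *\<^sub>R x" by transfer (simp add: scaleR_add_left)
  show "a *\<^sub>R b *\<^sub>R x = (a * b) *\<^sub>R x" by transfer simp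
  show "1 *\<^sub>R x = x" by transfer simp
  show "(norm x = 0) = (x = 0)" by transfer (auto simp: suminf_eq_zero_iff)
  show "norm (x + y) \<le> norm x + norm y"
  proof transfer
    fix x y :: "nat \<Rightarrow> 'a"
    assume s: "summable (\<lambda>n. norm (x n))" "summable (\<lambda>n. norm (y n))"
    have "(\<Sum>n. norm (x n + y n)) \<le> (\<Sum>n. norm (x n) + norm (y n))"
      by (intro suminf_le summable_norm_add summable_add s norm_triangle_ineq)
    also have "\<dots> = (\<Sum>n. norm (x n)) + (\<Sum>n. norm (y n))" by (rule suminf_add[OF s, symmetric])
    finally show "(\<Sum>n. norm (x n + y n)) \<le> (\<Sum>n. norm (x n)) + (\<Sum>n. norm (y n))" .
  qed
  show "norm (a *\<^sub>R x) = \<bar>a\<bar> * norm x" by transfer (simp add: suminf_mult)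
qed (rule dist_ell1_def sgn_ell1_def open_ell1_def uniformity_ell1_def)+

end

lemma sum_le_norm_ell1: "(\<Sum>n<N. norm (ell1_nth x n)) \<le> norm x"
  unfolding norm_ell1.rep_eq by (rule sum_le_suminf[OF summable_ell1]) auto

lemma norm_ell1_nth_le: "norm (ell1_nth x n) \<le> norm x"
  using sum_le_norm_ell1[of x "Suc n"] sum_nonneg[of "{..<n}" "\<lambda>n. norm (ell1_nth x n)"] by simp

instance ell1 :: (banach) banach
proof
  fix X :: "nat \<Rightarrow> 'a ell1" assume X: "Cauchy X"
  have "Cauchy (\<lambda>k. ell1_nth (X k) n)" for n
  proof (rule metric_CauchyI)
    fix e :: real assume "e > 0"
    then obtain M where "\<And>m k. m \<ge> M \<Longrightarrow> k \<ge> M \<Longrightarrow> dist (X m) (X k) < e"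
      using metric_CauchyD[OF X] by blast
    then show "\<exists>M. \<forall>m\<ge>M. \<forall>k\<ge>M. dist (ell1_nth (X m) n) (ell1_nth (X k) n) < e"
      using norm_ell1_nth_le[of "X _ - X _" n] le_less_trans
      by (metis (no_types, lifting) dist_norm minus_ell1.rep_eq)
  qed
  then have "\<forall>n. \<exists>l. (\<lambda>k. ell1_nth (X k) n) \<longlonglongrightarrow> l"
    using Cauchy_convergent convergent_def by blast
  then obtain l where l: "\<And>n. (\<lambda>k. ell1_nth (X k) n) \<longlonglongrightarrow> l n" by metis
  have bnd: "(\<Sum>n<N. norm (ell1_nth (X m) n - l n)) \<le> e"
    if M: "\<And>m k. m \<ge> M \<Longrightarrow> k \<ge> M \<Longrightarrow> dist (X m) (X k) < e" and "m \<ge> M" for M m N and e :: real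
  proof (rule LIMSEQ_le_const2)
    show "(\<lambda>k. \<Sum>n<N. norm (ell1_nth (X m) n - ell1_nth (X k) n))
        \<longlonglongrightarrow> (\<Sum>n<N. norm (ell1_nth (X m) n - l n))"
      by (intro tendsto_intros l)
    show "\<exists>K. \<forall>k\<ge>K. (\<Sum>n<N. norm (ell1_nth (X m) n - ell1_nth (X k) n)) \<le> e"
    proof (intro exI allI impI)
      fix k assume "k \<ge> M"
      have "(\<Sum>n<N. norm (ell1_nth (X m) n - ell1_nth (X k) n)) \<le> norm (X m - X k)"
        using sum_le_norm_ell1[of "X m - X k" N] by (simp add: minus_ell1.rep_eq)
      also have "\<dots> \<le> e" using M[OF \<open>m \<ge> M\<close> \<open>k \<ge> M\<close>] by (simp add: dist_norm)
      finally show "(\<Sum>n<N. norm (ell1_nth (X m) n - ell1_nth (X k) n)) \<le> e" .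
    qed
  qed
  have summ: "summable (\<lambda>n. norm (ell1_nth (X m) n - l n))"
    if "\<And>m k. m \<ge> M \<Longrightarrow> k \<ge> M \<Longrightarrow> dist (X m) (X k) < e" "m \<ge> M" for M m and e :: real
    by (rule bounded_imp_summable[where B = e])
       (use bnd[OF that, of "Suc _"] in \<open>auto simp: lessThan_Suc_atMost\<close>)
  obtain M1 where M1: "\<And>m k. m \<ge> M1 \<Longrightarrow> k \<ge> M1 \<Longrightarrow> dist (X m) (X k) < 1"
    using metric_CauchyD[OF X, of 1] by auto
  have "summable (\<lambda>n. norm (ell1_nth (X M1) n) + norm (ell1_nth (X M1) n - l n))"
    by (intro summable_add summable_ell1 summ[OF M1]) auto
  then have sl: "summable (\<lambda>n. norm (l n))"
    by (rule summable_comparison_test')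
       (use norm_triangle_sub[of "l _" "ell1_nth (X M1) _"] in \<open>simp add: norm_minus_commute\<close>)
  have "X \<longlonglongrightarrow> Ell1 l"
  proof (rule metric_LIMSEQ_I)
    fix r :: real assume "r > 0"
    then obtain M where M: "\<And>m k. m \<ge> M \<Longrightarrow> k \<ge> M \<Longrightarrow> dist (X m) (X k) < r / 2"
      using metric_CauchyD[OF X, of "r/2"] by auto
    have "dist (X m) (Ell1 l) < r" if "m \<ge> M" for m
    proof -
      have "dist (X m) (Ell1 l) = (\<Sum>n. norm (ell1_nth (X m) n - l n))"
        using sl by (simp add: dist_norm norm_ell1.rep_eq minus_ell1.rep_eq Ell1_inverse)
      also have "\<dots> \<le> r / 2"
        by (intro suminf_le_const summ[OF M that] bnd[OF M that])
      finally show ?thesis using \<open>r > 0\<close> by simp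
    qed
    then show "\<exists>M. \<forall>m\<ge>M. dist (X m) (Ell1 l) < r" by blast
  qed
  then show "convergent X" by (rule convergentI)
qed

instance ell1 :: ("{real_normed_vector, second_countable_topology}") second_countable_topology
proof
  obtain Q :: "'a set" where Q: "countable Q" "\<And>U. open U \<Longrightarrow> U \<noteq> {} \<Longrightarrow> \<exists>q\<in>Q. q \<in> U"
    using countable_dense_exists by metis
  define emb where "emb xs = Ell1 (\<lambda>n. if n < length xs then xs ! n else 0)" for xs :: "'a list"
  have emb: "ell1_nth (emb xs) n = (if n < length xs then xs ! n else 0)" for xs n
    unfolding emb_def by (subst Ell1_inverse) (auto intro!: summable_finite[of "{..<length xs}"] split: if_splits)
  show "\<exists>B :: 'a ell1 set set. countable B \<and> open = generate_topology B"
  proof (rule second_countable_of_dense)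
    show "countable (emb ` lists Q)" using Q(1) by (intro countable_image countable_lists)
    fix x :: "'a ell1" and e :: real assume "e > 0"
    obtain N where "norm (\<Sum>n. norm (ell1_nth x (n + N))) < e / 2"
      using suminf_exist_split[OF _ summable_ell1[of x], of "e/2"] \<open>e > 0\<close> by auto
    then have N: "(\<Sum>n. norm (ell1_nth x (n + N))) < e / 2" by simp
    have "\<exists>q\<in>Q. dist (ell1_nth x n) q < e / (2 * real (Suc N))" for n
    proof -
      have "0 < e / (2 * real (Suc N))" using \<open>e > 0\<close> by (intro divide_pos_pos) auto
      then have "ball (ell1_nth x n) (e / (2 * real (Suc N))) \<noteq> {}"
        by (simp only: ball_eq_empty not_le)
      from Q(2)[OF open_ball this] show ?thesis by (simp only: mem_ball)
    qed
    then obtain q where q: "\<And>n. q n \<in> Q"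
      "\<And>n. dist (ell1_nth x n) (q n) < e / (2 * real (Suc N))" by metis
    let ?y = "emb (map q [0..<N])"
    have y: "ell1_nth (x - ?y) n = (if n < N then ell1_nth x n - q n else ell1_nth x n)" for n
      by (simp add: minus_ell1.rep_eq emb)
    have "norm (x - ?y)
        = (\<Sum>n. norm (ell1_nth (x - ?y) (n + N))) + (\<Sum>n<N. norm (ell1_nth (x - ?y) n))"
      unfolding norm_ell1.rep_eq by (rule suminf_split_initial_segment[OF summable_ell1])
    also have "(\<Sum>n. norm (ell1_nth (x - ?y) (n + N))) < e / 2" using N by (simp add: y)
    also have "(\<Sum>n<N. norm (ell1_nth (x - ?y) n)) \<le> (\<Sum>n<N. e / (2 * real (Suc N)))"
      using q(2) by (intro sum_mono) (auto simp: y dist_norm less_imp_le)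
    also have "\<dots> \<le> e / 2" using \<open>e > 0\<close> by (simp add: field_simps)
    finally have "dist x ?y < e" by (simp add: dist_norm)
    moreover have "?y \<in> emb ` lists Q" using q(1) by (intro imageI) auto
    ultimately show "\<exists>d\<in>emb ` lists Q. dist x d < e" by blast
  qed
qed

subsection \<open>The space $c_0$\<close>

typedef (overloaded) ('a::real_normed_vector) c0 = "{x :: nat \<Rightarrow> 'a. x \<longlonglongrightarrow> 0}"
  morphisms c0_nth C0
  by (rule exI[of _ "\<lambda>_. 0"]) simp

setup_lifting type_definition_c0

lemma c0_nth_tendsto: "c0_nth x \<longlonglongrightarrow> 0"
  using c0_nth[of x] by simp

lemma bdd_above_of_null:
  fixes x :: "nat \<Rightarrow> 'a::real_normed_vector"
  assumes "x \<longlonglongrightarrow> 0" shows "bdd_above (range (\<lambda>n. norm (x n)))"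
  using convergent_imp_Bseq[OF convergentI[OF assms]] by (auto simp: Bseq_def)

instantiation c0 :: (real_normed_vector) real_normed_vector
begin

lift_definition zero_c0 :: "'a c0" is "\<lambda>_. 0" by simp

lift_definition plus_c0 :: "'a c0 \<Rightarrow> 'a c0 \<Rightarrow> 'a c0" is "\<lambda>x y n. x n + y n"
  using tendsto_add_zero by blast

lift_definition uminus_c0 :: "'a c0 \<Rightarrow> 'a c0" is "\<lambda>x n. - x n"
  using tendsto_minus by fastforce

lift_definition minus_c0 :: "'a c0 \<Rightarrow> 'a c0 \<Rightarrow> 'a c0" is "\<lambda>x y n. x n - y n"
  using tendsto_diff by fastforce

lift_definition scaleR_c0 :: "real \<Rightarrow> 'a c0 \<Rightarrow> 'a c0" is "\<lambda>r x n. r *\<^sub>R x n"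
  using tendsto_scaleR[OF tendsto_const] by fastforce

lift_definition norm_c0 :: "'a c0 \<Rightarrow> real" is "\<lambda>x. SUP n. norm (x n)" .

definition dist_c0 :: "'a c0 \<Rightarrow> 'a c0 \<Rightarrow> real" where "dist_c0 x y = norm (x - y)"

definition sgn_c0 :: "'a c0 \<Rightarrow> 'a c0" where "sgn_c0 x = inverse (norm x) *\<^sub>R x"

definition uniformity_c0 :: "('a c0 \<times> 'a c0) filter" where
  "uniformity_c0 = (INF e\<in>{0 <..}. principal {(x, y). dist x y < e})"

definition open_c0 :: "'a c0 set \<Rightarrow> bool" where
  "open_c0 U = (\<forall>x\<in>U. \<forall>\<^sub>F (x', y) in uniformity. x' = x \<longrightarrow> y \<in> U)"

instance
proof
  fix x y z :: "'a c0" and a b :: real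
  show "x + y + z = x + (y + z)" by transfer (simp add: add.assoc)
  show "x + y = y + x" by transfer (simp add: add.commute)
  show "0 + x = x" by transfer simp
  show "- x + x = 0" by transfer simp
  show "x - y = x + - y" by transfer simp
  show "a *\<^sub>R (x + y) = a *\<^sub>R x + a *\<^sub>R y" by transfer (simp add: scaleR_add_right)
  show "(a + b) *\<^sub>R x = a *\<^sub>R x + b *\<^sub>R x" by transfer (simp add: scaleR_add_left)
  show "a *\<^sub>R b *\<^sub>R x = (a * b) *\<^sub>R x" by transfer simp
  show "1 *\<^sub>R x = x" by transfer simp
  show "(norm x = 0) = (x = 0)"
  proof transfer
    fix x :: "nat \<Rightarrow> 'a" assume "x \<longlonglongrightarrow> 0"
    note b = bdd_above_of_null[OF this]
    show "((SUP n. norm (x n)) = 0) = (x = (\<lambda>_. 0))"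
    proof
      assume "(SUP n. norm (x n)) = 0"
      then have "norm (x n) \<le> 0" for n using cSUP_upper[OF _ b, of n] by simp
      then show "x = (\<lambda>_. 0)" by auto
    qed simp
  qed
  show "norm (x + y) \<le> norm x + norm y"
  proof transfer
    fix x y :: "nat \<Rightarrow> 'a" assume "x \<longlonglongrightarrow> 0" "y \<longlonglongrightarrow> 0"
    note b = this[THEN bdd_above_of_null]
    show "(SUP n. norm (x n + y n)) \<le> (SUP n. norm (x n)) + (SUP n. norm (y n))"
      by (intro cSUP_least order_trans[OF norm_triangle_ineq] add_mono cSUP_upper b) auto
  qed
  show "norm (a *\<^sub>R x) = \<bar>a\<bar> * norm x"
  proof transfer
    fix a and x :: "nat \<Rightarrow> 'a" assume "x \<longlonglongrightarrow> 0"
    note b = bdd_above_of_null[OF this]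
    have "\<bar>a\<bar> * (SUP n. norm (x n)) = (SUP n. \<bar>a\<bar> * norm (x n))"
      by (rule continuous_at_Sup_mono[where f = "(*) \<bar>a\<bar>" and S = "range (\<lambda>n. norm (x n))",
            unfolded image_image])
         (auto intro!: monoI mult_left_mono continuous_intros b)
    then show "(SUP n. norm (a *\<^sub>R x n)) = \<bar>a\<bar> * (SUP n. norm (x n))" by simp
  qed
qed (rule dist_c0_def sgn_c0_def open_c0_def uniformity_c0_def)+

end

instance c0 :: ("{real_normed_vector, second_countable_topology}") second_countable_topology
proof
  obtain Q :: "'a set" where Q: "countable Q" "\<And>U. open U \<Longrightarrow> U \<noteq> {} \<Longrightarrow> \<exists>q\<in>Q. q \<in> U"
    using countable_dense_exists by metis
  define emb where "emb xs = C0 (\<lambda>n. if n < length xs then xs ! n else 0)" for xs :: "'a list"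
  have emb: "c0_nth (emb xs) n = (if n < length xs then xs ! n else 0)" for xs n
  proof -
    have "(\<lambda>n. if n < length xs then xs ! n else 0) \<longlonglongrightarrow> 0"
      by (rule tendsto_eventually) (auto simp: eventually_sequentially intro!: exI[of _ "length xs"])
    then show ?thesis unfolding emb_def by (subst C0_inverse) auto
  qed
  show "\<exists>B :: 'a c0 set set. countable B \<and> open = generate_topology B"
  proof (rule second_countable_of_dense)
    show "countable (emb ` lists Q)" using Q(1) by (intro countable_image countable_lists)
    fix x :: "'a c0" and e :: real assume "e > 0"
    obtain N where N: "\<And>n. n \<ge> N \<Longrightarrow> norm (c0_nth x n) < e / 2"
      using LIMSEQ_D[OF c0_nth_tendsto[of x], of "e/2"] \<open>e > 0\<close> by auto
    have "\<exists>q\<in>Q. dist (c0_nth x n) q < e / 2" for n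
      using Q(2)[of "ball (c0_nth x n) (e / 2)"] \<open>e > 0\<close> by auto
    then obtain q where q: "\<And>n. q n \<in> Q" "\<And>n. dist (c0_nth x n) (q n) < e / 2" by metis
    let ?y = "emb (map q [0..<N])"
    have "norm (c0_nth (x - ?y) n) \<le> e / 2" for n
      using N[of n] q(2)[of n] by (auto simp: minus_c0.rep_eq emb dist_norm)
    then have "norm (x - ?y) \<le> e / 2" unfolding norm_c0.rep_eq by (intro cSUP_least) auto
    then have "dist x ?y < e" using \<open>e > 0\<close> by (simp add: dist_norm)
    moreover have "?y \<in> emb ` lists Q" using q(1) by (intro imageI) auto
    ultimately show "\<exists>d\<in>emb ` lists Q. dist x d < e" by blast
  qed
qed

section \<open>The Bochner space $L^\infty([0,1],\ell^1)$\<close>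

text \<open>
  $\ell^1$ is separable, so Borel measurability coincides with strong (Bochner) measurability.
  The scalar type \<open>'k\<close> of sort \<open>{real_normed_field, euclidean_space}\<close> covers
  \<open>real\<close> and \<open>complex\<close>.
\<close>

abbreviation unit_leb :: "real measure" where
  "unit_leb \<equiv> lebesgue_on {0..1}"

definition ess_bounded :: "(real \<Rightarrow> 'a::real_normed_vector) \<Rightarrow> bool" where
  "ess_bounded f \<longleftrightarrow> f \<in> borel_measurable unit_leb \<and>
     esssup unit_leb (\<lambda>s. ereal (norm (f s))) < \<infinity>"

lemma esssup_norm_nonneg:
  fixes f :: "real \<Rightarrow> 'a::real_normed_vector"
  shows "0 \<le> esssup unit_leb (\<lambda>s. ereal (norm (f s)))"
proof (rule ccontr)
  assume "\<not> ?thesis"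
  then have "AE s in unit_leb. False"
    using esssup_AE[of "\<lambda>s. ereal (norm (f s))" unit_leb]
    by (elim eventually_mono) (metis ereal_less_eq(5) norm_ge_zero order_trans)
  then have "emeasure unit_leb (space unit_leb) = 0"
    using ae_filter_eq_bot_iff[of unit_leb] by (simp add: trivial_limit_def)
  then show False by (simp add: emeasure_restrict_space space_restrict_space)
qed

lemma ess_boundedI:
  assumes "f \<in> borel_measurable unit_leb" "AE s in unit_leb. norm (f s) \<le> C"
  shows "ess_bounded f"
proof -
  have "esssup unit_leb (\<lambda>s. ereal (norm (f s))) \<le> ereal C"
    using assms by (intro esssup_I) auto
  then show ?thesis using assms(1) unfolding ess_bounded_def by (auto simp: less_ereal.simps(4)
    intro: le_less_trans)
qed

lemma ess_bounded_AE:
  assumes "ess_bounded f"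
  shows "AE s in unit_leb. norm (f s) \<le> real_of_ereal (esssup unit_leb (\<lambda>s. ereal (norm (f s))))"
proof -
  have "esssup unit_leb (\<lambda>s. ereal (norm (f s)))
      = ereal (real_of_ereal (esssup unit_leb (\<lambda>s. ereal (norm (f s)))))"
    using assms esssup_norm_nonneg[of f] by (auto simp: ess_bounded_def ereal_real)
  with esssup_AE[of "\<lambda>s. ereal (norm (f s))" unit_leb] show ?thesis
    by (metis (no_types, lifting) eventually_mono ereal_less_eq(3))
qed

lemma ess_bounded_measurable: "ess_bounded f \<Longrightarrow> f \<in> borel_measurable unit_leb"
  by (simp add: ess_bounded_def)

lemma ess_bounded_norm_measurable:
  "ess_bounded f \<Longrightarrow> (\<lambda>s. ereal (norm (f s))) \<in> borel_measurable unit_leb"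
  by (intro borel_measurable_ereal
      measurable_compose[OF ess_bounded_measurable borel_measurable_continuous_onI]
      continuous_on_norm_id)

lemma real_esssup_le:
  assumes "f \<in> borel_measurable unit_leb" "AE s in unit_leb. norm (f s) \<le> C"
  shows "real_of_ereal (esssup unit_leb (\<lambda>s. ereal (norm (f s)))) \<le> C"
proof -
  have "esssup unit_leb (\<lambda>s. ereal (norm (f s))) \<le> ereal C"
    using assms by (intro esssup_I) auto
  then show ?thesis using esssup_norm_nonneg[of f]
    by (cases "esssup unit_leb (\<lambda>s. ereal (norm (f s)))") auto
qed

quotient_type (overloaded) 'k linf =
    "real \<Rightarrow> ('k::{real_normed_field, euclidean_space}) ell1" /
  partial: "\<lambda>f g. ess_bounded f \<and> ess_bounded g \<and> (AE s in unit_leb. f s = g s)"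
proof (rule part_equivpI)
  show "\<exists>f :: real \<Rightarrow> 'k ell1. ess_bounded f \<and> ess_bounded f \<and> (AE s in unit_leb. f s = f s)"
    by (rule exI[of _ "\<lambda>_. 0"]) (auto intro: ess_boundedI[of _ 0])
  show "symp (\<lambda>f g :: real \<Rightarrow> 'k ell1.
      ess_bounded f \<and> ess_bounded g \<and> (AE s in unit_leb. f s = g s))"
    by (auto simp: symp_def elim: eventually_mono)
  show "transp (\<lambda>f g :: real \<Rightarrow> 'k ell1.
      ess_bounded f \<and> ess_bounded g \<and> (AE s in unit_leb. f s = g s))"
    by (auto simp: transp_def elim: eventually_elim2)
qed

lemma rep_linf:
  "ess_bounded (rep_linf f)"
  using Quotient3_rep_reflp[OF Quotient3_linf, of f] by simp

lemma rep_abs_linf: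
  "ess_bounded f \<Longrightarrow> AE s in unit_leb. rep_linf (abs_linf f) s = f s"
  using rep_abs_rsp_left[OF Quotient3_linf, of f f] by simp

lemma ess_bounded_add:
  fixes f g :: "real \<Rightarrow> 'k::{real_normed_field, euclidean_space} ell1"
  assumes f: "ess_bounded f" and g: "ess_bounded g"
  shows "ess_bounded (\<lambda>s. f s + g s)"
proof (rule ess_boundedI)
  show "(\<lambda>s. f s + g s) \<in> borel_measurable unit_leb"
    using f g by (intro borel_measurable_add ess_bounded_measurable)
  show "AE s in unit_leb. norm (f s + g s)
      \<le> real_of_ereal (esssup unit_leb (\<lambda>s. ereal (norm (f s))))
        + real_of_ereal (esssup unit_leb (\<lambda>s. ereal (norm (g s))))"
    using ess_bounded_AE[OF f] ess_bounded_AE[OF g]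
    by eventually_elim (rule order_trans[OF norm_triangle_ineq add_mono])
qed

lemma ess_bounded_linear:
  fixes f :: "real \<Rightarrow> 'k::{real_normed_field, euclidean_space} ell1"
    and h :: "'k ell1 \<Rightarrow> 'k ell1"
  assumes f: "ess_bounded f" and h: "bounded_linear h"
  shows "ess_bounded (\<lambda>s. h (f s))"
proof -
  obtain K where K: "\<And>x. norm (h x) \<le> norm x * K" "K > 0"
    using bounded_linear.pos_bounded[OF h] by blast
  show ?thesis
  proof (rule ess_boundedI)
    show "(\<lambda>s. h (f s)) \<in> borel_measurable unit_leb"
      by (rule measurable_compose[OF ess_bounded_measurable[OF f] borel_measurable_continuous_onI])
         (rule linear_continuous_on[OF h])
    show "AE s in unit_leb. norm (h (f s))
        \<le> real_of_ereal (esssup unit_leb (\<lambda>s. ereal (norm (f s)))) * K"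
      using ess_bounded_AE[OF f]
      by eventually_elim (meson K less_imp_le mult_right_mono order_trans)
  qed
qed

lemmas ess_bounded_scaleR = ess_bounded_linear[OF _ bounded_linear_scaleR_right]

lemmas ess_bounded_uminus = ess_bounded_linear[OF _ bounded_linear_minus[OF bounded_linear_ident]]

lemma AE_eq_combine:
  assumes "AE s in M. f s = f' s" "AE s in M. g s = g' s"
  shows "AE s in M. h (f s) (g s) = h (f' s) (g' s)"
  using assms by eventually_elim simp

instantiation linf :: ("{real_normed_field, euclidean_space}") real_normed_vector
begin

lift_definition zero_linf :: "'a linf" is "\<lambda>_. 0"
  by (auto intro: ess_boundedI[of _ 0])

lift_definition plus_linf :: "'a linf \<Rightarrow> 'a linf \<Rightarrow> 'a linf" is "\<lambda>f g s. f s + g s"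
  subgoal for f f' g g'
    using ess_bounded_add[of f g] ess_bounded_add[of f' g']
      AE_eq_combine[of f f' unit_leb g g' "(+)"] by simp
  done

lift_definition uminus_linf :: "'a linf \<Rightarrow> 'a linf" is "\<lambda>f s. - f s"
  by (auto intro: ess_bounded_uminus elim: eventually_mono)

lift_definition minus_linf :: "'a linf \<Rightarrow> 'a linf \<Rightarrow> 'a linf" is "\<lambda>f g s. f s - g s"
  subgoal for f f' g g'
    using ess_bounded_add[of f "\<lambda>s. - g s"] ess_bounded_add[of f' "\<lambda>s. - g' s"]
      ess_bounded_uminus[of g] ess_bounded_uminus[of g']
      AE_eq_combine[of f f' unit_leb g g' "(-)"] by simp
  done

lift_definition scaleR_linf :: "real \<Rightarrow> 'a linf \<Rightarrow> 'a linf" is "\<lambda>r f s. r *\<^sub>R f s"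
  by (auto intro: ess_bounded_scaleR elim: eventually_mono)

lift_definition norm_linf :: "'a linf \<Rightarrow> real"
  is "\<lambda>f. real_of_ereal (esssup unit_leb (\<lambda>s. ereal (norm (f s))))"
  subgoal for f f'
    using ess_bounded_norm_measurable[of f] ess_bounded_norm_measurable[of f']
      AE_eq_combine[of f f' unit_leb f f' "\<lambda>x _. ereal (norm x)"]
    by (auto intro!: arg_cong[of _ _ real_of_ereal] esssup_AE_cong)
  done

definition dist_linf :: "'a linf \<Rightarrow> 'a linf \<Rightarrow> real" where "dist_linf f g = norm (f - g)"

definition sgn_linf :: "'a linf \<Rightarrow> 'a linf" where "sgn_linf f = inverse (norm f) *\<^sub>R f"

definition uniformity_linf :: "('a linf \<times> 'a linf) filter" where
  "uniformity_linf = (INF e\<in>{0 <..}. principal {(x, y). dist x y < e})"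

definition open_linf :: "'a linf set \<Rightarrow> bool" where
  "open_linf U = (\<forall>x\<in>U. \<forall>\<^sub>F (x', y) in uniformity. x' = x \<longrightarrow> y \<in> U)"

instance
proof
  fix x y z :: "'a linf" and a b :: real
  show "x + y + z = x + (y + z)"
    by transfer (auto simp: add.assoc intro!: ess_bounded_add)
  show "x + y = y + x" by transfer (auto simp: add.commute intro!: ess_bounded_add)
  show "0 + x = x" by transfer auto
  show "- x + x = 0" by transfer (auto intro: ess_boundedI[of _ 0])
  show "x - y = x + - y"
  proof transfer
    fix f g :: "real \<Rightarrow> 'a ell1"
    assume "ess_bounded f \<and> ess_bounded f \<and> (AE s in unit_leb. f s = f s)"
      and "ess_bounded g \<and> ess_bounded g \<and> (AE s in unit_leb. g s = g s)"
    then show "ess_bounded (\<lambda>s. f s - g s) \<and> ess_bounded (\<lambda>s. f s + - g s) \<and>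
        (AE s in unit_leb. f s - g s = f s + - g s)"
      using ess_bounded_add[of f "\<lambda>s. - g s"] ess_bounded_uminus[of g] by simp
  qed
  show "a *\<^sub>R (x + y) = a *\<^sub>R x + a *\<^sub>R y"
    by transfer (auto simp: scaleR_add_right
        intro!: ess_bounded_add ess_bounded_scaleR)
  show "(a + b) *\<^sub>R x = a *\<^sub>R x + b *\<^sub>R x"
    by transfer (auto simp: scaleR_add_left
        intro!: ess_bounded_add ess_bounded_scaleR)
  show "a *\<^sub>R b *\<^sub>R x = (a * b) *\<^sub>R x"
    by transfer (auto intro!: ess_bounded_scaleR)
  show "1 *\<^sub>R x = x" by transfer simp
  show "(norm x = 0) = (x = 0)"
  proof transfer
    fix f :: "real \<Rightarrow> 'a ell1"
    assume "ess_bounded f \<and> ess_bounded f \<and> (AE s in unit_leb. f s = f s)"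
    then have f: "ess_bounded f" by simp
    show "(real_of_ereal (esssup unit_leb (\<lambda>s. ereal (norm (f s)))) = 0) =
        (ess_bounded f \<and> ess_bounded (\<lambda>_. 0 :: 'a ell1) \<and> (AE s in unit_leb. f s = 0))" (is "?L = ?R")
    proof
      assume ?L
      then show ?R using ess_bounded_AE[OF f] f by (auto intro: ess_boundedI[of _ 0])
    next
      assume ?R
      then have "real_of_ereal (esssup unit_leb (\<lambda>s. ereal (norm (f s)))) \<le> 0"
        by (intro real_esssup_le ess_bounded_measurable f) (auto elim: eventually_mono)
      then show ?L using esssup_norm_nonneg[of f] by (simp add: real_of_ereal_pos antisym)
    qed
  qed
  show "norm (x + y) \<le> norm x + norm y"
  proof transfer
    fix f g :: "real \<Rightarrow> 'a ell1"
    assume "ess_bounded f \<and> ess_bounded f \<and> (AE s in unit_leb. f s = f s)"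
      and "ess_bounded g \<and> ess_bounded g \<and> (AE s in unit_leb. g s = g s)"
    then have f: "ess_bounded f" and g: "ess_bounded g" by auto
    show "real_of_ereal (esssup unit_leb (\<lambda>s. ereal (norm (f s + g s))))
      \<le> real_of_ereal (esssup unit_leb (\<lambda>s. ereal (norm (f s))))
        + real_of_ereal (esssup unit_leb (\<lambda>s. ereal (norm (g s))))"
    proof (rule real_esssup_le[OF ess_bounded_measurable[OF ess_bounded_add[OF f g]]])
      show "AE s in unit_leb. norm (f s + g s)
        \<le> real_of_ereal (esssup unit_leb (\<lambda>s. ereal (norm (f s))))
          + real_of_ereal (esssup unit_leb (\<lambda>s. ereal (norm (g s))))"
        using ess_bounded_AE[OF f] ess_bounded_AE[OF g]
        by eventually_elim (rule order_trans[OF norm_triangle_ineq add_mono])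
    qed
  qed
  show "norm (a *\<^sub>R x) = \<bar>a\<bar> * norm x"
  proof (cases "a = 0")
    case True
    then show ?thesis
      by transfer (auto simp: esssup_const emeasure_restrict_space space_restrict_space)
  next
    case False
    then have "0 < \<bar>a\<bar>" by simp
    then show ?thesis
    proof transfer
      fix a :: real and f :: "real \<Rightarrow> 'a ell1" assume "0 < \<bar>a\<bar>"
      then show "real_of_ereal (esssup unit_leb (\<lambda>s. ereal (norm (a *\<^sub>R f s))))
          = \<bar>a\<bar> * real_of_ereal (esssup unit_leb (\<lambda>s. ereal (norm (f s))))"
        using esssup_cmult[of "\<bar>a\<bar>" unit_leb "\<lambda>s. ereal (norm (f s))"] by simp
    qed
  qed
qed (rule dist_linf_def sgn_linf_def open_linf_def uniformity_linf_def)+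

end

lift_definition scale_ell1 :: "'k::real_normed_field \<Rightarrow> 'k ell1 \<Rightarrow> 'k ell1" is "\<lambda>c x n. c * x n"
  by (simp add: norm_mult summable_mult)

lemma bounded_linear_scale_ell1: "bounded_linear (scale_ell1 c)"
proof (rule bounded_linear_intro)
  show "scale_ell1 c (x + y) = scale_ell1 c x + scale_ell1 c y" for x y
    by transfer (simp add: distrib_left)
  show "scale_ell1 c (r *\<^sub>R x) = r *\<^sub>R scale_ell1 c x" for r x by transfer simp
  show "norm (scale_ell1 c x) \<le> norm x * norm c" for x
    by transfer (simp add: norm_mult suminf_mult mult.commute)
qed

lift_definition scale_linf ::
    "'k::{real_normed_field, euclidean_space} \<Rightarrow> 'k linf \<Rightarrow> 'k linf"
  is "\<lambda>c f s. scale_ell1 c (f s)"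
  by (auto intro: ess_bounded_linear bounded_linear_scale_ell1 elim: eventually_mono)

definition Linf :: "nat set \<Rightarrow> 'k::{real_normed_field, euclidean_space} linf set" where
  "Linf J = {f. AE s in unit_leb. \<forall>n. n \<notin> J \<longrightarrow> ell1_nth (rep_linf f s) n = 0}"

subsection \<open>The weak$^*$-topology induced by $L^1([0,1],c_0)$\<close>

text \<open>
  Elements of $L^1([0,1],c_0(J))$ are represented by functions; functions equal almost
  everywhere define the same functional on \<open>Linf J\<close>.
\<close>

definition L1_c0 :: "nat set \<Rightarrow> (real \<Rightarrow> 'k::{real_normed_field, euclidean_space} c0) set" where
  "L1_c0 J = {g. integrable unit_leb g \<and>
     (AE s in unit_leb. \<forall>n. n \<notin> J \<longrightarrow> c0_nth (g s) n = 0)}"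

definition pairing ::
    "'k::{real_normed_field, euclidean_space} linf \<Rightarrow> (real \<Rightarrow> 'k c0) \<Rightarrow> 'k" where
  "pairing f g = (LINT s|unit_leb. (\<Sum>n. ell1_nth (rep_linf f s) n * c0_nth (g s) n))"

definition weak_star :: "nat set \<Rightarrow> 'k::{real_normed_field, euclidean_space} linf topology" where
  "weak_star J = topology_generated_by
     {{f \<in> Linf J. pairing f g \<in> U} | g U. g \<in> L1_c0 J \<and> open U}"

section \<open>Bi-continuous semigroups\<close>

text \<open>
  The Banach space is a complete linear subspace \<open>X\<close> of a normed space; \<open>scale\<close> is
  multiplication by scalars from \<open>'k\<close>.
\<close>

locale banach_space_on = vector_space scale
  for scale :: "'k::real_normed_field \<Rightarrow> 'a::real_normed_vector \<Rightarrow> 'a" +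
  fixes X :: "'a set"
  assumes norm_scale: "norm (scale c x) = norm c * norm x"
    and scale_of_real: "scale (of_real r) x = r *\<^sub>R x"
    and subspace_X: "module.subspace scale X"
    and complete_X: "complete X"
begin

definition linear_functional :: "('a \<Rightarrow> 'k) \<Rightarrow> bool" where
  "linear_functional \<phi> \<longleftrightarrow>
     (\<forall>x\<in>X. \<forall>y\<in>X. \<phi> (x + y) = \<phi> x + \<phi> y) \<and> (\<forall>c. \<forall>x\<in>X. \<phi> (scale c x) = c * \<phi> x)"

definition bounded_operator :: "('a \<Rightarrow> 'a) \<Rightarrow> bool" where
  "bounded_operator S \<longleftrightarrow> S \<in> X \<rightarrow> X \<and>
     (\<forall>x\<in>X. \<forall>y\<in>X. S (x + y) = S x + S y) \<and>
     (\<forall>c. \<forall>x\<in>X. S (scale c x) = scale c (S x)) \<and>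
     (\<exists>K. \<forall>x\<in>X. norm (S x) \<le> K * norm x)"

end

locale bicontinuous_space = banach_space_on scale X
  for scale :: "'k::real_normed_field \<Rightarrow> 'a::real_normed_vector \<Rightarrow> 'a" and X :: "'a set" +
  fixes \<tau> :: "'a topology"
  assumes topspace_tau: "topspace \<tau> = X"
    and continuous_add: "continuous_map (prod_topology \<tau> \<tau>) \<tau> (\<lambda>(x, y). x + y)"
    and continuous_scale: "continuous_map (prod_topology euclidean \<tau>) \<tau> (\<lambda>(c, x). scale c x)"
    and locally_convex: "\<lbrakk>openin \<tau> U; x \<in> U\<rbrakk> \<Longrightarrow> \<exists>C. openin \<tau> C \<and> convex C \<and> x \<in> C \<and> C \<subseteq> U"
    and hausdorff: "Hausdorff_space \<tau>"
    and coarser: "openin \<tau> U \<Longrightarrow> openin (top_of_set X) U"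
    and sequentially_complete:
      "\<lbrakk>range F \<subseteq> X; bounded (range F);
        \<And>U. openin \<tau> U \<Longrightarrow> 0 \<in> U \<Longrightarrow> \<exists>N. \<forall>m\<ge>N. \<forall>n\<ge>N. F m - F n \<in> U\<rbrakk>
       \<Longrightarrow> \<exists>l. limitin \<tau> F l sequentially"
    and norming:
      "x \<in> X \<Longrightarrow> norm x =
         (SUP \<phi> \<in> {\<phi>. linear_functional \<phi> \<and> continuous_map \<tau> euclidean \<phi> \<and>
                     (\<forall>y\<in>X. norm (\<phi> y) \<le> norm y)}. norm (\<phi> x))"

locale bicontinuous_semigroup = bicontinuous_space scale X \<tau>
  for scale :: "'k::real_normed_field \<Rightarrow> 'a::real_normed_vector \<Rightarrow> 'a" and X :: "'a set"
    and \<tau> :: "'a topology" +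
  fixes T :: "real \<Rightarrow> 'a \<Rightarrow> 'a"
  assumes bounded_operator: "t \<ge> 0 \<Longrightarrow> bounded_operator (T t)"
    and zero: "f \<in> X \<Longrightarrow> T 0 f = f"
    and add: "\<lbrakk>t \<ge> 0; s \<ge> 0; f \<in> X\<rbrakk> \<Longrightarrow> T (t + s) f = T t (T s f)"
    and strongly_continuous: "f \<in> X \<Longrightarrow> continuous_map (top_of_set {0..}) \<tau> (\<lambda>t. T t f)"
    and exponentially_bounded:
      "\<exists>M\<ge>1. \<exists>\<omega>. \<forall>t\<ge>0. \<forall>f\<in>X. norm (T t f) \<le> M * exp (\<omega> * t) * norm f"
    and locally_bi_equicontinuous:
      "\<lbrakk>range F \<subseteq> X; bounded (range F); limitin \<tau> F 0 sequentially; t0 \<ge> 0; openin \<tau> U; 0 \<in> U\<rbrakk>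
       \<Longrightarrow> \<forall>\<^sub>F n in sequentially. \<forall>s\<in>{0..t0}. T s (F n) \<in> U"

locale contraction_bicontinuous_semigroup = bicontinuous_semigroup scale X \<tau> T
  for scale :: "'k::real_normed_field \<Rightarrow> 'a::real_normed_vector \<Rightarrow> 'a" and X :: "'a set"
    and \<tau> :: "'a topology" and T :: "real \<Rightarrow> 'a \<Rightarrow> 'a" +
  assumes contraction: "\<lbrakk>t \<ge> 0; f \<in> X\<rbrakk> \<Longrightarrow> norm (T t f) \<le> norm f"

text \<open>Unbounded operators are represented by their graphs.\<close>

definition bicontinuous_generator ::
    "'a::real_normed_vector set \<Rightarrow> 'a topology \<Rightarrow> (real \<Rightarrow> 'a \<Rightarrow> 'a) \<Rightarrow> ('a \<times> 'a) set" where
  "bicontinuous_generator X \<tau> T =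
     {(f, g). f \<in> X \<and>
        limitin \<tau> (\<lambda>t. (1 / t) *\<^sub>R (T t f - f)) g (at_right 0) \<and>
        bdd_above ((\<lambda>t. norm (T t f - f) / t) ` {0<..1})}"

section \<open>The weighted adjacency matrix of the line graph\<close>

text \<open>
  The edge index set is \<open>arcs G :: nat set\<close>, the edge $e_j$ being \<open>(tail G j, head G j)\<close>.
\<close>

locale weighted_network = loopfree_digraph G + nomulti_digraph G
  for G :: "('v, nat) pre_digraph" +
  fixes w :: "nat \<Rightarrow> nat \<Rightarrow> real"
  assumes countable_verts: "countable (verts G)"
    and locally_finite: "v \<in> verts G \<Longrightarrow> finite (in_arcs G v) \<and> finite (out_arcs G v)"
    and weight_range: "\<lbrakk>i \<in> arcs G; j \<in> arcs G\<rbrakk> \<Longrightarrow> 0 \<le> w i j \<and> w i j \<le> 1"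
    and weight_support: "\<lbrakk>i \<in> arcs G; j \<in> arcs G; w i j \<noteq> 0\<rbrakk> \<Longrightarrow> head G j = tail G i"
    and weight_sum: "j \<in> arcs G \<Longrightarrow> ((\<lambda>i. w i j) has_sum 1) (arcs G)"

definition adjacency :: "('v, nat) pre_digraph \<Rightarrow> (nat \<Rightarrow> nat \<Rightarrow> real) \<Rightarrow> nat \<Rightarrow> nat \<Rightarrow> real" where
  "adjacency G w i j =
     (if i \<in> arcs G \<and> j \<in> arcs G \<and> head G j = tail G i then w i j else 0)"

definition adjacency_op ::
    "('v, nat) pre_digraph \<Rightarrow> (nat \<Rightarrow> nat \<Rightarrow> real) \<Rightarrow> 'k::{real_normed_field, banach} ell1 \<Rightarrow> 'k ell1" where
  "adjacency_op G w x = Ell1 (\<lambda>i. \<Sum>j. of_real (adjacency G w i j) * ell1_nth x j)"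

context weighted_network
begin

lemma adjacency_nonneg: "0 \<le> adjacency G w i j"
  using weight_range by (auto simp: adjacency_def)

lemma adjacency_le_1: "adjacency G w i j \<le> 1"
  using weight_range by (auto simp: adjacency_def)

lemma sum_adjacency_le_1:
  assumes "finite I" shows "(\<Sum>i\<in>I. adjacency G w i j) \<le> 1"
proof (cases "j \<in> arcs G")
  case True
  have "(\<Sum>i\<in>I. adjacency G w i j) = (\<Sum>i\<in>I \<inter> arcs G. adjacency G w i j)"
    using assms by (intro sum.mono_neutral_right) (auto simp: adjacency_def)
  also have "\<dots> \<le> (\<Sum>i\<in>I \<inter> arcs G. w i j)"
    using weight_range True by (intro sum_mono) (auto simp: adjacency_def)
  also have "\<dots> \<le> 1"
    using weight_range True assms
    by (intro finite_sum_le_has_sum[OF weight_sum]) auto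
  finally show ?thesis .
qed (simp add: adjacency_def)

text \<open>The series defining \<open>adjacency_op G w x\<close> converge and define an element of $\ell^1$.\<close>

lemma summable_adjacency_row:
  fixes x :: "'k::{real_normed_field, banach} ell1"
  shows "summable (\<lambda>j. norm (of_real (adjacency G w i j) * ell1_nth x j))"
  using summable_ell1[of x]
  by (rule summable_comparison_test')
     (use adjacency_nonneg adjacency_le_1 in \<open>simp add: norm_mult mult_left_le_one_le\<close>)

lemma adjacency_op_nth:
  fixes x :: "'k::{real_normed_field, banach} ell1"
  shows "ell1_nth (adjacency_op G w x) i = (\<Sum>j. of_real (adjacency G w i j) * ell1_nth x j)"
proof -
  let ?y = "\<lambda>i. \<Sum>j. of_real (adjacency G w i j) * ell1_nth x j"
  have "(\<Sum>i\<le>N. norm (?y i)) \<le> norm x" for N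
  proof -
    let ?a = "\<lambda>i j. norm (of_real (adjacency G w i j) * ell1_nth x j)"
    have "(\<Sum>i\<le>N. norm (?y i)) \<le> (\<Sum>i\<le>N. \<Sum>j. ?a i j)"
      by (intro sum_mono summable_norm summable_adjacency_row)
    also have "\<dots> = (\<Sum>j. \<Sum>i\<le>N. ?a i j)"
      by (rule suminf_sum[symmetric]) (rule summable_adjacency_row)
    also have "\<dots> \<le> (\<Sum>j. norm (ell1_nth x j))"
    proof (rule suminf_le)
      fix j
      have "(\<Sum>i\<le>N. ?a i j) = (\<Sum>i\<le>N. adjacency G w i j) * norm (ell1_nth x j)"
        by (simp add: norm_mult adjacency_nonneg sum_distrib_right)
      also have "\<dots> \<le> norm (ell1_nth x j)"
        by (intro mult_left_le_one_le sum_adjacency_le_1 sum_nonneg adjacency_nonneg) auto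
      finally show "(\<Sum>i\<le>N. ?a i j) \<le> norm (ell1_nth x j)" .
    qed (auto intro: summable_sum summable_adjacency_row summable_ell1)
    finally show ?thesis by (simp add: norm_ell1.rep_eq)
  qed
  then have "summable (\<lambda>i. norm (?y i))" by (intro bounded_imp_summable) auto
  then show ?thesis by (simp add: adjacency_op_def Ell1_inverse)
qed

end

section \<open>The operator $\mathrm{diag}(d/dx)$ with boundary condition $v(1) = \mathbb{B} v(0)$\<close>

definition test_function :: "(real \<Rightarrow> real) \<Rightarrow> bool" where
  "test_function \<phi> \<longleftrightarrow> (\<forall>n x. (deriv ^^ n) \<phi> field_differentiable at x) \<and>
     closure {x. \<phi> x \<noteq> 0} \<subseteq> {0<..<1}"

text \<open>
  The integrals are Bochner integrals in $\ell^1$.  Since coordinates are bounded functionals,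
  the weak derivative of \<open>v\<close> is the coordinatewise one.
\<close>

definition has_weak_derivative ::
    "'k::{real_normed_field, euclidean_space} linf \<Rightarrow> 'k linf \<Rightarrow> bool" where
  "has_weak_derivative v v' \<longleftrightarrow> (\<forall>\<phi>. test_function \<phi> \<longrightarrow>
     (LINT s|unit_leb. deriv \<phi> s *\<^sub>R rep_linf v s) = - (LINT s|unit_leb. \<phi> s *\<^sub>R rep_linf v' s))"

definition W1inf :: "nat set \<Rightarrow> 'k::{real_normed_field, euclidean_space} linf set" where
  "W1inf J = {v \<in> Linf J. \<exists>v'\<in>Linf J. has_weak_derivative v v'}"

definition continuous_representative ::
    "'k::{real_normed_field, euclidean_space} linf \<Rightarrow> (real \<Rightarrow> 'k ell1) \<Rightarrow> bool" where
  "continuous_representative v u \<longleftrightarrow>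
     continuous_on {0..1} u \<and> (AE s in unit_leb. u s = rep_linf v s)"

definition flow_domain ::
    "('v, nat) pre_digraph \<Rightarrow> (nat \<Rightarrow> nat \<Rightarrow> real)
      \<Rightarrow> 'k::{real_normed_field, euclidean_space} linf set" where
  "flow_domain G w = {v \<in> W1inf (arcs G).
     \<exists>u. continuous_representative v u \<and> u 1 = adjacency_op G w (u 0)}"

definition flow_operator ::
    "('v, nat) pre_digraph \<Rightarrow> (nat \<Rightarrow> nat \<Rightarrow> real)
      \<Rightarrow> ('k::{real_normed_field, euclidean_space} linf \<times> 'k linf) set" where
  "flow_operator G w = {(v, v'). v \<in> flow_domain G w \<and> v' \<in> Linf (arcs G) \<and>
     has_weak_derivative v v'}"

end

theory Submission
  imports Defs
begin

text \<open>
  Every element \<open>f\<close> of the space extends to the half-line by $u(x) = \mathbb{B}^n f(x-n)$ for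
  $n \le x < n+1$ (\<open>ext\<close>), and $T(t)f$ is the restriction of the translate $u(t + \cdot)$ to the unit
  interval. Since $u(x+n) = \mathbb{B}^n u(x)$, translates compose, which is the semigroup law; the
  contraction property holds because $\mathbb{B}$ is column-substochastic.

  All topological statements go through \<open>limitin_weak_starI\<close>: for norm-bounded nets, weak* convergence
  follows from convergence of the integrals of every coordinate over every interval $[0,x]$. Indeed such
  intervals generate the Borel sets, simple functions are dense in $L^1$, and finitely supported
  sequences are dense in $c_0$. For $T(t)f$ these integrals are the increments $P_i(t+x)-P_i(t)$ of the
  primitive $P_i$ of $u_i$, and $P_i$ is Lipschitz with constant the norm of \<open>f\<close>; this gives strong
  continuity. Local finiteness makes the rows of $\mathbb{B}$ finite, so $P_i$ on $[n,n+1]$ is a finite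
  combination of primitives on $[n-1,n]$ and a constant. Hence for a bounded weak* null sequence the
  primitives tend to zero pointwise on the half-line and, being equi-Lipschitz, uniformly on compact
  intervals; this is local bi-equicontinuity.

  The weak* topology is admissible: for norming, a multiple of the conjugate phases of finitely many
  coordinates on a set of positive measure almost attains the norm (\<open>exists_norming_pairing\<close>); for
  sequential completeness, the Radon--Nikodym theorem represents the limit coordinatewise, and testing
  against conjugate phases bounds the sums of its coordinates (\<open>weak_star_sequentially_complete\<close>).

  If \<open>(f, g)\<close> lies in the generator, the quotients $(P_i(t+x)-P_i(t)-P_i(x))/t$ tend boundedly to
  $\int_0^x g_i$. Integrating them over $x \in [0,c]$ shows that $P_i(t)/t$ has a limit $L_i$ and that
  $P_i(c) = c L_i + \int_0^c \int_0^x g_i$, hence $f_i = L_i + \int_0^{\cdot} g_i$ almost everywhere; the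
  case $x = 1$ is the boundary condition (\<open>generator_subset\<close>). Conversely, smooth approximations of
  indicator functions recover a continuous representative from its weak derivative
  (\<open>continuous_representative_eq_bint\<close>), the boundary condition makes the extension Lipschitz
  across $x = 1$, and its difference quotients have the required bound and limit
  (\<open>generator_superset\<close>).
\<close>

section \<open>Coordinates and the duality of sequence spaces\<close>

lemma bounded_linear_ell1_nth: "bounded_linear (\<lambda>x. ell1_nth x i)"
  by (rule bounded_linear_intro[where K = 1])
     (auto simp: plus_ell1.rep_eq scaleR_ell1.rep_eq norm_ell1_nth_le)

lemma ell1_nth_simps [simp]:
  "ell1_nth 0 i = 0" "ell1_nth (x + y) i = ell1_nth x i + ell1_nth y i"
  "ell1_nth (- x) i = - ell1_nth x i"
  "ell1_nth (x - y) i = ell1_nth x i - ell1_nth y i" "ell1_nth (r *\<^sub>R x) i = r *\<^sub>R ell1_nth x i"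
  "ell1_nth (scale_ell1 c z) i = c * ell1_nth z i"
  by (simp_all add: zero_ell1.rep_eq plus_ell1.rep_eq minus_ell1.rep_eq scaleR_ell1.rep_eq
      scale_ell1.rep_eq uminus_ell1.rep_eq)

lemma c0_nth_simps [simp]:
  "c0_nth 0 i = 0" "c0_nth (x + y) i = c0_nth x i + c0_nth y i"
  "c0_nth (x - y) i = c0_nth x i - c0_nth y i" "c0_nth (r *\<^sub>R x) i = r *\<^sub>R c0_nth x i"
  by (simp_all add: zero_c0.rep_eq plus_c0.rep_eq minus_c0.rep_eq scaleR_c0.rep_eq)

lemma norm_c0_nth_le: "norm (c0_nth y n) \<le> norm y"
  unfolding norm_c0.rep_eq by (rule cSUP_upper[OF _ bdd_above_of_null[OF c0_nth_tendsto]]) simp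

lemma norm_c0_le: "(\<And>n. norm (c0_nth y n) \<le> C) \<Longrightarrow> norm y \<le> C"
  unfolding norm_c0.rep_eq by (rule cSUP_least) auto

lemma norm_ell1_le: "(\<And>N. (\<Sum>n<N. norm (ell1_nth x n)) \<le> C) \<Longrightarrow> norm x \<le> C"
  unfolding norm_ell1.rep_eq by (rule suminf_le_const[OF summable_ell1])

lemma ell1_of_bounded_sums:
  fixes a :: "nat \<Rightarrow> 'a::real_normed_vector"
  assumes "\<And>N. (\<Sum>n<N. norm (a n)) \<le> C"
  shows "ell1_nth (Ell1 a) = a" "norm (Ell1 a) \<le> C"
proof -
  have "summable (\<lambda>n. norm (a n))"
    by (rule bounded_imp_summable[where B = C]) (use assms[of "Suc _"] in \<open>auto simp: lessThan_Suc_atMost\<close>)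
  then show 1: "ell1_nth (Ell1 a) = a" by (simp add: Ell1_inverse)
  show "norm (Ell1 a) \<le> C" by (rule norm_ell1_le) (simp add: 1 assms)
qed

text \<open>
  The sequence with entry \<open>c\<close> at position \<open>i\<close> and zeros elsewhere.
\<close>

lift_definition c0_single :: "nat \<Rightarrow> 'a::real_normed_vector \<Rightarrow> 'a c0" is "\<lambda>i c n. if n = i then c else 0"
  subgoal for i by (rule tendsto_eventually, rule eventually_mono[OF eventually_gt_at_top[of i]]) simp
  done

lemma c0_nth_single [simp]: "c0_nth (c0_single i c) n = (if n = i then c else 0)"
  by (simp add: c0_single.rep_eq)

lemma c0_eqI: "(\<And>n. c0_nth x n = c0_nth y n) \<Longrightarrow> x = y"
  by (simp add: c0_nth_inject[symmetric] ext)

lemma bounded_linear_c0_single: "bounded_linear (c0_single i)"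
  by (rule bounded_linear_intro[where K = 1]) (auto intro!: c0_eqI norm_c0_le)

text \<open>
  The canonical pairing of $\ell^1$ with $c_0$.
\<close>

definition duality :: "'k::{real_normed_field, banach} ell1 \<Rightarrow> 'k c0 \<Rightarrow> 'k" where
  "duality x y = (\<Sum>n. ell1_nth x n * c0_nth y n)"

lemma summable_duality:
  fixes x :: "'k::{real_normed_field, banach} ell1"
  shows "summable (\<lambda>n. norm (ell1_nth x n * c0_nth y n))"
  by (rule summable_comparison_test'[OF summable_mult2[OF summable_ell1[of x], of "norm y"]])
     (auto simp: norm_mult intro: mult_left_mono norm_c0_nth_le)

lemmas summable_duality' = summable_norm_cancel[OF summable_duality]

lemma norm_duality_le: "norm (duality x y) \<le> norm x * norm y"
proof -
  have "norm (duality x y) \<le> (\<Sum>n. norm (ell1_nth x n * c0_nth y n))"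
    unfolding duality_def by (rule summable_norm[OF summable_duality])
  also have "\<dots> \<le> (\<Sum>n. norm (ell1_nth x n) * norm y)"
    by (intro suminf_le summable_duality summable_mult2 summable_ell1)
       (auto simp: norm_mult intro: mult_left_mono norm_c0_nth_le)
  also have "\<dots> = norm x * norm y"
    unfolding norm_ell1.rep_eq by (rule suminf_mult2[OF summable_ell1, symmetric])
  finally show ?thesis .
qed

lemma bounded_bilinear_duality: "bounded_bilinear (duality :: 'k::{real_normed_field, banach} ell1 \<Rightarrow> _)"
proof
  fix a a' :: "'k ell1" and b b' :: "'k c0" and r :: real
  show "duality (a + a') b = duality a b + duality a' b"
    unfolding duality_def by (simp add: distrib_right suminf_add[OF summable_duality' summable_duality'])
  show "duality a (b + b') = duality a b + duality a b'"
    unfolding duality_def by (simp add: distrib_left suminf_add[OF summable_duality' summable_duality'])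
  show "duality (r *\<^sub>R a) b = r *\<^sub>R duality a b"
    unfolding duality_def by (simp add: suminf_scaleR_right[OF summable_duality'])
  show "duality a (r *\<^sub>R b) = r *\<^sub>R duality a b"
    unfolding duality_def by (simp add: suminf_scaleR_right[OF summable_duality'])
  show "\<exists>K. \<forall>a b. norm (duality a b :: 'k) \<le> norm a * norm b * K"
    by (rule exI[of _ 1]) (simp add: norm_duality_le)
qed

lemma duality_scale: "duality (scale_ell1 c x) y = c * duality x y"
  unfolding duality_def by (simp add: mult.assoc suminf_mult[OF summable_duality'])

lemma duality_single [simp]: "duality x (c0_single i c) = ell1_nth x i * c"
  unfolding duality_def by (subst suminf_finite[of "{i}"]) auto

text \<open>Truncation of a null sequence to its first \<open>N\<close> coordinates.\<close>

definition c0_trunc :: "nat \<Rightarrow> 'a::real_normed_vector c0 \<Rightarrow> 'a c0" where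
  "c0_trunc N y = (\<Sum>i<N. c0_single i (c0_nth y i))"

lemma c0_nth_sum: "c0_nth (\<Sum>i\<in>A. f i) n = (\<Sum>i\<in>A. c0_nth (f i) n)"
  by (induct A rule: infinite_finite_induct) auto

lemma ell1_nth_sum: "ell1_nth (\<Sum>i\<in>A. f i) n = (\<Sum>i\<in>A. ell1_nth (f i) n)"
  by (induct A rule: infinite_finite_induct) auto

lemma c0_nth_trunc: "c0_nth (c0_trunc N y) n = (if n < N then c0_nth y n else 0)"
proof -
  have "c0_nth (c0_trunc N y) n = (\<Sum>i<N. if i = n then c0_nth y i else 0)"
    by (auto simp: c0_trunc_def c0_nth_sum intro!: sum.cong)
  also have "\<dots> = (if n < N then c0_nth y n else 0)" by (simp add: sum.delta)
  finally show ?thesis .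
qed

lemma norm_c0_trunc_le: "norm (y - c0_trunc N y) \<le> norm y"
  by (rule norm_c0_le) (auto simp: c0_nth_trunc norm_c0_nth_le)

lemma c0_trunc_tendsto: "(\<lambda>N. norm (y - c0_trunc N y)) \<longlonglongrightarrow> 0"
proof (rule LIMSEQ_I)
  fix r :: real assume "r > 0"
  then obtain N where N: "\<And>n. n \<ge> N \<Longrightarrow> norm (c0_nth y n) < r / 2"
    using LIMSEQ_D[OF c0_nth_tendsto[of y], of "r/2"] by auto
  have "norm (y - c0_trunc M y) \<le> r / 2" if "M \<ge> N" for M
    using N that \<open>r > 0\<close> by (intro norm_c0_le) (auto simp: c0_nth_trunc less_imp_le)
  then show "\<exists>no. \<forall>n\<ge>no. norm (norm (y - c0_trunc n y) - 0) < r"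
    using \<open>r > 0\<close> by (intro exI[of _ N] allI impI) (fastforce intro: le_less_trans)
qed

section \<open>Elements of the Bochner space\<close>

lemma AE_unit_leb_iff: "(AE s in unit_leb. P s) \<longleftrightarrow> (AE s in lborel. s \<in> {0..1} \<longrightarrow> P s)"
  by (subst AE_restrict_space_iff) (auto simp: AE_completion_iff)

lemma finite_measure_unit_leb: "finite_measure unit_leb"
  by (rule finite_measureI) (simp add: emeasure_restrict_space space_restrict_space)

interpretation unit_leb: finite_measure unit_leb
  by (rule finite_measure_unit_leb)

lemma measure_unit_leb_space [simp]: "measure unit_leb {0..1} = 1"
  by (simp add: measure_restrict_space)

lemma space_unit_leb [simp]: "space unit_leb = {0..1}"
  by (simp add: space_restrict_space)

lemma linf_eqI:
  assumes "AE s in unit_leb. rep_linf f s = rep_linf g s" shows "f = g"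
  using assms Quotient3_rel_rep[OF Quotient3_linf, of f g] rep_linf[of f] rep_linf[of g] by simp

lemma rep_linf_measurable [measurable]: "rep_linf f \<in> borel_measurable unit_leb"
  by (rule ess_bounded_measurable[OF rep_linf])

lemma norm_rep_linf: "AE s in unit_leb. norm (rep_linf f s) \<le> norm f"
  using ess_bounded_AE[OF rep_linf[of f]] by (simp add: norm_linf_def)

lemma norm_linf_le: "AE s in unit_leb. norm (rep_linf f s) \<le> C \<Longrightarrow> norm f \<le> C"
  using real_esssup_le[OF ess_bounded_measurable[OF rep_linf[of f]], of C] by (simp add: norm_linf_def)

lemma rep_linf_plus: "AE s in unit_leb. rep_linf (f + g) s = rep_linf f s + rep_linf g s"
  using rep_abs_linf[OF ess_bounded_add[OF rep_linf rep_linf], of f g] by (simp add: plus_linf_def)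

lemma rep_linf_uminus: "AE s in unit_leb. rep_linf (- f) s = - rep_linf f s"
  using rep_abs_linf[OF ess_bounded_uminus[OF rep_linf], of f] by (simp add: uminus_linf_def)

lemma rep_linf_minus: "AE s in unit_leb. rep_linf (f - g) s = rep_linf f s - rep_linf g s"
  using rep_linf_plus[of f "- g"] rep_linf_uminus[of g] by eventually_elim simp

lemma rep_linf_scaleR: "AE s in unit_leb. rep_linf (r *\<^sub>R f) s = r *\<^sub>R rep_linf f s"
  using rep_abs_linf[OF ess_bounded_scaleR[OF rep_linf], of r f] by (simp add: scaleR_linf_def)

lemma rep_linf_zero: "AE s in unit_leb. rep_linf 0 s = 0"
  using rep_abs_linf[OF ess_boundedI[of "\<lambda>_. 0" 0]] by (simp add: zero_linf_def)

lemma rep_linf_scale: "AE s in unit_leb. rep_linf (scale_linf c f) s = scale_ell1 c (rep_linf f s)"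
  using rep_abs_linf[OF ess_bounded_linear[OF rep_linf bounded_linear_scale_ell1], of c f]
  by (simp add: scale_linf_def)

lemma LinfD: "f \<in> Linf J \<Longrightarrow> AE s in unit_leb. \<forall>n. n \<notin> J \<longrightarrow> ell1_nth (rep_linf f s) n = 0"
  by (simp add: Linf_def)

lemma Linf_0: "(0 :: 'k::{real_normed_field, euclidean_space} linf) \<in> Linf J"
  unfolding Linf_def mem_Collect_eq using rep_linf_zero[where 'a = 'k] by eventually_elim simp

lemma Linf_add: assumes "f \<in> Linf J" "g \<in> Linf J" shows "f + g \<in> Linf J"
  using rep_linf_plus[of f g] LinfD[OF assms(1)] LinfD[OF assms(2)]
  unfolding Linf_def mem_Collect_eq by eventually_elim simp

lemma Linf_diff: assumes "f \<in> Linf J" "g \<in> Linf J" shows "f - g \<in> Linf J"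
  using rep_linf_minus[of f g] LinfD[OF assms(1)] LinfD[OF assms(2)]
  unfolding Linf_def mem_Collect_eq by eventually_elim simp

lemma Linf_scaleR: assumes "f \<in> Linf J" shows "r *\<^sub>R f \<in> Linf J"
  using rep_linf_scaleR[of r f] LinfD[OF assms]
  unfolding Linf_def mem_Collect_eq by eventually_elim simp

lemma Linf_scale: assumes "f \<in> Linf J" shows "scale_linf c f \<in> Linf J"
  using rep_linf_scale[of c f] LinfD[OF assms]
  unfolding Linf_def mem_Collect_eq by eventually_elim simp

subsection \<open>Borel representatives\<close>

lemma lebesgue_ex_borel:
  fixes f :: "real \<Rightarrow> 'k::euclidean_space"
  assumes "f \<in> borel_measurable lebesgue"
  shows "\<exists>f'\<in>borel_measurable borel. AE x in lborel. f x = f' x"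
proof -
  have "\<forall>b\<in>Basis. \<exists>g\<in>borel_measurable lborel. AE x in lborel. f x \<bullet> b = g x"
    using assms by (intro ballI completion_ex_borel_measurable_real) simp
  then obtain g where g: "\<And>b. b \<in> Basis \<Longrightarrow> g b \<in> borel_measurable lborel"
    "\<And>b. b \<in> Basis \<Longrightarrow> AE x in lborel. f x \<bullet> b = g b x" by metis
  show ?thesis
  proof
    show "(\<lambda>x. \<Sum>b\<in>Basis. g b x *\<^sub>R b) \<in> borel_measurable borel"
      using g(1) by simp
    have "AE x in lborel. \<forall>b\<in>Basis. f x \<bullet> b = g b x"
      using g(2) by (intro AE_finite_allI) auto
    then show "AE x in lborel. f x = (\<Sum>b\<in>Basis. g b x *\<^sub>R b)"
      by eventually_elim (metis (no_types, lifting) euclidean_representation sum.cong)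
  qed
qed

text \<open>A map into $\ell^1$ with Borel coordinates is Borel, being a limit of finite combinations of them.\<close>

lemma borel_measurable_ell1:
  fixes f :: "'a \<Rightarrow> 'k::{banach, second_countable_topology} ell1"
  assumes [measurable]: "\<And>i. (\<lambda>x. ell1_nth (f x) i) \<in> borel_measurable M"
  shows "f \<in> borel_measurable M"
proof -
  define e :: "nat \<Rightarrow> 'k \<Rightarrow> 'k ell1" where "e i c = Ell1 (\<lambda>n. if n = i then c else 0)" for i c
  have e_nth: "ell1_nth (e i c) n = (if n = i then c else 0)" for i c n
    unfolding e_def by (subst Ell1_inverse) (auto intro!: summable_finite[of "{i}"] split: if_splits)
  have bl: "bounded_linear (e i)" for i
  proof (rule bounded_linear_intro[where K = 1])
    show "norm (e i x) \<le> norm x * 1" for x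
      unfolding norm_ell1.rep_eq by (subst suminf_finite[of "{i}"]) (auto simp: e_nth)
  qed (auto intro!: ell1_eqI simp: e_nth)
  have nth: "ell1_nth (\<Sum>i<N. e i (ell1_nth y i)) n = (if n < N then ell1_nth y n else 0)" for N y n
  proof -
    have "ell1_nth (\<Sum>i<N. e i (ell1_nth y i)) n = (\<Sum>i<N. if i = n then ell1_nth y i else 0)"
      by (auto simp: ell1_nth_sum e_nth intro!: sum.cong)
    then show ?thesis by (simp add: sum.delta)
  qed
  show ?thesis
  proof (rule borel_measurable_LIMSEQ_metric[where f = "\<lambda>N x. \<Sum>i<N. e i (ell1_nth (f x) i)"])
    show "(\<lambda>x. \<Sum>i<N. e i (ell1_nth (f x) i)) \<in> borel_measurable M" for N
    proof (rule borel_measurable_sum)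
      fix i
      have "e i \<in> borel_measurable borel"
        by (intro borel_measurable_continuous_onI linear_continuous_on bl)
      then show "(\<lambda>x. e i (ell1_nth (f x) i)) \<in> borel_measurable M" by measurable
    qed
    fix x
    let ?y = "f x"
    have "norm (?y - (\<Sum>i<N. e i (ell1_nth ?y i))) = (\<Sum>n. norm (ell1_nth ?y (n + N)))" for N
      unfolding norm_ell1.rep_eq
      by (subst suminf_split_initial_segment[where k = N, OF summable_ell1]) (simp add: nth)
    moreover have "(\<lambda>N. \<Sum>n. norm (ell1_nth ?y (n + N))) \<longlonglongrightarrow> 0"
      using suminf_exist_split2[OF summable_ell1[of ?y]] .
    ultimately have "(\<lambda>N. norm (?y - (\<Sum>i<N. e i (ell1_nth ?y i)))) \<longlonglongrightarrow> 0" by simp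
    then have "(\<lambda>N. ?y - (\<Sum>i<N. e i (ell1_nth ?y i))) \<longlonglongrightarrow> 0" by (rule tendsto_norm_zero_cancel)
    from tendsto_diff[OF tendsto_const[of ?y] this]
    show "(\<lambda>N. \<Sum>i<N. e i (ell1_nth ?y i)) \<longlonglongrightarrow> ?y" by simp
  qed
qed

lemma borel_ell1_nth [measurable]:
  "f \<in> borel_measurable M \<Longrightarrow> (\<lambda>x. ell1_nth (f x) i :: 'k::{banach, second_countable_topology}) \<in> borel_measurable M"
  by (rule measurable_compose[OF _ borel_measurable_continuous_onI])
     (auto intro: linear_continuous_on bounded_linear_ell1_nth)

text \<open>
  The norm bound and the support condition of the representative hold at every point: on the Borel
  set where they fail for given Borel versions of the coordinates, the value is set to zero.
\<close>

lemma ex_borel_representative: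
  fixes f :: "'k::{real_normed_field, euclidean_space} linf"
  assumes "f \<in> Linf J"
  shows "\<exists>h. h \<in> borel_measurable borel \<and> (\<forall>x. norm (h x) \<le> norm f) \<and>
    (\<forall>x. \<forall>n. n \<notin> J \<longrightarrow> ell1_nth (h x) n = 0) \<and> (AE s in unit_leb. rep_linf f s = h s)"
proof -
  have "(\<lambda>x. if x \<in> {0..1} then ell1_nth (rep_linf f x) i else 0) \<in> borel_measurable lebesgue" for i
    by (subst measurable_restrict_space_iff[symmetric]) auto
  from lebesgue_ex_borel[OF this]
  have "\<forall>i. \<exists>g. g \<in> borel_measurable borel \<and>
      (AE x in lborel. (if x \<in> {0..1} then ell1_nth (rep_linf f x) i else 0) = g x)" by blast
  from choice[OF this] obtain g where g [measurable]: "\<And>i. g i \<in> borel_measurable borel"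
    and ae: "\<And>i. AE x in lborel. (if x \<in> {0..1} then ell1_nth (rep_linf f x) i else 0) = g i x" by blast
  define ok where "ok x \<longleftrightarrow> (\<forall>N. (\<Sum>n<N. norm (g n x)) \<le> norm f) \<and> (\<forall>n. n \<notin> J \<longrightarrow> g n x = 0)" for x
  have [measurable]: "Measurable.pred borel ok" unfolding ok_def[abs_def] by measurable
  define h where "h x = Ell1 (\<lambda>n. if ok x then g n x else 0)" for x
  have h: "ell1_nth (h x) n = (if ok x then g n x else 0)" "norm (h x) \<le> norm f" for x n
  proof -
    have "(\<Sum>n<N. norm (if ok x then g n x else 0)) \<le> norm f" for N
    proof (cases "ok x")
      case True
      then show ?thesis using True[unfolded ok_def] by simp
    qed simp
    note ell1_of_bounded_sums[OF this]
    then show "ell1_nth (h x) n = (if ok x then g n x else 0)" "norm (h x) \<le> norm f"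
      by (simp_all add: h_def)
  qed
  have "AE s in unit_leb. rep_linf f s = h s"
  proof -
    have "AE x in lborel. \<forall>i. (if x \<in> {0..1} then ell1_nth (rep_linf f x) i else 0) = g i x"
      using ae by (simp add: AE_all_countable)
    then have "AE x in unit_leb. \<forall>i. ell1_nth (rep_linf f x) i = g i x"
      unfolding AE_unit_leb_iff by eventually_elim auto
    then show ?thesis using norm_rep_linf[of f] LinfD[OF assms]
    proof eventually_elim
      case (elim x)
      have "ok x" unfolding ok_def
        using elim sum_le_norm_ell1[of "rep_linf f x"] by (metis (no_types, lifting) order_trans sum.cong)
      with elim show ?case by (intro ell1_eqI) (simp add: h)
    qed
  qed
  moreover have "h \<in> borel_measurable borel"
    by (rule borel_measurable_ell1) (simp add: h)
  moreover have "\<forall>x. \<forall>n. n \<notin> J \<longrightarrow> ell1_nth (h x) n = 0" by (auto simp: h ok_def)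
  ultimately show ?thesis using h(2) by blast
qed

section \<open>The pairing and the weak* topology\<close>

lemma pairing_eq: "pairing f g = (LINT s|unit_leb. duality (rep_linf f s) (g s))"
  by (simp add: pairing_def duality_def)

lemma
  assumes "g \<in> L1_c0 J"
  shows L1_c0_measurable: "g \<in> borel_measurable unit_leb"
    and L1_c0_norm: "integrable unit_leb (\<lambda>s. norm (g s))"
proof -
  obtain x where x: "has_bochner_integral unit_leb g x"
    using assms by (auto simp: L1_c0_def integrable.simps)
  then show 1: "g \<in> borel_measurable unit_leb" by (auto simp: has_bochner_integral.simps)
  from has_bochner_integral_implies_finite_norm[OF x] 1
  show "integrable unit_leb (\<lambda>s. norm (g s))" by (intro integrableI_bounded) auto
qed

lemma borel_measurable_duality [measurable]:
  fixes f :: "'a \<Rightarrow> 'k::{real_normed_field, euclidean_space} ell1"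
  assumes "f \<in> borel_measurable M" "g \<in> borel_measurable M"
  shows "(\<lambda>s. duality (f s) (g s)) \<in> borel_measurable M"
  by (rule borel_measurable_continuous_Pair[OF assms])
     (intro bounded_bilinear.continuous_on[OF bounded_bilinear_duality] continuous_intros)

lemma pairing_integrable:
  fixes f :: "'k::{real_normed_field, euclidean_space} linf"
  assumes g: "g \<in> L1_c0 J"
  shows "integrable unit_leb (\<lambda>s. duality (rep_linf f s) (g s))"
proof (rule Bochner_Integration.integrable_bound)
  show "integrable unit_leb (\<lambda>s. norm f * norm (g s))" using L1_c0_norm[OF g] by simp
  show "(\<lambda>s. duality (rep_linf f s) (g s)) \<in> borel_measurable unit_leb"
    using L1_c0_measurable[OF g] by measurable
  show "AE s in unit_leb. norm (duality (rep_linf f s) (g s)) \<le> norm (norm f * norm (g s))"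
    using norm_rep_linf[of f]
    by eventually_elim (auto intro!: order_trans[OF norm_duality_le] mult_right_mono)
qed

lemma norm_pairing_le:
  fixes f :: "'k::{real_normed_field, euclidean_space} linf"
  assumes g: "g \<in> L1_c0 J"
  shows "norm (pairing f g) \<le> norm f * (LINT s|unit_leb. norm (g s))"
proof -
  have "norm (pairing f g) \<le> (LINT s|unit_leb. norm (duality (rep_linf f s) (g s)))"
    unfolding pairing_eq by (rule integral_norm_bound)
  also have "\<dots> \<le> (LINT s|unit_leb. norm f * norm (g s))"
    using norm_rep_linf[of f] pairing_integrable[OF g, of f] L1_c0_norm[OF g]
    by (intro integral_mono_AE) (auto elim!: eventually_mono intro!: order_trans[OF norm_duality_le] mult_right_mono)
  finally show ?thesis by simp
qed

lemma pairing_linear: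
  fixes f :: "'k::{real_normed_field, euclidean_space} linf"
  assumes g: "g \<in> L1_c0 J"
  shows pairing_add: "pairing (f + h) g = pairing f g + pairing h g"
    and pairing_diff: "pairing (f - h) g = pairing f g - pairing h g"
    and pairing_scale: "pairing (scale_linf c f) g = c * pairing f g"
    and pairing_scaleR: "pairing (r *\<^sub>R f) g = r *\<^sub>R pairing f g"
    and pairing_zero: "pairing (0 :: 'k linf) g = 0"
proof -
  note [measurable] = L1_c0_measurable[OF g]
  note i = pairing_integrable[OF g]
  interpret d: bounded_bilinear "duality :: 'k ell1 \<Rightarrow> _" by (rule bounded_bilinear_duality)
  show "pairing (f + h) g = pairing f g + pairing h g"
    unfolding pairing_eq Bochner_Integration.integral_add[OF i i, symmetric] using rep_linf_plus[of f h]
    by (intro integral_cong_AE) (auto elim!: eventually_mono simp: d.add_left)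
  show "pairing (f - h) g = pairing f g - pairing h g"
    unfolding pairing_eq Bochner_Integration.integral_diff[OF i i, symmetric] using rep_linf_minus[of f h]
    by (intro integral_cong_AE) (auto elim!: eventually_mono simp: d.diff_left)
  have "pairing (scale_linf c f) g = (LINT s|unit_leb. c * duality (rep_linf f s) (g s))"
    unfolding pairing_eq using rep_linf_scale[of c f]
    by (intro integral_cong_AE) (auto elim!: eventually_mono simp: duality_scale)
  then show "pairing (scale_linf c f) g = c * pairing f g"
    by (simp add: pairing_eq)
  have "pairing (r *\<^sub>R f) g = (LINT s|unit_leb. r *\<^sub>R duality (rep_linf f s) (g s))"
    unfolding pairing_eq using rep_linf_scaleR[of r f]
    by (intro integral_cong_AE) (auto elim!: eventually_mono simp: d.scaleR_left)
  then show "pairing (r *\<^sub>R f) g = r *\<^sub>R pairing f g"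
    by (simp add: pairing_eq)
  have "pairing (0 :: 'k linf) g = (LINT s|unit_leb. 0)"
    unfolding pairing_eq using rep_linf_zero[where 'a = 'k]
    by (intro integral_cong_AE) (auto elim!: eventually_mono simp: d.zero_left)
  then show "pairing (0 :: 'k linf) g = 0" by simp
qed

lemma zero_in_L1_c0: "(\<lambda>_. 0) \<in> L1_c0 J"
  by (simp add: L1_c0_def)

lemma topspace_weak_star [simp]:
  "topspace (weak_star J :: 'k::{real_normed_field, euclidean_space} linf topology) = Linf J"
  unfolding weak_star_def topology_generated_by_topspace using zero_in_L1_c0[of J] by blast

lemma openin_weak_star_basic:
  "g \<in> L1_c0 J \<Longrightarrow> open V \<Longrightarrow> openin (weak_star J) {h \<in> Linf J. pairing h g \<in> V}"
  unfolding weak_star_def by (rule topology_generated_by_Basis) blast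

text \<open>
  Finitely many functionals and one tolerance describe a base of neighbourhoods.
\<close>

lemma weak_star_nhd:
  fixes f :: "'k::{real_normed_field, euclidean_space} linf"
  assumes "openin (weak_star J) U" "f \<in> U"
  shows "\<exists>S e. finite S \<and> S \<subseteq> L1_c0 J \<and> e > 0 \<and>
    {h \<in> Linf J. \<forall>g\<in>S. norm (pairing h g - pairing f g) < e} \<subseteq> U"
proof -
  have "generate_topology_on {{f \<in> Linf J. pairing f g \<in> U} | g U. g \<in> L1_c0 J \<and> open U} U"
    using assms(1) unfolding weak_star_def openin_topology_generated_by_iff .
  then show ?thesis using assms(2)
  proof induct
    case (Int a b)
    then have "f \<in> a" "f \<in> b" by auto
    from Int(2)[OF this(1)] Int(4)[OF this(2)] obtain S e S' e' where *:
      "finite S" "S \<subseteq> L1_c0 J" "e > 0" "{h \<in> Linf J. \<forall>g\<in>S. norm (pairing h g - pairing f g) < e} \<subseteq> a"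
      "finite S'" "S' \<subseteq> L1_c0 J" "e' > 0" "{h \<in> Linf J. \<forall>g\<in>S'. norm (pairing h g - pairing f g) < e'} \<subseteq> b"
      by (elim exE conjE)
    show ?case
    proof (intro exI conjI)
      show "finite (S \<union> S')" "S \<union> S' \<subseteq> L1_c0 J" "min e e' > 0" using * by auto
      have "{h \<in> Linf J. \<forall>g\<in>S \<union> S'. norm (pairing h g - pairing f g) < min e e'}
          \<subseteq> {h \<in> Linf J. \<forall>g\<in>S. norm (pairing h g - pairing f g) < e} \<inter>
            {h \<in> Linf J. \<forall>g\<in>S'. norm (pairing h g - pairing f g) < e'}" by auto
      with *(4,8) show "{h \<in> Linf J. \<forall>g\<in>S \<union> S'. norm (pairing h g - pairing f g) < min e e'} \<subseteq> a \<inter> b"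
        by blast
    qed
  next
    case (UN K)
    then obtain k where "k \<in> K" "f \<in> k" by blast
    from UN(2)[OF this] obtain S e where "finite S" "S \<subseteq> L1_c0 J" "e > 0"
      "{h \<in> Linf J. \<forall>g\<in>S. norm (pairing h g - pairing f g) < e} \<subseteq> k" by (elim exE conjE)
    with \<open>k \<in> K\<close> show ?case by (intro exI[of _ S] exI[of _ e]) blast
  next
    case (Basis s)
    then obtain g V where s: "s = {f \<in> Linf J. pairing f g \<in> V}" "g \<in> L1_c0 J" "open V" by blast
    with Basis(2) obtain e where "e > 0" "\<And>y. dist y (pairing f g) < e \<Longrightarrow> y \<in> V"
      by (auto simp: open_dist)
    then have "{h \<in> Linf J. \<forall>g\<in>{g}. norm (pairing h g - pairing f g) < e} \<subseteq> s"
      by (auto simp: s dist_norm)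
    with \<open>e > 0\<close> s(2) show ?case by (intro exI[of _ "{g}"] exI[of _ e]) auto
  qed simp
qed

lemma continuous_map_pairing:
  "g \<in> L1_c0 J \<Longrightarrow> continuous_map (weak_star J) euclidean (\<lambda>f. pairing f g)"
  by (simp add: continuous_map_def openin_weak_star_basic)

lemma continuous_map_weak_star:
  fixes \<phi> :: "'a \<Rightarrow> 'k::{real_normed_field, euclidean_space} linf"
  assumes "\<And>y. y \<in> topspace Y \<Longrightarrow> \<phi> y \<in> Linf J"
    and "\<And>g. g \<in> L1_c0 J \<Longrightarrow> continuous_map Y euclidean (\<lambda>y. pairing (\<phi> y) g)"
  shows "continuous_map Y (weak_star J) \<phi>"
  unfolding weak_star_def
proof (rule continuous_on_generated_topo)
  show "\<phi> ` topspace Y \<subseteq> \<Union>{{f \<in> Linf J. pairing f g \<in> U} | g U. g \<in> L1_c0 J \<and> open U}"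
    using assms(1) zero_in_L1_c0[of J] by blast
  fix U :: "'k linf set"
  assume "U \<in> {{f \<in> Linf J. pairing f g \<in> U} | g U. g \<in> L1_c0 J \<and> open U}"
  then obtain g V where U: "U = {f \<in> Linf J. pairing f g \<in> V}" "g \<in> L1_c0 J" "open V" by blast
  have "\<phi> -` U \<inter> topspace Y = {y \<in> topspace Y. pairing (\<phi> y) g \<in> V}" using U assms(1) by auto
  with assms(2)[OF U(2)] U(3) show "openin Y (\<phi> -` U \<inter> topspace Y)"
    by (simp add: continuous_map_def)
qed

lemma limitin_weak_star:
  fixes F :: "'a \<Rightarrow> 'k::{real_normed_field, euclidean_space} linf"
  shows "limitin (weak_star J) F l Fi \<longleftrightarrow> l \<in> Linf J \<and> (\<forall>\<^sub>F x in Fi. F x \<in> Linf J) \<and>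
    (\<forall>g\<in>L1_c0 J. ((\<lambda>x. pairing (F x) g) \<longlongrightarrow> pairing l g) Fi)" (is "?L \<longleftrightarrow> ?R")
proof
  assume L: ?L
  then have "l \<in> Linf J" by (simp add: limitin_def)
  moreover have "\<forall>\<^sub>F x in Fi. F x \<in> Linf J"
    using L \<open>l \<in> Linf J\<close> openin_topspace[of "weak_star J :: 'k linf topology"] by (simp add: limitin_def)
  moreover have "((\<lambda>x. pairing (F x) g) \<longlongrightarrow> pairing l g) Fi" if "g \<in> L1_c0 J" for g
    using continuous_map_limit[OF continuous_map_pairing[OF that] L] by (simp add: o_def)
  ultimately show ?R by blast
next
  assume R: ?R
  show ?L unfolding limitin_def
  proof (intro conjI allI impI)
    show "l \<in> topspace (weak_star J)" using R by simp
    fix U :: "'k linf set" assume "openin (weak_star J) U \<and> l \<in> U"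
    then have "openin (weak_star J) U" "l \<in> U" by auto
    from weak_star_nhd[OF this] obtain S e where S: "finite S" "S \<subseteq> L1_c0 J" "e > 0"
      "{h \<in> Linf J. \<forall>g\<in>S. norm (pairing h g - pairing l g) < e} \<subseteq> U" by (elim exE conjE)
    have "\<forall>\<^sub>F x in Fi. \<forall>g\<in>S. norm (pairing (F x) g - pairing l g) < e"
      using S R by (intro eventually_ball_finite) (auto simp: tendsto_iff dist_norm subset_iff)
    moreover have "\<forall>\<^sub>F x in Fi. F x \<in> Linf J" using R by blast
    ultimately show "\<forall>\<^sub>F x in Fi. F x \<in> U"
      by eventually_elim (use S(4) in blast)
  qed
qed

section \<open>Norm completeness and compatibility of the weak* topology\<close>

lemma scale_linf_vector_space:
  "vector_space (scale_linf :: 'k::{real_normed_field, euclidean_space} \<Rightarrow> 'k linf \<Rightarrow> 'k linf)"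
proof
  fix a b :: 'k and x y :: "'k linf"
  have "AE s in unit_leb. rep_linf (scale_linf a (x + y)) s = rep_linf (scale_linf a x + scale_linf a y) s"
    using rep_linf_scale[of a "x + y"] rep_linf_plus[of x y] rep_linf_plus[of "scale_linf a x" "scale_linf a y"]
      rep_linf_scale[of a x] rep_linf_scale[of a y]
    by eventually_elim (auto intro!: ell1_eqI simp: distrib_left)
  then show "scale_linf a (x + y) = scale_linf a x + scale_linf a y" by (rule linf_eqI)
  have "AE s in unit_leb. rep_linf (scale_linf (a + b) x) s = rep_linf (scale_linf a x + scale_linf b x) s"
    using rep_linf_scale[of "a + b" x] rep_linf_plus[of "scale_linf a x" "scale_linf b x"]
      rep_linf_scale[of a x] rep_linf_scale[of b x]
    by eventually_elim (auto intro!: ell1_eqI simp: distrib_right)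
  then show "scale_linf (a + b) x = scale_linf a x + scale_linf b x" by (rule linf_eqI)
  have "AE s in unit_leb. rep_linf (scale_linf a (scale_linf b x)) s = rep_linf (scale_linf (a * b) x) s"
    using rep_linf_scale[of a "scale_linf b x"] rep_linf_scale[of "a * b" x] rep_linf_scale[of b x]
    by eventually_elim (auto intro!: ell1_eqI simp: mult.assoc)
  then show "scale_linf a (scale_linf b x) = scale_linf (a * b) x" by (rule linf_eqI)
  have "AE s in unit_leb. rep_linf (scale_linf 1 x) s = rep_linf x s"
    using rep_linf_scale[of 1 x] by eventually_elim (auto intro!: ell1_eqI)
  then show "scale_linf 1 x = x" by (rule linf_eqI)
qed

lemma scale_linf_of_real: "scale_linf (of_real r) x = r *\<^sub>R x"
proof (rule linf_eqI)
  show "AE s in unit_leb. rep_linf (scale_linf (of_real r) x) s = rep_linf (r *\<^sub>R x) s"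
    using rep_linf_scale[of "of_real r" x] rep_linf_scaleR[of r x]
    by eventually_elim (auto intro!: ell1_eqI simp: scaleR_conv_of_real)
qed

lemma norm_scale_ell1: "norm (scale_ell1 c x) = norm c * norm x"
  unfolding norm_ell1.rep_eq by (simp add: norm_mult suminf_mult[OF summable_ell1])

lemma norm_scale_linf:
  fixes x :: "'k::{real_normed_field, euclidean_space} linf"
  shows "norm (scale_linf c x) = norm c * norm x"
proof -
  interpret vector_space "scale_linf :: 'k \<Rightarrow> 'k linf \<Rightarrow> _" by (rule scale_linf_vector_space)
  have le: "norm (scale_linf c x) \<le> norm c * norm x" for c :: 'k and x
  proof (rule norm_linf_le)
    show "AE s in unit_leb. norm (rep_linf (scale_linf c x) s) \<le> norm c * norm x"
      using rep_linf_scale[of c x] norm_rep_linf[of x]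
      by eventually_elim (auto simp: norm_scale_ell1 mult_left_mono)
  qed
  show ?thesis
  proof (cases "c = 0")
    case False
    have "norm x = norm (scale_linf (inverse c) (scale_linf c x))" using False by simp
    also have "\<dots> \<le> norm (inverse c) * norm (scale_linf c x)" by (rule le)
    finally have "norm c * norm x \<le> norm (scale_linf c x)" using False by (simp add: norm_inverse norm_divide field_simps)
    with le[of c x] show ?thesis by simp
  qed simp
qed

lemma subspace_Linf:
  "module.subspace scale_linf (Linf J :: 'k::{real_normed_field, euclidean_space} linf set)"
proof -
  interpret vector_space "scale_linf :: 'k \<Rightarrow> 'k linf \<Rightarrow> _" by (rule scale_linf_vector_space)
  show ?thesis by (rule subspaceI) (auto intro: Linf_0 Linf_add Linf_scale)
qed

lemma complete_Linf: "complete (Linf J :: 'k::{real_normed_field, euclidean_space} linf set)"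
  unfolding complete_def
proof (intro allI impI, elim conjE)
  fix F :: "nat \<Rightarrow> 'k linf" assume F: "\<forall>n. F n \<in> Linf J" and C: "Cauchy F"
  obtain K where K: "\<And>n. norm (F n) \<le> K"
    using cauchy_imp_bounded[OF C] by (auto simp: bounded_iff)
  have "AE s in unit_leb. \<forall>m n. norm (rep_linf (F m) s - rep_linf (F n) s) \<le> norm (F m - F n)"
  proof (subst AE_all_countable, rule allI, subst AE_all_countable, rule allI)
    fix m n show "AE s in unit_leb. norm (rep_linf (F m) s - rep_linf (F n) s) \<le> norm (F m - F n)"
      using norm_rep_linf[of "F m - F n"] rep_linf_minus[of "F m" "F n"] by eventually_elim simp
  qed
  moreover have "AE s in unit_leb. \<forall>m. norm (rep_linf (F m) s) \<le> K"
  proof (subst AE_all_countable, rule allI)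
    fix m show "AE s in unit_leb. norm (rep_linf (F m) s) \<le> K"
      using norm_rep_linf[of "F m"] by eventually_elim (rule order_trans[OF _ K])
  qed
  moreover have "AE s in unit_leb. \<forall>m n. n \<notin> J \<longrightarrow> ell1_nth (rep_linf (F m) s) n = 0"
  proof (subst AE_all_countable, rule allI)
    show "AE s in unit_leb. \<forall>n. n \<notin> J \<longrightarrow> ell1_nth (rep_linf (F m) s) n = 0" for m
      using F by (intro LinfD) blast
  qed
  ultimately have ae: "AE s in unit_leb. (\<forall>m n. norm (rep_linf (F m) s - rep_linf (F n) s) \<le> norm (F m - F n)) \<and>
      (\<forall>m. norm (rep_linf (F m) s) \<le> K) \<and> (\<forall>m n. n \<notin> J \<longrightarrow> ell1_nth (rep_linf (F m) s) n = 0)"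
    by eventually_elim blast
  define h where "h s = lim (\<lambda>n. rep_linf (F n) s)" for s
  have h: "(\<lambda>n. rep_linf (F n) s) \<longlonglongrightarrow> h s"
    if "\<forall>m n. norm (rep_linf (F m) s - rep_linf (F n) s) \<le> norm (F m - F n)" for s
  proof -
    have "Cauchy (\<lambda>n. rep_linf (F n) s)"
    proof (rule metric_CauchyI)
      fix e :: real assume "e > 0"
      then obtain M where "\<forall>m\<ge>M. \<forall>n\<ge>M. dist (F m) (F n) < e" using metric_CauchyD[OF C] by blast
      then show "\<exists>M. \<forall>m\<ge>M. \<forall>n\<ge>M. dist (rep_linf (F m) s) (rep_linf (F n) s) < e"
        using that by (intro exI[of _ M]) (metis dist_norm le_less_trans)
    qed
    then show ?thesis unfolding h_def by (simp add: Cauchy_convergent_iff convergent_LIMSEQ_iff)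
  qed
  have ess: "ess_bounded h"
  proof (rule ess_boundedI)
    show "h \<in> borel_measurable unit_leb" unfolding h_def[abs_def] by (rule borel_measurable_lim_metric) simp
    show "AE s in unit_leb. norm (h s) \<le> K"
      using ae
    proof eventually_elim
      case (elim s)
      then have "(\<lambda>n. rep_linf (F n) s) \<longlonglongrightarrow> h s" by (intro h) blast
      from LIMSEQ_le_const2[OF tendsto_norm[OF this], of K] elim show ?case by blast
    qed
  qed
  let ?l = "abs_linf h"
  have "?l \<in> Linf J" unfolding Linf_def mem_Collect_eq
    using rep_abs_linf[OF ess] ae
  proof eventually_elim
    case (elim s)
    then have "(\<lambda>n. rep_linf (F n) s) \<longlonglongrightarrow> h s" by (intro h) blast
    then have "(\<lambda>n. ell1_nth (rep_linf (F n) s) i) \<longlonglongrightarrow> ell1_nth (h s) i" for i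
      by (rule bounded_linear.tendsto[OF bounded_linear_ell1_nth])
    from LIMSEQ_unique[OF this] elim show ?case by simp
  qed
  moreover have "F \<longlonglongrightarrow> ?l"
  proof (rule metric_LIMSEQ_I)
    fix r :: real assume "r > 0"
    then obtain M where M: "\<And>m n. m \<ge> M \<Longrightarrow> n \<ge> M \<Longrightarrow> dist (F m) (F n) < r / 2"
      using metric_CauchyD[OF C, of "r/2"] by auto
    have le: "norm (F m - ?l) \<le> r / 2" if "m \<ge> M" for m
    proof (rule norm_linf_le)
      show "AE s in unit_leb. norm (rep_linf (F m - ?l) s) \<le> r / 2"
        using rep_abs_linf[OF ess] ae rep_linf_minus[of "F m" ?l]
      proof eventually_elim
        case (elim s)
        have "norm (rep_linf (F m) s - h s) \<le> r / 2"
        proof (rule LIMSEQ_le_const2)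
          show "(\<lambda>n. norm (rep_linf (F m) s - rep_linf (F n) s)) \<longlonglongrightarrow> norm (rep_linf (F m) s - h s)"
            using elim by (intro tendsto_norm tendsto_diff tendsto_const h) blast
          show "\<exists>N. \<forall>n\<ge>N. norm (rep_linf (F m) s - rep_linf (F n) s) \<le> r / 2"
          proof (intro exI allI impI)
            fix n assume "n \<ge> M"
            have "norm (rep_linf (F m) s - rep_linf (F n) s) \<le> norm (F m - F n)" using elim by blast
            also have "\<dots> \<le> r / 2" using M[OF that \<open>n \<ge> M\<close>] by (simp add: dist_norm)
            finally show "norm (rep_linf (F m) s - rep_linf (F n) s) \<le> r / 2" .
          qed
        qed
        with elim show ?case by simp
      qed
    qed
    have "dist (F n) ?l < r" if "n \<ge> M" for n
      using le[OF that] \<open>r > 0\<close> unfolding dist_norm by linarith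
    then show "\<exists>no. \<forall>n\<ge>no. dist (F n) ?l < r" by blast
  qed
  ultimately show "\<exists>l\<in>Linf J. F \<longlonglongrightarrow> l" by blast
qed

lemma banach_space_on_Linf:
  "banach_space_on scale_linf (Linf J :: 'k::{real_normed_field, euclidean_space} linf set)"
proof -
  interpret vector_space "scale_linf :: 'k \<Rightarrow> 'k linf \<Rightarrow> _" by (rule scale_linf_vector_space)
  show ?thesis
    by unfold_locales (simp_all add: norm_scale_linf scale_linf_of_real subspace_Linf complete_Linf)
qed

lemma weak_star_locally_convex:
  fixes x :: "'k::{real_normed_field, euclidean_space} linf"
  assumes "openin (weak_star J) U" "x \<in> U"
  shows "\<exists>C. openin (weak_star J) C \<and> convex C \<and> x \<in> C \<and> C \<subseteq> U"
proof -
  obtain S e where S: "finite S" "S \<subseteq> L1_c0 J" "e > 0"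
    "{h \<in> Linf J. \<forall>g\<in>S. norm (pairing h g - pairing x g) < e} \<subseteq> U"
    using weak_star_nhd[OF assms] by (elim exE conjE)
  define C where "C = {h \<in> Linf J. \<forall>g\<in>S. pairing h g \<in> ball (pairing x g) e}"
  have "C \<subseteq> {h \<in> Linf J. \<forall>g\<in>S. norm (pairing h g - pairing x g) < e}"
    by (auto simp: C_def dist_norm norm_minus_commute)
  then have "C \<subseteq> U" using S(4) by (rule subset_trans)
  have x: "x \<in> Linf J" using assms openin_subset[OF assms(1)] by auto
  have "C = topspace (weak_star J :: 'k linf topology) \<inter>
      \<Inter>((\<lambda>g. {h \<in> Linf J. pairing h g \<in> ball (pairing x g) e}) ` S)"
    unfolding C_def topspace_weak_star by blast
  moreover have "openin (weak_star J) (topspace (weak_star J :: 'k linf topology) \<inter>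
      \<Inter>((\<lambda>g. {h \<in> Linf J. pairing h g \<in> ball (pairing x g) e}) ` S))"
  proof (rule openin_Int_Inter)
    show "openin (weak_star J) (topspace (weak_star J :: 'k linf topology))" by (rule openin_topspace)
    fix A assume "A \<in> (\<lambda>g. {h \<in> Linf J. pairing h g \<in> ball (pairing x g) e}) ` S"
    then show "openin (weak_star J) A" using S(2) openin_weak_star_basic[OF _ open_ball] by fast
  qed (use S(1) in simp)
  ultimately have "openin (weak_star J) C" by simp
  moreover have "convex C"
  proof (rule convexI)
    fix f h :: "'k linf" and u v :: real
    assume f: "f \<in> C" and h: "h \<in> C" and uv: "0 \<le> u" "0 \<le> v" "u + v = 1"
    have "pairing (u *\<^sub>R f + v *\<^sub>R h) g \<in> ball (pairing x g) e" if "g \<in> S" for g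
    proof -
      have g: "g \<in> L1_c0 J" using S that by auto
      have "pairing (u *\<^sub>R f + v *\<^sub>R h) g = u *\<^sub>R pairing f g + v *\<^sub>R pairing h g"
        by (simp add: pairing_add[OF g] pairing_scaleR[OF g])
      moreover have "u *\<^sub>R pairing f g + v *\<^sub>R pairing h g \<in> ball (pairing x g) e"
        using f h that uv by (intro convexD[OF convex_ball]) (auto simp: C_def)
      ultimately show ?thesis by simp
    qed
    moreover have "u *\<^sub>R f + v *\<^sub>R h \<in> Linf J"
      using f h by (intro Linf_add Linf_scaleR) (auto simp: C_def)
    ultimately show "u *\<^sub>R f + v *\<^sub>R h \<in> C" by (simp add: C_def)
  qed
  moreover have "x \<in> C" using S(3) x by (simp add: C_def)
  ultimately show ?thesis using \<open>C \<subseteq> U\<close> by blast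
qed

lemma weak_star_coarser:
  assumes "openin (weak_star J) U"
  shows "openin (top_of_set (Linf J :: 'k::{real_normed_field, euclidean_space} linf set)) U"
proof -
  have "continuous_map (top_of_set (Linf J)) (weak_star J) (\<lambda>f :: 'k linf. f)"
  proof (rule continuous_map_weak_star)
    fix g :: "real \<Rightarrow> 'k c0" assume g: "g \<in> L1_c0 J"
    have "bounded_linear (\<lambda>f :: 'k linf. pairing f g)"
      by (rule bounded_linear_intro[where K = "LINT s|unit_leb. norm (g s)"])
         (simp_all add: pairing_add[OF g] pairing_scaleR[OF g] norm_pairing_le[OF g])
    then show "continuous_map (top_of_set (Linf J)) euclidean (\<lambda>f :: 'k linf. pairing f g)"
      by (simp add: linear_continuous_on)
  qed simp
  from openin_continuous_map_preimage[OF this assms]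
  have "openin (top_of_set (Linf J)) {x \<in> Linf J. x \<in> U}" by simp
  moreover have "{x \<in> Linf J. x \<in> U} = U" using openin_subset[OF assms] by auto
  ultimately show ?thesis by simp
qed

lemma weak_star_add:
  "continuous_map (prod_topology (weak_star J) (weak_star J)) (weak_star J)
    (\<lambda>(x, y :: 'k::{real_normed_field, euclidean_space} linf). x + y)"
proof (rule continuous_map_weak_star)
  fix g :: "real \<Rightarrow> 'k c0" assume g: "g \<in> L1_c0 J"
  have "continuous_map (prod_topology (weak_star J) (weak_star J)) euclidean
      (\<lambda>p. pairing (fst p) g + pairing (snd p) g :: 'k)"
    using continuous_map_compose[OF continuous_map_fst continuous_map_pairing[OF g]]
      continuous_map_compose[OF continuous_map_snd continuous_map_pairing[OF g]]
    by (intro continuous_map_add) (auto simp: o_def)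
  then show "continuous_map (prod_topology (weak_star J) (weak_star J)) euclidean
      (\<lambda>y. pairing (case y of (x, y) \<Rightarrow> (x + y :: 'k linf)) g)"
    by (simp add: case_prod_unfold pairing_add[OF g])
qed (auto intro: Linf_add)

lemma weak_star_scale:
  "continuous_map (prod_topology euclidean (weak_star J)) (weak_star J)
    (\<lambda>(c :: 'k::{real_normed_field, euclidean_space}, x). scale_linf c x)"
proof (rule continuous_map_weak_star)
  fix g :: "real \<Rightarrow> 'k c0" assume g: "g \<in> L1_c0 J"
  have 1: "continuous_map (prod_topology euclidean (weak_star J)) euclidean (\<lambda>p. fst p :: 'k)"
    by (rule continuous_map_fst)
  have 2: "continuous_map (prod_topology euclidean (weak_star J)) euclidean (\<lambda>p :: 'k \<times> _. pairing (snd p) g)"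
    using continuous_map_compose[OF continuous_map_snd continuous_map_pairing[OF g]] by (simp add: o_def)
  have 3: "continuous_map euclidean euclidean (\<lambda>p :: 'k \<times> 'k. fst p * snd p)"
    by (simp add: continuous_intros)
  have "continuous_map (prod_topology euclidean (weak_star J)) euclidean
      (\<lambda>p. fst p * pairing (snd p) g :: 'k)"
    using continuous_map_compose[OF continuous_map_pairedI[OF 1 2], of euclidean "\<lambda>p. fst p * snd p"] 3
    by (simp add: o_def)
  then show "continuous_map (prod_topology euclidean (weak_star J)) euclidean
      (\<lambda>y. pairing (case y of (c :: 'k, x) \<Rightarrow> scale_linf c x) g)"
    by (simp add: case_prod_unfold pairing_scale[OF g])
qed (auto intro: Linf_scale)

section \<open>Weak* convergence of bounded nets through primitives\<close>

lemma tendsto_zero_approx: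
  fixes b :: "'n \<Rightarrow> 'a::real_normed_vector"
  assumes "\<And>e. e > 0 \<Longrightarrow> \<exists>a :: 'n \<Rightarrow> 'a. (a \<longlongrightarrow> 0) Fi \<and> (\<forall>n. norm (b n) \<le> norm (a n) + e)"
  shows "(b \<longlongrightarrow> 0) Fi"
proof (rule tendstoI)
  fix e :: real assume "e > 0"
  then have "e / 2 > 0" by simp
  from assms[OF this] obtain a :: "'n \<Rightarrow> 'a"
    where a: "(a \<longlongrightarrow> 0) Fi" "\<And>n. norm (b n) \<le> norm (a n) + e / 2" by blast
  have "\<forall>\<^sub>F n in Fi. norm (a n) < e / 2"
    using tendstoD[OF a(1), of "e/2"] \<open>e > 0\<close> by (simp add: dist_norm)
  then show "\<forall>\<^sub>F n in Fi. dist (b n) 0 < e"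
  proof eventually_elim
    case (elim n)
    with a(2)[of n] show ?case by simp
  qed
qed

lemma integrable_unit_leb_bounded:
  fixes \<phi> :: "real \<Rightarrow> 'a::{banach, second_countable_topology}"
  assumes "\<phi> \<in> borel_measurable unit_leb" "AE s in unit_leb. norm (\<phi> s) \<le> C"
  shows "integrable unit_leb \<phi>"
  by (rule unit_leb.integrable_const_bound[OF assms(2,1)])

lemma norm_set_integral_le:
  fixes \<phi> :: "real \<Rightarrow> 'a::{banach, second_countable_topology}"
  assumes [measurable]: "\<phi> \<in> borel_measurable unit_leb" "A \<in> sets unit_leb"
    and bd: "AE s in unit_leb. norm (\<phi> s) \<le> C"
  shows "norm (LINT s|unit_leb. indicator A s *\<^sub>R \<phi> s) \<le> C * measure unit_leb A"
proof -
  have i: "integrable unit_leb (\<lambda>s. indicator A s *\<^sub>R \<phi> s)"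
    by (rule integrable_mult_indicator) (auto intro: integrable_unit_leb_bounded[OF _ bd])
  have "norm (LINT s|unit_leb. indicator A s *\<^sub>R \<phi> s) \<le> (LINT s|unit_leb. norm (indicator A s *\<^sub>R \<phi> s))"
    by (rule integral_norm_bound)
  also have "\<dots> \<le> (LINT s|unit_leb. indicator A s *\<^sub>R C)"
  proof (rule integral_mono_AE)
    show "AE s in unit_leb. norm (indicator A s *\<^sub>R \<phi> s) \<le> indicator A s *\<^sub>R C"
      using bd by eventually_elim (auto split: split_indicator)
  qed (intro integrable_norm i, intro integrable_mult_indicator, auto)
  also have "\<dots> = C * measure unit_leb A"
    using sets.sets_into_space[OF assms(2)] by (simp add: unit_leb.emeasure_eq_measure Int_absorb2)
  finally show ?thesis .
qed

lemma integral_sum_plus: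
  fixes f :: "'i \<Rightarrow> 'a \<Rightarrow> 'b::{banach, second_countable_topology}"
  assumes "\<And>i. i \<in> I \<Longrightarrow> integrable M (f i)" "integrable M r"
  shows "(LINT s|M. (\<Sum>i\<in>I. f i s) + r s) = (\<Sum>i\<in>I. integral\<^sup>L M (f i)) + integral\<^sup>L M r"
  by (subst Bochner_Integration.integral_add[OF Bochner_Integration.integrable_sum[OF assms(1)] assms(2)])
     (simp_all add: Bochner_Integration.integral_sum[OF assms(1)])

lemma borel_in_unit_leb:
  "A \<in> sets borel \<Longrightarrow> (\<lambda>s. indicator A s :: real) \<in> borel_measurable unit_leb"
  by (rule measurable_restrict_space1, rule measurable_completion) simp

lemma borel_sets_unit_leb: "A \<in> sets borel \<Longrightarrow> A \<inter> {0..1} \<in> sets unit_leb"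
  by (subst sets_restrict_space_iff) auto

text \<open>
  For uniformly bounded functions, convergence to zero of the integrals over initial intervals passes
  to all measurable sets: the Borel sets with this property form a Dynkin system, because the
  uniform bound controls the tails of disjoint unions.
\<close>

lemma bounded_tendsto_sets:
  fixes \<phi> :: "'n \<Rightarrow> real \<Rightarrow> 'a::{banach, second_countable_topology}"
  assumes meas [measurable]: "\<And>n. \<phi> n \<in> borel_measurable unit_leb"
    and bd: "\<And>n. AE s in unit_leb. norm (\<phi> n s) \<le> C" and C: "0 \<le> C"
    and prim: "\<And>x. x \<in> {0..1} \<Longrightarrow> ((\<lambda>n. LINT s|unit_leb. indicator {0..x} s *\<^sub>R \<phi> n s) \<longlongrightarrow> 0) Fi"
    and A: "A \<in> sets unit_leb"
  shows "((\<lambda>n. LINT s|unit_leb. indicator A s *\<^sub>R \<phi> n s) \<longlongrightarrow> 0) Fi"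
proof -
  have int: "integrable unit_leb (\<lambda>s. indicator A s *\<^sub>R \<phi> n s)" if "A \<in> sets borel" for A n
    using bd[of n] borel_in_unit_leb[OF that]
    by (intro integrable_unit_leb_bounded[where C = C] borel_measurable_scaleR meas)
       (auto elim!: eventually_mono split: split_indicator simp: C)
  have bor: "((\<lambda>n. LINT s|unit_leb. indicator B s *\<^sub>R \<phi> n s) \<longlongrightarrow> 0) Fi" if "B \<in> sets borel" for B
  proof -
    have "B \<in> sigma_sets UNIV (range (\<lambda>a::real. {..a}))" using that by (simp add: borel_eq_atMost)
    have stable: "Int_stable (range (\<lambda>a::real. {..a}))"
      proof (rule Int_stableI)
        fix A B :: "real set" assume "A \<in> range atMost" "B \<in> range atMost"
        then obtain a b where "A = {..a}" "B = {..b}" by blast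
        then have "A \<inter> B = {..min a b}" by auto
        then show "A \<inter> B \<in> range atMost" by blast
      qed
    have "range (\<lambda>a::real. {..a}) \<subseteq> Pow UNIV" by simp
    from stable this \<open>B \<in> sigma_sets UNIV (range atMost)\<close> show ?thesis
    proof (induct rule: sigma_sets_induct_disjoint)
      case (basic A)
      then obtain a where A: "A = {..a}" by auto
      show ?case
      proof (cases "a < 0")
        case True
        have "(LINT s|unit_leb. indicator A s *\<^sub>R \<phi> n s) = (LINT s|unit_leb. 0)" for n
          using True by (intro Bochner_Integration.integral_cong) (auto simp: A split: split_indicator)
        then show ?thesis by simp
      next
        case False
        have "(LINT s|unit_leb. indicator A s *\<^sub>R \<phi> n s)
            = (LINT s|unit_leb. indicator {0..min a 1} s *\<^sub>R \<phi> n s)" for n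
          by (intro Bochner_Integration.integral_cong) (auto simp: A split: split_indicator)
        then show ?thesis using False prim[of "min a 1"] by simp
      qed
    next
      case empty
      show ?case by simp
    next
      case (compl A)
      then have A: "A \<in> sets borel" by (simp add: borel_eq_atMost)
      have "(LINT s|unit_leb. indicator (UNIV - A) s *\<^sub>R \<phi> n s)
          = (LINT s|unit_leb. indicator {0..1} s *\<^sub>R \<phi> n s) - (LINT s|unit_leb. indicator A s *\<^sub>R \<phi> n s)" for n
        by (subst Bochner_Integration.integral_diff[symmetric])
           (auto intro!: int A Bochner_Integration.integral_cong split: split_indicator)
      then show ?case using tendsto_diff[OF prim[of 1] compl(2)] by simp
    next
      case (union A)
      have Ab: "A i \<in> sets borel" for i using union(2) by (auto simp: borel_eq_atMost)
      define R where "R K = (\<Union>i. A i) - (\<Union>i<K. A i)" for K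
      have Rb: "R K \<in> sets borel" for K using Ab by (auto simp: R_def)
      have "(\<lambda>K. measure unit_leb (R K \<inter> {0..1})) \<longlonglongrightarrow> measure unit_leb (\<Inter>K. R K \<inter> {0..1})"
        using borel_sets_unit_leb[OF Rb] by (intro unit_leb.finite_Lim_measure_decseq)
          (auto simp: R_def decseq_def)
      moreover have "(\<Inter>K. R K \<inter> {0..1}) = {}" unfolding R_def by blast
      ultimately have R0: "(\<lambda>K. C * measure unit_leb (R K \<inter> {0..1})) \<longlonglongrightarrow> 0"
        by (intro tendsto_mult_right_zero) simp
      show ?case
      proof (rule tendsto_zero_approx)
        fix e :: real assume "e > 0"
        from order_tendstoD(2)[OF R0 this] obtain K where K: "C * measure unit_leb (R K \<inter> {0..1}) < e"
          by (auto simp: eventually_sequentially)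
        let ?a = "\<lambda>n. \<Sum>i<K. LINT s|unit_leb. indicator (A i) s *\<^sub>R \<phi> n s"
        have "norm (LINT s|unit_leb. indicator (\<Union>i. A i) s *\<^sub>R \<phi> n s) \<le> norm (?a n) + e" for n
        proof -
          have "indicator (\<Union>i. A i) s = (\<Sum>i<K. indicator (A i) s) + (indicator (R K \<inter> {0..1}) s :: real)"
            if "s \<in> {0..1}" for s
          proof -
            have "(\<Sum>i<K. indicator (A i) s) = (indicator (\<Union>i<K. A i) s :: real)"
              using union(1) by (intro indicator_UN_disjoint[symmetric]) (auto simp: disjoint_family_on_def)
            moreover have "indicator (\<Union>i. A i) s = indicator (\<Union>i<K. A i) s + (indicator (R K \<inter> {0..1}) s :: real)"
              using that by (cases "s \<in> (\<Union>i<K. A i)"; cases "s \<in> (\<Union>i. A i)")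
                (simp_all add: R_def indicator_def)
            ultimately show ?thesis by simp
          qed
          then have "(LINT s|unit_leb. indicator (\<Union>i. A i) s *\<^sub>R \<phi> n s)
              = (LINT s|unit_leb. (\<Sum>i<K. indicator (A i) s *\<^sub>R \<phi> n s) + indicator (R K \<inter> {0..1}) s *\<^sub>R \<phi> n s)"
            by (intro Bochner_Integration.integral_cong) (simp_all add: scaleR_left_distrib scaleR_sum_left)
          also have "\<dots> = ?a n + (LINT s|unit_leb. indicator (R K \<inter> {0..1}) s *\<^sub>R \<phi> n s)"
            using borel_sets_unit_leb[OF Rb] by (intro integral_sum_plus int Ab sets.Int Rb) simp
          finally have "norm (LINT s|unit_leb. indicator (\<Union>i. A i) s *\<^sub>R \<phi> n s)
              \<le> norm (?a n) + norm (LINT s|unit_leb. indicator (R K \<inter> {0..1}) s *\<^sub>R \<phi> n s)"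
            by (simp add: norm_triangle_ineq)
          also have "norm (LINT s|unit_leb. indicator (R K \<inter> {0..1}) s *\<^sub>R \<phi> n s) \<le> e"
            using norm_set_integral_le[OF meas[of n] borel_sets_unit_leb[OF Rb[of K]] bd[of n]] K by simp
          finally show ?thesis by simp
        qed
        moreover have "(?a \<longlongrightarrow> 0) Fi"
          using tendsto_sum[of "{..<K}", OF union(3)] by simp
        ultimately show "\<exists>a :: 'n \<Rightarrow> 'a. (a \<longlongrightarrow> 0) Fi \<and>
            (\<forall>n. norm (LINT s|unit_leb. indicator (\<Union>i. A i) s *\<^sub>R \<phi> n s) \<le> norm (a n) + e)"
          by (intro exI[of _ ?a]) simp
      qed
    qed
  qed
  \<comment> \<open>A Lebesgue set differs from a Borel set by a null set.\<close>
  have "A \<in> sets (completion lborel)" using A by (auto simp: sets_restrict_space intro: sets.Int)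
  then obtain S N N' where A: "A = S \<union> N" "N \<subseteq> N'" "N' \<in> null_sets lborel" "S \<in> sets lborel"
    by (elim sets_completionE)
  have "AE s in unit_leb. s \<notin> N'" unfolding AE_unit_leb_iff using AE_not_in[OF A(3)] by eventually_elim simp
  then have ae: "AE s in unit_leb. indicator A s = (indicator S s :: real)"
    by eventually_elim (use A(1,2) in \<open>auto split: split_indicator\<close>)
  have "(LINT s|unit_leb. indicator A s *\<^sub>R \<phi> n s) = (LINT s|unit_leb. indicator S s *\<^sub>R \<phi> n s)" for n
    using borel_in_unit_leb[of S] A(4) \<open>A \<in> sets unit_leb\<close> ae
    by (intro integral_cong_AE borel_measurable_scaleR meas) (auto elim!: eventually_mono)
  with bor[of S] A(4) show ?thesis by simp
qed

text \<open>
  Passage from indicator functions to integrable functions, by density of the simple functions.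
\<close>

lemma bounded_tendsto_L1:
  fixes \<phi> :: "'n \<Rightarrow> real \<Rightarrow> 'k::{real_normed_field, euclidean_space}"
  assumes meas [measurable]: "\<And>n. \<phi> n \<in> borel_measurable unit_leb"
    and bd: "\<And>n. AE s in unit_leb. norm (\<phi> n s) \<le> C" and C: "0 \<le> C"
    and sets: "\<And>A. A \<in> sets unit_leb \<Longrightarrow> ((\<lambda>n. LINT s|unit_leb. indicator A s *\<^sub>R \<phi> n s) \<longlongrightarrow> 0) Fi"
    and h: "integrable unit_leb h"
  shows "((\<lambda>n. LINT s|unit_leb. \<phi> n s * h s) \<longlongrightarrow> 0) Fi"
proof -
  have int: "integrable unit_leb (\<lambda>s. \<phi> n s * f s)" if [measurable]: "integrable unit_leb f" for f n
  proof (rule Bochner_Integration.integrable_bound)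
    show "integrable unit_leb (\<lambda>s. C * norm (f s))" using that by simp
    show "AE s in unit_leb. norm (\<phi> n s * f s) \<le> norm (C * norm (f s))"
      using bd[of n] by eventually_elim (use C in \<open>auto simp: norm_mult intro: mult_right_mono\<close>)
  qed simp
  from h show ?thesis
  proof (induct rule: integrable_induct)
    case (base A c)
    have "(LINT s|unit_leb. \<phi> n s * indicator A s *\<^sub>R c) = (LINT s|unit_leb. indicator A s *\<^sub>R \<phi> n s) * c" for n
      by (simp flip: integral_mult_left_zero add: mult.assoc)
    then show ?case using tendsto_mult_left_zero[OF sets[OF base(1)], of c] by simp
  next
    case (add f g)
    then show ?case using tendsto_add[OF add(2,4)] by (simp add: distrib_left int)
  next
    case (lim f s)
    have [measurable]: "s i \<in> borel_measurable unit_leb" "f \<in> borel_measurable unit_leb" for i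
      using lim by auto
    have R0: "(\<lambda>i. LINT x|unit_leb. C * norm (f x - s i x)) \<longlonglongrightarrow> (LINT x|unit_leb. 0)"
    proof (rule integral_dominated_convergence[where w = "\<lambda>x. C * (3 * norm (f x))"])
      show "integrable unit_leb (\<lambda>x. C * (3 * norm (f x)))" using lim(5) by simp
      show "AE x in unit_leb. (\<lambda>i. C * norm (f x - s i x)) \<longlonglongrightarrow> 0"
      proof (rule AE_I2)
        fix x assume "x \<in> space unit_leb"
        from tendsto_diff[OF tendsto_const lim(3)[OF this], of "f x"]
        show "(\<lambda>i. C * norm (f x - s i x)) \<longlonglongrightarrow> 0" by (intro tendsto_mult_right_zero tendsto_norm_zero) simp
      qed
      show "AE x in unit_leb. norm (C * norm (f x - s i x)) \<le> C * (3 * norm (f x))" for i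
      proof (rule AE_I2)
        fix x assume "x \<in> space unit_leb"
        from lim(4)[OF this, of i] norm_triangle_ineq4[of "f x" "s i x"]
        have "norm (f x - s i x) \<le> 3 * norm (f x)" by simp
        then show "norm (C * norm (f x - s i x)) \<le> C * (3 * norm (f x))"
          using C by (simp add: abs_mult mult_left_mono)
      qed
    qed auto
    show ?case
    proof (rule tendsto_zero_approx)
      fix e :: real assume "e > 0"
      from order_tendstoD(2)[OF R0, of e] this obtain i where i: "(LINT x|unit_leb. C * norm (f x - s i x)) < e"
        by (auto simp: eventually_sequentially)
      have "norm (LINT x|unit_leb. \<phi> n x * f x) \<le> norm (LINT x|unit_leb. \<phi> n x * s i x) + e" for n
      proof -
        have "(LINT x|unit_leb. \<phi> n x * f x)
            = (LINT x|unit_leb. \<phi> n x * s i x) + (LINT x|unit_leb. \<phi> n x * (f x - s i x))"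
          using lim(1)[of i] lim(5) by (simp add: int flip: Bochner_Integration.integral_add) (simp add: algebra_simps)
        moreover have "norm (LINT x|unit_leb. \<phi> n x * (f x - s i x)) \<le> (LINT x|unit_leb. C * norm (f x - s i x))"
        proof (rule order_trans[OF integral_norm_bound], rule integral_mono_AE)
          show "integrable unit_leb (\<lambda>x. norm (\<phi> n x * (f x - s i x)))"
            using lim(1)[of i] lim(5) by (intro integrable_norm int) simp
          show "integrable unit_leb (\<lambda>x. C * norm (f x - s i x))" using lim(1)[of i] lim(5) by simp
          show "AE x in unit_leb. norm (\<phi> n x * (f x - s i x)) \<le> C * norm (f x - s i x)"
            using bd[of n] by eventually_elim (auto simp: norm_mult intro: mult_right_mono)
        qed
        ultimately show ?thesis using i
          norm_triangle_ineq[of "LINT x|unit_leb. \<phi> n x * s i x" "LINT x|unit_leb. \<phi> n x * (f x - s i x)"] by simp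
      qed
      with lim(2)[of i] show "\<exists>a :: 'n \<Rightarrow> 'k. (a \<longlongrightarrow> 0) Fi \<and>
          (\<forall>n. norm (LINT x|unit_leb. \<phi> n x * f x) \<le> norm (a n) + e)"
        by (intro exI[of _ "\<lambda>n. LINT x|unit_leb. \<phi> n x * s i x"]) simp
    qed
  qed
qed

lemma continuous_c0_trunc: "continuous_on UNIV (c0_trunc N)"
proof -
  have "bounded_linear (\<lambda>y. c0_nth y i)" for i
    by (rule bounded_linear_intro[where K = 1]) (auto simp: norm_c0_nth_le)
  then show ?thesis unfolding c0_trunc_def[abs_def]
    by (intro continuous_on_sum linear_continuous_on bounded_linear_compose[OF bounded_linear_c0_single])
qed

lemma borel_c0_nth:
  fixes g :: "'a \<Rightarrow> 'k::{real_normed_vector, second_countable_topology} c0"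
  assumes "g \<in> borel_measurable M"
  shows "(\<lambda>x. c0_nth (g x) i) \<in> borel_measurable M"
proof (rule measurable_compose[OF assms borel_measurable_continuous_onI])
  have "bounded_linear (\<lambda>y :: 'k c0. c0_nth y i)"
    by (rule bounded_linear_intro[where K = 1]) (auto simp: norm_c0_nth_le)
  then show "continuous_on UNIV (\<lambda>y :: 'k c0. c0_nth y i)" by (rule linear_continuous_on)
qed

text \<open>
  Passage from scalar test functions to test functions with values in $c_0$: the truncations of the
  test function converge to it in $L^1$, and a truncated one involves finitely many coordinates.
\<close>

lemma pairing_tendsto_zero:
  fixes D :: "'n \<Rightarrow> 'k::{real_normed_field, euclidean_space} linf"
  assumes bd: "\<And>n. norm (D n) \<le> C"
    and sets: "\<And>i A. A \<in> sets unit_leb \<Longrightarrow>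
      ((\<lambda>n. LINT s|unit_leb. indicator A s *\<^sub>R ell1_nth (rep_linf (D n) s) i) \<longlongrightarrow> 0) Fi"
    and g: "g \<in> L1_c0 J"
  shows "((\<lambda>n. pairing (D n) g) \<longlongrightarrow> 0) Fi"
proof -
  have C: "0 \<le> C" using bd norm_ge_zero order_trans by blast
  note [measurable] = L1_c0_measurable[OF g] borel_c0_nth[OF L1_c0_measurable[OF g]]
  have [measurable]: "(\<lambda>s. c0_trunc N (g s)) \<in> borel_measurable unit_leb" for N
    by (rule measurable_compose[OF L1_c0_measurable[OF g] borel_measurable_continuous_onI[OF continuous_c0_trunc]])
  have AEb: "AE s in unit_leb. norm (rep_linf (D n) s) \<le> C" for n
    using norm_rep_linf[of "D n"] by eventually_elim (rule order_trans[OF _ bd])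
  have R0: "(\<lambda>N. LINT s|unit_leb. C * norm (g s - c0_trunc N (g s))) \<longlonglongrightarrow> (LINT s|unit_leb. 0)"
  proof (rule integral_dominated_convergence[where w = "\<lambda>s. C * norm (g s)"])
    show "integrable unit_leb (\<lambda>s. C * norm (g s))" using L1_c0_norm[OF g] by simp
    show "AE s in unit_leb. (\<lambda>N. C * norm (g s - c0_trunc N (g s))) \<longlonglongrightarrow> 0"
      by (intro AE_I2 tendsto_mult_right_zero c0_trunc_tendsto)
    show "AE s in unit_leb. norm (C * norm (g s - c0_trunc N (g s))) \<le> C * norm (g s)" for N
      using C by (intro AE_I2) (simp add: abs_mult mult_left_mono norm_c0_trunc_le)
  qed auto
  interpret d: bounded_bilinear "duality :: 'k ell1 \<Rightarrow> _" by (rule bounded_bilinear_duality)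
  have gi: "integrable unit_leb (\<lambda>s. c0_nth (g s) i)" for i
    by (rule Bochner_Integration.integrable_bound[OF L1_c0_norm[OF g]]) (auto simp: norm_c0_nth_le)
  have Di: "AE s in unit_leb. norm (ell1_nth (rep_linf (D n) s) i) \<le> C" for n i
    using AEb[of n] by eventually_elim (rule order_trans[OF norm_ell1_nth_le])
  have coord: "((\<lambda>n. LINT s|unit_leb. ell1_nth (rep_linf (D n) s) i * c0_nth (g s) i) \<longlongrightarrow> 0) Fi" for i
    by (rule bounded_tendsto_L1[OF _ Di C sets gi]) auto
  show ?thesis
  proof (rule tendsto_zero_approx)
    fix e :: real assume "e > 0"
    from order_tendstoD(2)[OF R0, of e] this obtain N
      where N: "(LINT s|unit_leb. C * norm (g s - c0_trunc N (g s))) < e"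
      by (auto simp: eventually_sequentially)
    let ?a = "\<lambda>n. \<Sum>i<N. LINT s|unit_leb. ell1_nth (rep_linf (D n) s) i * c0_nth (g s) i"
    have "norm (pairing (D n) g) \<le> norm (?a n) + e" for n
    proof -
      have i1: "integrable unit_leb (\<lambda>s. ell1_nth (rep_linf (D n) s) i * c0_nth (g s) i)" for i
      proof (rule Bochner_Integration.integrable_bound)
        show "integrable unit_leb (\<lambda>s. C * norm (g s))" using L1_c0_norm[OF g] by simp
        show "AE s in unit_leb. norm (ell1_nth (rep_linf (D n) s) i * c0_nth (g s) i) \<le> norm (C * norm (g s))"
          using Di[of n i] by eventually_elim (use C in \<open>auto simp: norm_mult intro!: mult_mono norm_c0_nth_le\<close>)
      qed auto
      have nR: "integrable unit_leb (\<lambda>s. C * norm (g s - c0_trunc N (g s)))"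
      proof (rule Bochner_Integration.integrable_bound)
        show "integrable unit_leb (\<lambda>s. C * norm (g s))" using L1_c0_norm[OF g] by simp
        show "AE s in unit_leb. norm (C * norm (g s - c0_trunc N (g s))) \<le> norm (C * norm (g s))"
          using C by (intro AE_I2) (simp add: abs_mult mult_left_mono norm_c0_trunc_le)
      qed auto
      have bR: "AE s in unit_leb. norm (duality (rep_linf (D n) s) (g s - c0_trunc N (g s))) \<le> C * norm (g s - c0_trunc N (g s))"
        using AEb[of n] by eventually_elim (intro order_trans[OF norm_duality_le] mult_right_mono, auto)
      have i2: "integrable unit_leb (\<lambda>s. duality (rep_linf (D n) s) (g s - c0_trunc N (g s)))"
        using bR by (intro Bochner_Integration.integrable_bound[OF nR]) (auto elim!: eventually_mono)
      have dec: "duality x y = (\<Sum>i<N. ell1_nth x i * c0_nth y i) + duality x (y - c0_trunc N y)" for x :: "'k ell1" and y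
        by (simp add: d.diff_right c0_trunc_def d.sum_right)
      have "pairing (D n) g = (LINT s|unit_leb. (\<Sum>i<N. ell1_nth (rep_linf (D n) s) i * c0_nth (g s) i)
          + duality (rep_linf (D n) s) (g s - c0_trunc N (g s)))"
        unfolding pairing_eq by (rule Bochner_Integration.integral_cong[OF refl dec])
      also have "\<dots> = ?a n + (LINT s|unit_leb. duality (rep_linf (D n) s) (g s - c0_trunc N (g s)))"
        by (intro integral_sum_plus i1 i2)
      finally have "norm (pairing (D n) g)
          \<le> norm (?a n) + norm (LINT s|unit_leb. duality (rep_linf (D n) s) (g s - c0_trunc N (g s)))"
        by (simp add: norm_triangle_ineq)
      also have "norm (LINT s|unit_leb. duality (rep_linf (D n) s) (g s - c0_trunc N (g s)))
          \<le> (LINT s|unit_leb. C * norm (g s - c0_trunc N (g s)))"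
        by (rule order_trans[OF integral_norm_bound integral_mono_AE[OF integrable_norm[OF i2] nR bR]])
      finally show ?thesis using N by simp
    qed
    moreover have "(?a \<longlongrightarrow> 0) Fi"
      using tendsto_sum[of "{..<N}", OF coord] by simp
    ultimately show "\<exists>a :: 'n \<Rightarrow> 'k. (a \<longlongrightarrow> 0) Fi \<and> (\<forall>n. norm (pairing (D n) g) \<le> norm (a n) + e)"
      by (intro exI[of _ ?a]) simp
  qed
qed

section \<open>Weak* limits tested on sets and on intervals\<close>

text \<open>The integral of the \<open>i\<close>-th coordinate of \<open>f\<close> over \<open>A\<close>.\<close>

definition coord_integral :: "'k::{real_normed_field, euclidean_space} linf \<Rightarrow> nat \<Rightarrow> real set \<Rightarrow> 'k" where
  "coord_integral f i A = (LINT s|unit_leb. indicator A s *\<^sub>R ell1_nth (rep_linf f s) i)"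

lemma rep_linf_coord_bound: "AE s in unit_leb. norm (ell1_nth (rep_linf f s) i) \<le> norm f"
  using norm_rep_linf[of f] by eventually_elim (rule order_trans[OF norm_ell1_nth_le])

lemma coord_integrable:
  "A \<in> sets unit_leb \<Longrightarrow> integrable unit_leb (\<lambda>s. indicator A s *\<^sub>R ell1_nth (rep_linf f s) i)"
  by (intro integrable_mult_indicator integrable_unit_leb_bounded[OF _ rep_linf_coord_bound]) auto

lemma coord_measurable:
  assumes "A \<in> sets unit_leb"
  shows "(\<lambda>s. indicator A s *\<^sub>R ell1_nth (rep_linf f s) i) \<in> borel_measurable unit_leb"
  using coord_integrable[OF assms] by (rule borel_measurable_integrable)

lemma interval_in_unit_leb: "x \<in> {0..1} \<Longrightarrow> {0..x} \<in> sets unit_leb"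
  by (subst sets_restrict_space_iff) auto

lemma coord_integral_diff:
  assumes "A \<in> sets unit_leb"
  shows "coord_integral (f - g) i A = coord_integral f i A - coord_integral g i A"
proof -
  have "coord_integral (f - g) i A = (LINT s|unit_leb. indicator A s *\<^sub>R ell1_nth (rep_linf f s) i
      - indicator A s *\<^sub>R ell1_nth (rep_linf g s) i)"
    unfolding coord_integral_def
  proof (rule integral_cong_AE)
    show "AE s in unit_leb. indicator A s *\<^sub>R ell1_nth (rep_linf (f - g) s) i =
        indicator A s *\<^sub>R ell1_nth (rep_linf f s) i - indicator A s *\<^sub>R ell1_nth (rep_linf g s) i"
      using rep_linf_minus[of f g] by eventually_elim (simp add: scaleR_right_diff_distrib)
  qed (intro coord_measurable borel_measurable_diff assms)+
  then show ?thesis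
    unfolding coord_integral_def by (simp add: Bochner_Integration.integral_diff coord_integrable assms)
qed

lemma coord_integral_zero: "A \<in> sets unit_leb \<Longrightarrow> coord_integral 0 i A = 0"
  using coord_integral_diff[of A 0 0 i] by simp

lemma single_in_L1_c0:
  assumes "A \<in> sets unit_leb" "i \<in> J"
  shows "(\<lambda>s. indicator A s *\<^sub>R c0_single i (1 :: 'k::{real_normed_field, euclidean_space})) \<in> L1_c0 J"
  using assms unfolding L1_c0_def
  by (auto simp: unit_leb.emeasure_eq_measure intro!: AE_I2 integrable_scaleR_left)

lemma pairing_single:
  "pairing f (\<lambda>s. indicator A s *\<^sub>R c0_single i 1) = coord_integral f i A"
  unfolding pairing_eq coord_integral_def
  by (simp add: bounded_bilinear.scaleR_right[OF bounded_bilinear_duality])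

lemma coord_integral_outside:
  assumes "f \<in> Linf J" "i \<notin> J" "A \<in> sets unit_leb"
  shows "coord_integral f i A = 0"
proof -
  have "coord_integral f i A = (LINT s|unit_leb. 0)"
    unfolding coord_integral_def
  proof (rule integral_cong_AE)
    show "AE s in unit_leb. indicator A s *\<^sub>R ell1_nth (rep_linf f s) i = 0"
      using LinfD[OF assms(1)] by eventually_elim (use assms(2) in simp)
  qed (intro coord_measurable borel_measurable_const assms)+
  then show ?thesis by simp
qed

lemma limitin_weak_star_coord:
  fixes F :: "'n \<Rightarrow> 'k::{real_normed_field, euclidean_space} linf"
  assumes "limitin (weak_star J) F l Fi" and A: "A \<in> sets unit_leb"
  shows "((\<lambda>n. coord_integral (F n) i A) \<longlongrightarrow> coord_integral l i A) Fi"
proof (cases "i \<in> J")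
  case True
  have "((\<lambda>n. pairing (F n) (\<lambda>s. indicator A s *\<^sub>R c0_single i 1)) \<longlongrightarrow>
      pairing l (\<lambda>s. indicator A s *\<^sub>R c0_single i 1)) Fi"
    using assms(1) single_in_L1_c0[OF A True] unfolding limitin_weak_star by blast
  then show ?thesis by (simp add: pairing_single)
next
  case False
  have l: "l \<in> Linf J" and F: "\<forall>\<^sub>F n in Fi. F n \<in> Linf J" using assms(1) by (auto simp: limitin_weak_star)
  have "\<forall>\<^sub>F n in Fi. coord_integral (F n) i A = 0"
    using F by eventually_elim (rule coord_integral_outside[OF _ False A])
  then show ?thesis
    unfolding coord_integral_outside[OF l False A] by (rule tendsto_eventually)
qed

text \<open>
  The criterion for weak* convergence used throughout: along a filter on which the norms are
  eventually bounded, it suffices to integrate coordinates over initial intervals.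
\<close>

lemma limitin_weak_starI:
  fixes F :: "'n \<Rightarrow> 'k::{real_normed_field, euclidean_space} linf"
  assumes l: "l \<in> Linf J" and F: "\<forall>\<^sub>F n in Fi. F n \<in> Linf J \<and> norm (F n) \<le> C"
    and lim: "\<And>i x. x \<in> {0..1} \<Longrightarrow>
      ((\<lambda>n. coord_integral (F n) i {0..x}) \<longlongrightarrow> coord_integral l i {0..x}) Fi"
  shows "limitin (weak_star J) F l Fi"
  unfolding limitin_weak_star
proof (intro conjI ballI l)
  show "\<forall>\<^sub>F n in Fi. F n \<in> Linf J" using F by (rule eventually_mono) blast
  fix g :: "real \<Rightarrow> 'k c0" assume g: "g \<in> L1_c0 J"
  \<comment> \<open>The bound holds only eventually; the exceptional members of the net are replaced by zero.\<close>
  define D where "D n = (if norm (F n) \<le> C then F n - l else 0)" for n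
  define K where "K = \<bar>C\<bar> + norm l"
  have ev: "\<forall>\<^sub>F n in Fi. D n = F n - l"
    using F by eventually_elim (simp add: D_def)
  have bd: "norm (D n) \<le> K" for n
    using norm_triangle_ineq4[of "F n" l] by (auto simp: D_def K_def)
  have coord: "AE s in unit_leb. norm (ell1_nth (rep_linf (D n) s) i) \<le> K" for n i
    using rep_linf_coord_bound[of "D n" i] by eventually_elim (rule order_trans[OF _ bd])
  have prim: "((\<lambda>n. LINT s|unit_leb. indicator {0..x} s *\<^sub>R ell1_nth (rep_linf (D n) s) i) \<longlongrightarrow> 0) Fi"
    if x: "x \<in> {0..1}" for i x
  proof (rule Lim_transform_eventually)
    show "((\<lambda>n. coord_integral (F n) i {0..x} - coord_integral l i {0..x}) \<longlongrightarrow> 0) Fi"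
      using lim[OF x] by (rule LIM_zero)
    show "\<forall>\<^sub>F n in Fi. coord_integral (F n) i {0..x} - coord_integral l i {0..x} =
        (LINT s|unit_leb. indicator {0..x} s *\<^sub>R ell1_nth (rep_linf (D n) s) i)"
      using ev by eventually_elim
        (simp add: coord_integral_diff[OF interval_in_unit_leb[OF x], symmetric], simp add: coord_integral_def)
  qed
  have "((\<lambda>n. pairing (D n) g) \<longlongrightarrow> 0) Fi"
  proof (rule pairing_tendsto_zero[OF bd _ g])
    fix i :: nat and A :: "real set" assume "A \<in> sets unit_leb"
    then show "((\<lambda>n. LINT s|unit_leb. indicator A s *\<^sub>R ell1_nth (rep_linf (D n) s) i) \<longlongrightarrow> 0) Fi"
      by (intro bounded_tendsto_sets[OF _ coord _ prim]) (auto simp: K_def)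
  qed
  moreover have "\<forall>\<^sub>F n in Fi. pairing (D n) g = pairing (F n) g - pairing l g"
    using ev by eventually_elim (simp add: pairing_diff[OF g])
  ultimately have "((\<lambda>n. pairing (F n) g - pairing l g) \<longlongrightarrow> 0) Fi" by (rule Lim_transform_eventually)
  then show "((\<lambda>n. pairing (F n) g) \<longlongrightarrow> pairing l g) Fi" by (rule LIM_zero_cancel)
qed

section \<open>Sequential completeness of norm-bounded sets\<close>

lemma (in finite_measure) AE_le_of_set_integrals:
  fixes h :: "'a \<Rightarrow> real"
  assumes h: "integrable M h"
    and le: "\<And>A. A \<in> sets M \<Longrightarrow> (LINT s|M. indicator A s *\<^sub>R h s) \<le> C * measure M A"
  shows "AE s in M. h s \<le> C"
proof -
  have [measurable]: "h \<in> borel_measurable M" using h by simp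
  define A where "A = {s \<in> space M. C < h s}"
  have A [measurable]: "A \<in> sets M" unfolding A_def by measurable
  have i1: "integrable M (\<lambda>s. indicator A s *\<^sub>R h s)" "integrable M (\<lambda>s. indicator A s *\<^sub>R C)"
    using h by (intro integrable_mult_indicator A; simp)+
  have k: "integrable M (\<lambda>s. indicator A s *\<^sub>R h s - indicator A s *\<^sub>R C)"
    using i1 by (rule Bochner_Integration.integrable_diff)
  have nn: "AE s in M. 0 \<le> indicator A s *\<^sub>R h s - indicator A s *\<^sub>R C"
    by (rule AE_I2) (auto simp: A_def split: split_indicator)
  have "(LINT s|M. indicator A s *\<^sub>R C) = C * measure M A"
    using sets.sets_into_space[OF A] by (simp add: emeasure_eq_measure Int_absorb2)
  then have "(LINT s|M. indicator A s *\<^sub>R h s - indicator A s *\<^sub>R C) \<le> 0"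
    using le[OF A] by (subst Bochner_Integration.integral_diff[OF i1]) (simp add: mult.commute)
  with integral_nonneg_AE[OF nn] have "(LINT s|M. indicator A s *\<^sub>R h s - indicator A s *\<^sub>R C) = 0" by simp
  then have "AE s in M. indicator A s *\<^sub>R h s - indicator A s *\<^sub>R C = 0"
    using integral_nonneg_eq_0_iff_AE[OF k nn] by simp
  then show ?thesis using AE_space
    by eventually_elim (auto simp: A_def split: split_indicator_asm)
qed

text \<open>
  The setwise limit of the indefinite integrals of a bounded sequence is an indefinite integral:
  after a shift making it nonnegative it is a measure, and the Radon--Nikodym theorem applies.
\<close>

lemma (in finite_measure) weak_limit_density:
  fixes \<phi> :: "nat \<Rightarrow> 'a \<Rightarrow> real"
  assumes meas [measurable]: "\<And>n. \<phi> n \<in> borel_measurable M"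
    and bd: "\<And>n. AE s in M. norm (\<phi> n s) \<le> C" and C: "0 \<le> C"
    and conv: "\<And>A. A \<in> sets M \<Longrightarrow> convergent (\<lambda>n. LINT s|M. indicator A s *\<^sub>R \<phi> n s)"
  shows "\<exists>f. f \<in> borel_measurable M \<and> (AE s in M. norm (f s) \<le> C) \<and>
    (\<forall>A\<in>sets M. (\<lambda>n. LINT s|M. indicator A s *\<^sub>R \<phi> n s) \<longlonglongrightarrow> (LINT s|M. indicator A s *\<^sub>R f s))"
proof -
  define L where "L A = lim (\<lambda>n. LINT s|M. indicator A s *\<^sub>R \<phi> n s)" for A
  have L: "(\<lambda>n. LINT s|M. indicator A s *\<^sub>R \<phi> n s) \<longlonglongrightarrow> L A" if "A \<in> sets M" for A
    using conv[OF that] unfolding L_def by (simp add: convergent_LIMSEQ_iff)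
  have int: "integrable M (\<lambda>s. indicator A s *\<^sub>R \<phi> n s)" if "A \<in> sets M" for A n
    using that by (intro integrable_mult_indicator integrable_const_bound[OF bd]) auto
  have ineq: "\<bar>LINT s|M. indicator A s *\<^sub>R \<phi> n s\<bar> \<le> C * measure M A" if A: "A \<in> sets M" for A n
  proof -
    have "norm (LINT s|M. indicator A s *\<^sub>R \<phi> n s) \<le> (LINT s|M. indicator A s *\<^sub>R C)"
    proof (rule order_trans[OF integral_norm_bound], rule integral_mono_AE)
      show "integrable M (\<lambda>s. norm (indicator A s *\<^sub>R \<phi> n s))" by (intro integrable_norm int A)
      show "integrable M (\<lambda>s. indicator A s *\<^sub>R C)" using A by (intro integrable_mult_indicator) auto
      show "AE s in M. norm (indicator A s *\<^sub>R \<phi> n s) \<le> indicator A s *\<^sub>R C"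
        using bd[of n] by eventually_elim (auto split: split_indicator)
    qed
    then show ?thesis using sets.sets_into_space[OF A] A by (simp add: emeasure_eq_measure Int_absorb2 mult.commute)
  qed
  have Lb: "\<bar>L A\<bar> \<le> C * measure M A" if A: "A \<in> sets M" for A
    by (rule LIMSEQ_le_const2[OF tendsto_rabs[OF L[OF A]]]) (use ineq[OF A] in auto)
  define v where "v A = L A + C * measure M A" for A
  have v: "0 \<le> v A" "v A \<le> 2 * C * measure M A" if "A \<in> sets M" for A
    using Lb[OF that] by (auto simp: v_def)
  have Ladd: "L (A \<union> B) = L A + L B" if "A \<in> sets M" "B \<in> sets M" "A \<inter> B = {}" for A B
  proof (rule LIMSEQ_unique[OF L[of "A \<union> B"]])
    have "(LINT s|M. indicator (A \<union> B) s *\<^sub>R \<phi> n s)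
        = (LINT s|M. indicator A s *\<^sub>R \<phi> n s) + (LINT s|M. indicator B s *\<^sub>R \<phi> n s)" for n
      using that(3) by (subst Bochner_Integration.integral_add[OF int[OF that(1)] int[OF that(2)], symmetric])
        (simp add: indicator_add[symmetric] distrib_right)
    then show "(\<lambda>n. LINT s|M. indicator (A \<union> B) s *\<^sub>R \<phi> n s) \<longlonglongrightarrow> L A + L B"
      using tendsto_add[OF L[OF that(1)] L[OF that(2)]] by simp
  qed (use that in auto)
  define \<nu> where "\<nu> A = ennreal (v A)" for A
  have pos: "positive (sets M) \<nu>" using v(2)[of "{}"] by (auto simp: positive_def \<nu>_def ennreal_neg)
  have "additive (sets M) \<nu>"
    unfolding additive_def
  proof (intro ballI impI)
    fix A B assume AB: "A \<in> sets M" "B \<in> sets M" "A \<inter> B = {}"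
    have "v (A \<union> B) = v A + v B" using Ladd[OF AB] finite_measure_Union[OF AB] by (simp add: v_def algebra_simps)
    then show "\<nu> (A \<union> B) = \<nu> A + \<nu> B" using v(1)[OF AB(1)] v(1)[OF AB(2)] by (simp add: \<nu>_def)
  qed
  moreover have "(\<lambda>i. \<nu> (A i)) \<longlonglongrightarrow> 0"
    if A: "range A \<subseteq> sets M" "decseq A" "(\<Inter>i. A i) = {}" for A
  proof -
    have "(\<lambda>i. 2 * C * measure M (A i)) \<longlonglongrightarrow> 0"
      using finite_Lim_measure_decseq[OF A(1,2)] A(3) by (intro tendsto_mult_right_zero) simp
    then have "(\<lambda>i. v (A i)) \<longlonglongrightarrow> 0"
      by (rule tendsto_sandwich[OF _ _ tendsto_const, rotated 2])
         (use v A(1) in \<open>auto intro!: always_eventually\<close>)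
    then show ?thesis unfolding \<nu>_def using tendsto_ennrealI by fastforce
  qed
  ultimately have ca: "countably_additive (sets M) \<nu>"
    by (intro sets.empty_continuous_imp_countably_additive pos) (auto simp: \<nu>_def)
  define N where "N = measure_of (space M) (sets M) \<nu>"
  have sN: "sets N = sets M" unfolding N_def by (simp add: sets.space_closed)
  have eN: "emeasure N A = \<nu> A" if "A \<in> sets M" for A
    unfolding N_def using pos ca that by (intro emeasure_measure_of_sigma) (auto intro: sets.sigma_algebra_axioms)
  have "absolutely_continuous M N"
    unfolding absolutely_continuous_def
  proof
    fix A assume A: "A \<in> null_sets M"
    then have "v A \<le> 0" using v(2)[of A] by (auto simp: null_sets_def measure_def)
    then show "A \<in> null_sets N" using A eN[of A] by (auto simp: null_sets_def sN \<nu>_def ennreal_neg)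
  qed
  from Radon_Nikodym[OF this sN] obtain f where f [measurable]: "f \<in> borel_measurable M" and dN: "density M f = N"
    by blast
  have fA: "(\<integral>\<^sup>+s. f s * indicator A s \<partial>M) = ennreal (v A)" if "A \<in> sets M" for A
    using eN[OF that] that unfolding dN[symmetric] \<nu>_def by (simp add: emeasure_density)
  \<comment> \<open>The density of the shifted measure is finite almost everywhere; undoing the shift subtracts \<open>C\<close>.\<close>
  define r where "r s = enn2real (f s)" for s
  have [measurable]: "r \<in> borel_measurable M" unfolding r_def[abs_def] by measurable
  have "(\<integral>\<^sup>+s. f s \<partial>M) = (\<integral>\<^sup>+s. f s * indicator (space M) s \<partial>M)"
    by (intro nn_integral_cong) auto
  then have fin: "(\<integral>\<^sup>+s. f s \<partial>M) \<noteq> \<infinity>" using fA[of "space M"] by simp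
  have fr: "AE s in M. f s = ennreal (r s)"
    using nn_integral_PInf_AE[OF f fin] by eventually_elim (simp add: r_def less_top)
  have rA: "(LINT s|M. indicator A s *\<^sub>R r s) = v A \<and> integrable M (\<lambda>s. indicator A s *\<^sub>R r s)"
    if A [measurable]: "A \<in> sets M" for A
  proof -
    have "(\<integral>\<^sup>+s. ennreal (indicator A s *\<^sub>R r s) \<partial>M) = (\<integral>\<^sup>+s. f s * indicator A s \<partial>M)"
      using fr by (intro nn_integral_cong_AE) (auto elim!: eventually_mono split: split_indicator)
    then have "(\<integral>\<^sup>+s. ennreal (indicator A s *\<^sub>R r s) \<partial>M) = ennreal (v A)" using fA[OF A] by simp
    moreover have "0 \<le> r s" for s by (simp add: r_def)
    ultimately have "has_bochner_integral M (\<lambda>s. indicator A s *\<^sub>R r s) (v A)"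
      using v(1)[OF A] by (intro has_bochner_integral_nn_integral) auto
    then show ?thesis by (simp add: has_bochner_integral_iff)
  qed
  have gA: "(LINT s|M. indicator A s *\<^sub>R (r s - C)) = L A" if A: "A \<in> sets M" for A
  proof -
    have i: "integrable M (\<lambda>s. indicator A s *\<^sub>R C)" using A by (intro integrable_mult_indicator) auto
    have "A \<inter> space M = A" using sets.sets_into_space[OF A] by blast
    then show ?thesis
      using rA[OF A] Bochner_Integration.integral_diff[OF conjunct2[OF rA[OF A]] i]
      by (simp add: v_def scaleR_right_diff_distrib right_diff_distrib mult.commute)
  qed
  have "integrable M (\<lambda>s. indicator (space M) s *\<^sub>R r s)" using rA[of "space M"] by simp
  then have "integrable M r" by (rule Bochner_Integration.integrable_cong[THEN iffD1, OF refl, rotated]) simp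
  then have i: "integrable M (\<lambda>s. r s - C)" by simp
  have "AE s in M. r s - C \<le> C"
    using i by (rule AE_le_of_set_integrals) (use Lb gA in \<open>auto simp: abs_le_iff\<close>)
  moreover have "AE s in M. - (r s - C) \<le> C"
  proof (rule AE_le_of_set_integrals)
    show "integrable M (\<lambda>s. - (r s - C))" using i by (rule Bochner_Integration.integrable_minus)
    fix A assume A: "A \<in> sets M"
    have "(LINT s|M. indicator A s *\<^sub>R - (r s - C)) = - (LINT s|M. indicator A s *\<^sub>R (r s - C))"
      by (subst Bochner_Integration.integral_minus[symmetric]) (simp add: algebra_simps)
    then show "(LINT s|M. indicator A s *\<^sub>R - (r s - C)) \<le> C * measure M A"
      using Lb[OF A] gA[OF A] by (simp add: abs_le_iff)
  qed
  ultimately have "AE s in M. norm (r s - C) \<le> C"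
    by eventually_elim (auto simp: abs_le_iff)
  then show ?thesis using L gA by (intro exI[of _ "\<lambda>s. r s - C"]) simp
qed

text \<open>
  The vector-valued version, obtained from the scalar one in each coordinate of the orthonormal basis.
\<close>

lemma vector_weak_limit_density:
  fixes \<phi> :: "nat \<Rightarrow> real \<Rightarrow> 'k::euclidean_space"
  assumes meas [measurable]: "\<And>n. \<phi> n \<in> borel_measurable unit_leb"
    and bd: "\<And>n. AE s in unit_leb. norm (\<phi> n s) \<le> C" and C: "0 \<le> C"
    and conv: "\<And>A. A \<in> sets unit_leb \<Longrightarrow> convergent (\<lambda>n. LINT s|unit_leb. indicator A s *\<^sub>R \<phi> n s)"
  shows "\<exists>f. f \<in> borel_measurable unit_leb \<and> (AE s in unit_leb. norm (f s) \<le> real DIM('k) * C) \<and>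
    (\<forall>A\<in>sets unit_leb. (\<lambda>n. LINT s|unit_leb. indicator A s *\<^sub>R \<phi> n s) \<longlonglongrightarrow>
      (LINT s|unit_leb. indicator A s *\<^sub>R f s))"
proof -
  have int: "integrable unit_leb (\<lambda>s. indicator A s *\<^sub>R \<phi> n s)" if "A \<in> sets unit_leb" for A n
    using that by (intro integrable_mult_indicator unit_leb.integrable_const_bound[OF bd]) auto
  have inner: "(LINT s|unit_leb. indicator A s *\<^sub>R (\<phi> n s \<bullet> b)) = (LINT s|unit_leb. indicator A s *\<^sub>R \<phi> n s) \<bullet> b"
    if "A \<in> sets unit_leb" for A n b
    using int[OF that, of n] by (simp flip: integral_inner_left)
  have "\<exists>f. f \<in> borel_measurable unit_leb \<and> (AE s in unit_leb. norm (f s) \<le> C) \<and>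
    (\<forall>A\<in>sets unit_leb. (\<lambda>n. LINT s|unit_leb. indicator A s *\<^sub>R (\<phi> n s \<bullet> b)) \<longlonglongrightarrow>
      (LINT s|unit_leb. indicator A s *\<^sub>R f s))" if b: "b \<in> Basis" for b
  proof (rule unit_leb.weak_limit_density[OF _ _ C])
    show "AE s in unit_leb. norm (\<phi> n s \<bullet> b) \<le> C" for n
      using bd[of n] by eventually_elim (unfold real_norm_def, rule order_trans[OF Basis_le_norm[OF b]])
    fix A :: "real set" assume A: "A \<in> sets unit_leb"
    obtain l where "(\<lambda>n. LINT s|unit_leb. indicator A s *\<^sub>R \<phi> n s) \<longlonglongrightarrow> l"
      using conv[OF A] by (auto simp: convergent_def)
    then have "(\<lambda>n. (LINT s|unit_leb. indicator A s *\<^sub>R \<phi> n s) \<bullet> b) \<longlonglongrightarrow> l \<bullet> b"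
      by (intro tendsto_intros)
    then show "convergent (\<lambda>n. LINT s|unit_leb. indicator A s *\<^sub>R (\<phi> n s \<bullet> b))"
      unfolding inner[OF A] by (rule convergentI)
  qed simp
  then have "\<forall>b. \<exists>f. b \<in> Basis \<longrightarrow> f \<in> borel_measurable unit_leb \<and> (AE s in unit_leb. norm (f s) \<le> C) \<and>
    (\<forall>A\<in>sets unit_leb. (\<lambda>n. LINT s|unit_leb. indicator A s *\<^sub>R (\<phi> n s \<bullet> b)) \<longlonglongrightarrow>
      (LINT s|unit_leb. indicator A s *\<^sub>R f s))" by blast
  from choice[OF this] obtain f where f:
    "\<And>b. b \<in> Basis \<Longrightarrow> f b \<in> borel_measurable unit_leb"
    "\<And>b. b \<in> Basis \<Longrightarrow> AE s in unit_leb. norm (f b s) \<le> C"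
    "\<And>b A. b \<in> Basis \<Longrightarrow> A \<in> sets unit_leb \<Longrightarrow>
      (\<lambda>n. LINT s|unit_leb. indicator A s *\<^sub>R (\<phi> n s \<bullet> b)) \<longlonglongrightarrow> (LINT s|unit_leb. indicator A s *\<^sub>R f b s)"
    by blast
  let ?f = "\<lambda>s. \<Sum>b\<in>Basis. f b s *\<^sub>R b"
  show ?thesis
  proof (intro exI conjI ballI)
    show "?f \<in> borel_measurable unit_leb" using f(1) by (intro borel_measurable_sum borel_measurable_scaleR) auto
    have "AE s in unit_leb. \<forall>b\<in>Basis. norm (f b s) \<le> C" using f(2) by (intro AE_finite_allI) auto
    then show "AE s in unit_leb. norm (?f s) \<le> real DIM('k) * C"
    proof eventually_elim
      case (elim s)
      have "norm (?f s) \<le> (\<Sum>b\<in>(Basis :: 'k set). C)"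
        by (rule sum_norm_le) (use elim in auto)
      then show ?case by simp
    qed
    fix A :: "real set" assume A: "A \<in> sets unit_leb"
    have fi: "integrable unit_leb (\<lambda>s. indicator A s *\<^sub>R f b s)" if "b \<in> Basis" for b
      by (rule integrable_mult_indicator[OF A unit_leb.integrable_const_bound[OF f(2)[OF that] f(1)[OF that]]])
    have "(LINT s|unit_leb. indicator A s *\<^sub>R ?f s) = (LINT s|unit_leb. (\<Sum>b\<in>Basis. (indicator A s *\<^sub>R f b s) *\<^sub>R b))"
      by (simp add: scaleR_sum_right)
    also have "\<dots> = (\<Sum>b\<in>Basis. LINT s|unit_leb. (indicator A s *\<^sub>R f b s) *\<^sub>R b)"
      by (rule Bochner_Integration.integral_sum) (rule integrable_scaleR_left, rule fi)
    also have "\<dots> = (\<Sum>b\<in>Basis. (LINT s|unit_leb. indicator A s *\<^sub>R f b s) *\<^sub>R b)"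
      by (rule sum.cong[OF refl]) (rule integral_scaleR_left, rule fi)
    finally have "(LINT s|unit_leb. indicator A s *\<^sub>R ?f s) = (\<Sum>b\<in>Basis. (LINT s|unit_leb. indicator A s *\<^sub>R f b s) *\<^sub>R b)" .
    moreover have "(\<lambda>n. \<Sum>b\<in>Basis. ((LINT s|unit_leb. indicator A s *\<^sub>R \<phi> n s) \<bullet> b) *\<^sub>R b) \<longlonglongrightarrow>
        (\<Sum>b\<in>Basis. (LINT s|unit_leb. indicator A s *\<^sub>R f b s) *\<^sub>R b)"
      using f(3)[OF _ A] unfolding inner[OF A] by (intro tendsto_sum tendsto_scaleR tendsto_const)
    ultimately show "(\<lambda>n. LINT s|unit_leb. indicator A s *\<^sub>R \<phi> n s) \<longlonglongrightarrow> (LINT s|unit_leb. indicator A s *\<^sub>R ?f s)"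
      by (simp add: euclidean_representation)
  qed
qed

text \<open>The conjugate phase of \<open>z\<close>: \<open>z * cphase z\<close> is the absolute value of \<open>z\<close>.\<close>

definition cphase :: "'k::real_normed_field \<Rightarrow> 'k" where
  "cphase z = of_real (norm z) * inverse z"

lemma cphase_mult: "z * cphase z = of_real (norm z)"
  by (cases "z = 0") (simp_all add: cphase_def)

lemma norm_cphase_le: "norm (cphase z) \<le> 1"
  by (cases "z = 0") (simp_all add: cphase_def norm_mult norm_inverse)

lemma cphase_0 [simp]: "cphase 0 = 0"
  by (simp add: cphase_def)

lemma borel_cphase [measurable]:
  fixes f :: "'a \<Rightarrow> 'k::{real_normed_field, euclidean_space}"
  assumes [measurable]: "f \<in> borel_measurable M"
  shows "(\<lambda>x. cphase (f x)) \<in> borel_measurable M"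
proof -
  have [measurable]: "(\<lambda>x. inverse (f x)) \<in> borel_measurable M"
    by (rule borel_measurable_inverse) fact
  show ?thesis unfolding cphase_def by measurable
qed

text \<open>
  The limit is built coordinatewise. That its coordinates are summable, with sums bounded by the bound
  of the sequence, is seen by testing against their conjugate phases on an arbitrary measurable set.
\<close>

lemma weak_star_sequentially_complete:
  fixes F :: "nat \<Rightarrow> 'k::{real_normed_field, euclidean_space} linf"
  assumes F: "range F \<subseteq> Linf J" and bF: "bounded (range F)"
    and cauchy: "\<And>U. openin (weak_star J) U \<Longrightarrow> 0 \<in> U \<Longrightarrow> \<exists>N. \<forall>m\<ge>N. \<forall>n\<ge>N. F m - F n \<in> U"
  shows "\<exists>l. limitin (weak_star J) F l sequentially"
proof -
  obtain C where C: "\<And>n. norm (F n) \<le> C" using bF by (auto simp: bounded_iff)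
  have C0: "0 \<le> C" using C[of 0] norm_ge_zero order_trans by blast
  have FJ: "F n \<in> Linf J" for n using F by auto
  have conv_pairing: "convergent (\<lambda>n. pairing (F n) g)" if g: "g \<in> L1_c0 J" for g
  proof -
    have "Cauchy (\<lambda>n. pairing (F n) g)"
    proof (rule metric_CauchyI)
      fix e :: real assume "e > 0"
      have "openin (weak_star J) {h \<in> Linf J. pairing h g \<in> ball 0 e}"
        by (rule openin_weak_star_basic[OF g open_ball])
      moreover have "(0 :: 'k linf) \<in> {h \<in> Linf J. pairing h g \<in> ball 0 e}"
        using \<open>e > 0\<close> by (simp add: Linf_0 pairing_zero[OF g])
      ultimately obtain N where "\<forall>m\<ge>N. \<forall>n\<ge>N. F m - F n \<in> {h \<in> Linf J. pairing h g \<in> ball 0 e}"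
        using cauchy by blast
      then show "\<exists>N. \<forall>m\<ge>N. \<forall>n\<ge>N. dist (pairing (F m) g) (pairing (F n) g) < e"
        by (intro exI[of _ N]) (auto simp: pairing_diff[OF g] dist_norm)
    qed
    then show ?thesis by (rule Cauchy_convergent)
  qed
  have conv: "convergent (\<lambda>n. coord_integral (F n) i A)" if A: "A \<in> sets unit_leb" for i A
  proof (cases "i \<in> J")
    case True
    then show ?thesis using conv_pairing[OF single_in_L1_c0[OF A True]] by (simp add: pairing_single)
  next
    case False
    then show ?thesis by (simp add: coord_integral_outside[OF FJ False A] convergent_const)
  qed
  have cb: "AE s in unit_leb. norm (ell1_nth (rep_linf (F n) s) i) \<le> C" for n i
    using rep_linf_coord_bound[of "F n" i] by eventually_elim (rule order_trans[OF _ C])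
  have "\<forall>i. \<exists>f. f \<in> borel_measurable unit_leb \<and> (AE s in unit_leb. norm (f s) \<le> real DIM('k) * C) \<and>
    (\<forall>A\<in>sets unit_leb. (\<lambda>n. coord_integral (F n) i A) \<longlonglongrightarrow>
      (LINT s|unit_leb. indicator A s *\<^sub>R f s)) \<and> (i \<notin> J \<longrightarrow> f = (\<lambda>_. 0))"
  proof
    fix i
    show "\<exists>f. f \<in> borel_measurable unit_leb \<and> (AE s in unit_leb. norm (f s) \<le> real DIM('k) * C) \<and>
      (\<forall>A\<in>sets unit_leb. (\<lambda>n. coord_integral (F n) i A) \<longlonglongrightarrow>
        (LINT s|unit_leb. indicator A s *\<^sub>R f s)) \<and> (i \<notin> J \<longrightarrow> f = (\<lambda>_. 0))"
    proof (cases "i \<in> J")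
    case True
    then show ?thesis
      using vector_weak_limit_density[of "\<lambda>n s. ell1_nth (rep_linf (F n) s) i" C, OF _ cb C0] conv
      unfolding coord_integral_def by simp
  next
    case False
    have "(\<lambda>n. coord_integral (F n) i A) \<longlonglongrightarrow> 0" if "A \<in> sets unit_leb" for A
      by (simp add: coord_integral_outside[OF FJ False that])
    then show ?thesis using C0 by (intro exI[of _ "\<lambda>_. 0"]) simp
    qed
  qed
  from choice[OF this] obtain f where f:
    "\<And>i. f i \<in> borel_measurable unit_leb" "\<And>i. AE s in unit_leb. norm (f i s) \<le> real DIM('k) * C"
    "\<And>i A. A \<in> sets unit_leb \<Longrightarrow> (\<lambda>n. coord_integral (F n) i A) \<longlonglongrightarrow> (LINT s|unit_leb. indicator A s *\<^sub>R f i s)"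
    "\<And>i. i \<notin> J \<Longrightarrow> f i = (\<lambda>_. 0)" by blast
  note [measurable] = f(1)
  have fi: "integrable unit_leb (f i)" for i
    by (rule unit_leb.integrable_const_bound[OF f(2,1)])
  have weak: "(\<lambda>n. LINT s|unit_leb. ell1_nth (rep_linf (F n) s) i * h s) \<longlonglongrightarrow> (LINT s|unit_leb. f i s * h s)"
    if h: "h \<in> borel_measurable unit_leb" "\<And>s. norm (h s) \<le> 1" for i h
  proof -
    note [measurable] = h(1)
    have hi: "integrable unit_leb h" by (rule unit_leb.integrable_const_bound[of _ 1]) (auto simp: h)
    have bd: "AE s in unit_leb. norm (ell1_nth (rep_linf (F n) s) i - f i s) \<le> C + real DIM('k) * C" for n
      using cb[of n i] f(2)[of i] by eventually_elim (rule order_trans[OF norm_triangle_ineq4 add_mono])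
    have i1: "integrable unit_leb (\<lambda>s. indicator A s *\<^sub>R f i s)" if "A \<in> sets unit_leb" for A
      using that fi by (rule integrable_mult_indicator)
    have "((\<lambda>n. LINT s|unit_leb. (ell1_nth (rep_linf (F n) s) i - f i s) * h s) \<longlonglongrightarrow> 0)"
    proof (rule bounded_tendsto_L1[OF _ bd _ _ hi])
      fix A :: "real set" assume A: "A \<in> sets unit_leb"
      have "(LINT s|unit_leb. indicator A s *\<^sub>R (ell1_nth (rep_linf (F n) s) i - f i s))
          = coord_integral (F n) i A - (LINT s|unit_leb. indicator A s *\<^sub>R f i s)" for n
        unfolding coord_integral_def
        by (subst Bochner_Integration.integral_diff[OF coord_integrable[OF A] i1[OF A], symmetric])
           (simp add: scaleR_right_diff_distrib)
      then show "(\<lambda>n. LINT s|unit_leb. indicator A s *\<^sub>R (ell1_nth (rep_linf (F n) s) i - f i s)) \<longlonglongrightarrow> 0"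
        using LIM_zero[OF f(3)[OF A, of i]] by simp
    qed (use C0 in auto)
    moreover have "(LINT s|unit_leb. (ell1_nth (rep_linf (F n) s) i - f i s) * h s)
        = (LINT s|unit_leb. ell1_nth (rep_linf (F n) s) i * h s) - (LINT s|unit_leb. f i s * h s)" for n
    proof -
      have "AE s in unit_leb. norm (ell1_nth (rep_linf (F n) s) i * h s) \<le> C"
        using cb[of n i] unfolding norm_mult
        by eventually_elim (rule order_trans[OF mult_right_le_one_le[OF norm_ge_zero norm_ge_zero h(2)]])
      moreover have "AE s in unit_leb. norm (f i s * h s) \<le> real DIM('k) * C"
        using f(2)[of i] unfolding norm_mult
        by eventually_elim (rule order_trans[OF mult_right_le_one_le[OF norm_ge_zero norm_ge_zero h(2)]])
      ultimately have "integrable unit_leb (\<lambda>s. ell1_nth (rep_linf (F n) s) i * h s)"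
        "integrable unit_leb (\<lambda>s. f i s * h s)"
        by - (rule unit_leb.integrable_const_bound, assumption, measurable)+
      then show ?thesis by (simp add: left_diff_distrib Bochner_Integration.integral_diff)
    qed
    ultimately show ?thesis by (simp add: LIM_zero_cancel)
  qed
  have sum_le: "AE s in unit_leb. (\<Sum>i<N. norm (f i s)) \<le> C" for N
  proof (rule unit_leb.AE_le_of_set_integrals)
    show "integrable unit_leb (\<lambda>s. \<Sum>i<N. norm (f i s))" using fi by simp
    fix A :: "real set" assume A [measurable]: "A \<in> sets unit_leb"
    \<comment> \<open>Pairing the limit with these test functions gives the integral over \<open>A\<close> of the sum of the absolute values.\<close>
    define h where "h i s = indicator A s *\<^sub>R cphase (f i s)" for i s
    have hm [measurable]: "h i \<in> borel_measurable unit_leb" for i unfolding h_def by measurable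
    have hb: "norm (h i s) \<le> indicator A s" for i s
      by (auto simp: h_def norm_cphase_le split: split_indicator)
    have hb1: "norm (h i s) \<le> 1" for i s using order_trans[OF hb[of i s], of 1] by (simp split: split_indicator)
    have int: "integrable unit_leb (\<lambda>s. ell1_nth (rep_linf (F n) s) i * h i s)" for n i
    proof (rule unit_leb.integrable_const_bound)
      show "AE s in unit_leb. norm (ell1_nth (rep_linf (F n) s) i * h i s) \<le> C * 1"
        using cb[of n i] by eventually_elim (unfold norm_mult, intro mult_mono hb1, use C0 in auto)
    qed simp
    have bound: "norm (\<Sum>i<N. LINT s|unit_leb. ell1_nth (rep_linf (F n) s) i * h i s) \<le> C * measure unit_leb A" for n
    proof -
      have iC: "integrable unit_leb (\<lambda>s. indicator A s *\<^sub>R C)" by (intro integrable_mult_indicator A) simp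
      have "(\<Sum>i<N. LINT s|unit_leb. ell1_nth (rep_linf (F n) s) i * h i s)
          = (LINT s|unit_leb. (\<Sum>i<N. ell1_nth (rep_linf (F n) s) i * h i s))"
        by (rule Bochner_Integration.integral_sum[symmetric]) (rule int)
      also have "norm \<dots> \<le> (LINT s|unit_leb. indicator A s *\<^sub>R C)"
      proof (rule order_trans[OF integral_norm_bound], rule integral_mono_AE)
        show "integrable unit_leb (\<lambda>s. norm (\<Sum>i<N. ell1_nth (rep_linf (F n) s) i * h i s))"
          by (intro integrable_norm Bochner_Integration.integrable_sum int)
        show "AE s in unit_leb. norm (\<Sum>i<N. ell1_nth (rep_linf (F n) s) i * h i s) \<le> indicator A s *\<^sub>R C"
          using norm_rep_linf[of "F n"]
        proof eventually_elim
          case (elim s)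
          have "norm (\<Sum>i<N. ell1_nth (rep_linf (F n) s) i * h i s) \<le> (\<Sum>i<N. norm (ell1_nth (rep_linf (F n) s) i) * indicator A s)"
            by (rule sum_norm_le) (simp add: norm_mult mult_left_mono hb)
          also have "\<dots> \<le> C * indicator A s"
            unfolding sum_distrib_right[symmetric]
            by (intro mult_right_mono order_trans[OF sum_le_norm_ell1] order_trans[OF elim C]) simp
          finally show ?case by (simp add: mult.commute)
        qed
      qed (rule iC)
      also have "\<dots> = C * measure unit_leb A"
        using sets.sets_into_space[OF A] by (simp add: unit_leb.emeasure_eq_measure Int_absorb2)
      finally show ?thesis .
    qed
    have "norm (\<Sum>i<N. LINT s|unit_leb. f i s * h i s) \<le> C * measure unit_leb A"
      by (rule LIMSEQ_le_const2[OF tendsto_norm[OF tendsto_sum[OF weak[OF hm hb1]]]]) (use bound in auto)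
    moreover have "(\<Sum>i<N. LINT s|unit_leb. f i s * h i s)
        = of_real (LINT s|unit_leb. indicator A s *\<^sub>R (\<Sum>i<N. norm (f i s)))"
    proof -
      have i: "integrable unit_leb (\<lambda>s. indicator A s *\<^sub>R norm (f i s))" for i
        using fi by (intro integrable_mult_indicator A integrable_norm)
      have "f i s * h i s = of_real (indicator A s *\<^sub>R norm (f i s))" for i s
        by (simp add: h_def cphase_mult split: split_indicator)
      then have "(LINT s|unit_leb. f i s * h i s) = of_real (LINT s|unit_leb. indicator A s *\<^sub>R norm (f i s))" for i
        unfolding integral_bounded_linear[OF bounded_linear_of_real i, symmetric] by simp
      then have "(\<Sum>i<N. LINT s|unit_leb. f i s * h i s)
          = of_real (\<Sum>i<N. LINT s|unit_leb. indicator A s *\<^sub>R norm (f i s))"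
        by simp
      also have "(\<Sum>i<N. LINT s|unit_leb. indicator A s *\<^sub>R norm (f i s))
          = (LINT s|unit_leb. (\<Sum>i<N. indicator A s *\<^sub>R norm (f i s)))"
        by (rule Bochner_Integration.integral_sum[symmetric]) (rule i)
      finally show ?thesis by (simp add: sum_distrib_left)
    qed
    ultimately show "(LINT s|unit_leb. indicator A s *\<^sub>R (\<Sum>i<N. norm (f i s))) \<le> C * measure unit_leb A"
      by simp
  qed
  define h where "h s = Ell1 (\<lambda>i. if \<forall>N. (\<Sum>i<N. norm (f i s)) \<le> C then f i s else 0)" for s
  have h: "ell1_nth (h s) i = (if \<forall>N. (\<Sum>i<N. norm (f i s)) \<le> C then f i s else 0)" "norm (h s) \<le> C" for s i
  proof -
    have "(\<Sum>i<M. norm (if \<forall>N. (\<Sum>i<N. norm (f i s)) \<le> C then f i s else 0)) \<le> C" for M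
    proof (cases "\<forall>N. (\<Sum>i<N. norm (f i s)) \<le> C")
      case False
      show ?thesis by (simp only: if_not_P[OF False] norm_zero sum.neutral_const C0)
    qed simp
    note ell1_of_bounded_sums[OF this]
    then show "ell1_nth (h s) i = (if \<forall>N. (\<Sum>i<N. norm (f i s)) \<le> C then f i s else 0)" "norm (h s) \<le> C"
      unfolding h_def by simp_all
  qed
  have "h \<in> borel_measurable unit_leb"
  proof (rule borel_measurable_ell1)
    show "(\<lambda>x. ell1_nth (h x) i) \<in> borel_measurable unit_leb" for i unfolding h by measurable
  qed
  then have ess: "ess_bounded h" by (rule ess_boundedI[where C = C]) (simp add: h)
  let ?l = "abs_linf h"
  have "AE s in unit_leb. \<forall>N. (\<Sum>i<N. norm (f i s)) \<le> C" using sum_le by (simp add: AE_all_countable)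
  then have lf: "AE s in unit_leb. \<forall>i. ell1_nth (rep_linf ?l s) i = f i s"
    using rep_abs_linf[OF ess] by eventually_elim (simp add: h)
  have "?l \<in> Linf J" unfolding Linf_def mem_Collect_eq
    using lf by eventually_elim (simp add: f(4))
  moreover have "coord_integral ?l i A = (LINT s|unit_leb. indicator A s *\<^sub>R f i s)" if A: "A \<in> sets unit_leb" for i A
    unfolding coord_integral_def
  proof (rule integral_cong_AE)
    show "AE s in unit_leb. indicator A s *\<^sub>R ell1_nth (rep_linf ?l s) i = indicator A s *\<^sub>R f i s"
      using lf by eventually_elim simp
  qed (use A in auto)
  ultimately have l: "?l \<in> Linf J"
    "\<And>i A. A \<in> sets unit_leb \<Longrightarrow> coord_integral ?l i A = (LINT s|unit_leb. indicator A s *\<^sub>R f i s)" by blast+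
  have "limitin (weak_star J) F ?l sequentially"
  proof (rule limitin_weak_starI[where C = C])
    fix i :: nat and x :: real assume x: "x \<in> {0..1}"
    show "(\<lambda>n. coord_integral (F n) i {0..x}) \<longlonglongrightarrow> coord_integral ?l i {0..x}"
      unfolding l(2)[OF interval_in_unit_leb[OF x]] by (rule f(3)[OF interval_in_unit_leb[OF x]])
  qed (use l(1) FJ C in auto)
  then show ?thesis by blast
qed

section \<open>The functionals of the weak* topology are norming\<close>

text \<open>
  On a set of positive measure finitely many coordinates already have absolute sum above \<open>c\<close>; the
  normalised conjugate phases of these coordinates on that set form the test function.
\<close>

lemma exists_norming_pairing:
  fixes x :: "'k::{real_normed_field, euclidean_space} linf"
  assumes x: "x \<in> Linf J" and c: "0 \<le> c" "c < norm x"
  shows "\<exists>g\<in>L1_c0 J. (LINT s|unit_leb. norm (g s)) \<le> 1 \<and> c \<le> norm (pairing x g)"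
proof -
  let ?x = "\<lambda>i s. ell1_nth (rep_linf x s) i"
  define E where "E N = {s \<in> space unit_leb. c < (\<Sum>i<N. norm (?x i s))}" for N
  have E [measurable]: "E N \<in> sets unit_leb" for N unfolding E_def by measurable
  have "\<exists>N. measure unit_leb (E N) > 0"
  proof (rule ccontr)
    assume "\<not> ?thesis"
    then have "measure unit_leb (E N) = 0" for N
      by (metis measure_nonneg order_le_less)
    then have "E N \<in> null_sets unit_leb" for N
      using E[of N] by (auto simp: null_sets_def unit_leb.emeasure_eq_measure)
    then have "AE s in unit_leb. \<forall>N. s \<notin> E N" unfolding AE_all_countable by (blast intro: AE_not_in)
    then have "AE s in unit_leb. norm (rep_linf x s) \<le> c"
      using AE_space by eventually_elim (auto simp: E_def not_less intro: norm_ell1_le)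
    from norm_linf_le[OF this] c show False by simp
  qed
  then obtain N where N: "measure unit_leb (E N) > 0" by blast
  define m where "m = measure unit_leb (E N)"
  have m: "m > 0" using N by (simp add: m_def)
  define a where "a i s = (indicator (E N) s / m) *\<^sub>R cphase (?x i s)" for i s
  have a_meas [measurable]: "a i \<in> borel_measurable unit_leb" for i unfolding a_def by measurable
  have a_bd: "norm (a i s) \<le> indicator (E N) s / m" for i s
    using m mult_left_mono[OF norm_cphase_le[of "?x i s"], of "1 / m"]
    by (auto simp: a_def split: split_indicator)
  have ai: "integrable unit_leb (a i)" for i
  proof (rule unit_leb.integrable_const_bound[of _ "1 / m"])
    show "AE s in unit_leb. norm (a i s) \<le> 1 / m"
      using m by (intro AE_I2 order_trans[OF a_bd]) (auto split: split_indicator)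
  qed measurable
  define g where "g s = (\<Sum>i<N. c0_single i (a i s))" for s
  have g_nth: "c0_nth (g s) n = (if n < N then a n s else 0)" for s n
  proof -
    have "c0_nth (g s) n = (\<Sum>i<N. if i = n then a i s else 0)"
      by (auto simp: g_def c0_nth_sum intro!: sum.cong)
    then show ?thesis by (simp add: sum.delta)
  qed
  have gi: "integrable unit_leb g" unfolding g_def
    by (rule Bochner_Integration.integrable_sum) (rule integrable_bounded_linear[OF bounded_linear_c0_single ai])
  have gJ: "g \<in> L1_c0 J" unfolding L1_c0_def
  proof (intro CollectI conjI gi)
    show "AE s in unit_leb. \<forall>n. n \<notin> J \<longrightarrow> c0_nth (g s) n = 0"
      using LinfD[OF x] by eventually_elim (simp add: g_nth a_def)
  qed
  have iE: "(LINT s|unit_leb. indicator (E N) s / m) = 1" "integrable unit_leb (\<lambda>s. indicator (E N) s / m :: real)"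
    using m sets.sets_into_space[OF E[of N]] E[of N]
    by (auto simp: m_def Int_absorb2 unit_leb.emeasure_eq_measure)
  have "norm (g s) \<le> indicator (E N) s / m" for s
    using m by (intro norm_c0_le) (auto simp: g_nth a_bd)
  then have "(LINT s|unit_leb. norm (g s)) \<le> (LINT s|unit_leb. indicator (E N) s / m)"
    by (intro integral_mono L1_c0_norm[OF gJ] iE(2))
  then have le1: "(LINT s|unit_leb. norm (g s)) \<le> 1" using iE(1) by simp
  let ?r = "\<lambda>s. (indicator (E N) s / m) * (\<Sum>i<N. norm (?x i s))"
  have dual: "duality (rep_linf x s) (g s) = of_real (?r s)" for s
  proof -
    interpret d: bounded_bilinear "duality :: 'k ell1 \<Rightarrow> _" by (rule bounded_bilinear_duality)
    have "duality (rep_linf x s) (g s) = (\<Sum>i<N. ?x i s * a i s)" by (simp add: g_def d.sum_right)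
    also have "\<dots> = (\<Sum>i<N. of_real ((indicator (E N) s / m) * norm (?x i s)))"
      by (rule sum.cong[OF refl], unfold a_def mult_scaleR_right cphase_mult) (simp add: scaleR_conv_of_real)
    also have "\<dots> = of_real (?r s)" by (simp add: sum_distrib_left)
    finally show ?thesis .
  qed
  have ri: "integrable unit_leb ?r"
  proof (rule unit_leb.integrable_const_bound[of _ "norm x / m"])
    show "AE s in unit_leb. norm (?r s) \<le> norm x / m"
      using norm_rep_linf[of x]
    proof eventually_elim
      case (elim s)
      have "(\<Sum>i<N. norm (?x i s)) \<le> norm x" by (rule order_trans[OF sum_le_norm_ell1 elim])
      then show ?case using m by (auto simp: sum_nonneg divide_right_mono split: split_indicator)
    qed
  qed measurable
  have "c = (LINT s|unit_leb. c * (indicator (E N) s / m))"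
    using iE(1) by simp
  also have "\<dots> \<le> (LINT s|unit_leb. ?r s)"
  proof (rule integral_mono[OF _ ri])
    show "integrable unit_leb (\<lambda>s. c * (indicator (E N) s / m))" by (intro integrable_mult_right iE(2))
    fix s assume "s \<in> space unit_leb"
    show "c * (indicator (E N) s / m) \<le> ?r s"
      using m by (auto simp: E_def divide_right_mono less_imp_le split: split_indicator)
  qed
  also have "\<dots> \<le> norm (pairing x g)"
    unfolding pairing_eq dual integral_bounded_linear[OF bounded_linear_of_real ri] norm_of_real by (rule abs_ge_self)
  finally show ?thesis using gJ le1 by blast
qed

lemma bicontinuous_space_Linf:
  "bicontinuous_space scale_linf (Linf J :: 'k::{real_normed_field, euclidean_space} linf set) (weak_star J)"
proof -
  interpret banach_space_on scale_linf "Linf J :: 'k linf set" by (rule banach_space_on_Linf)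
  show ?thesis
  proof unfold_locales
    show "Hausdorff_space (weak_star J :: 'k linf topology)"
      unfolding Hausdorff_space_def
    proof (intro allI impI)
      fix x y :: "'k linf"
      assume xy: "x \<in> topspace (weak_star J) \<and> y \<in> topspace (weak_star J) \<and> x \<noteq> y"
      then have "x - y \<in> Linf J" "0 < norm (x - y)" by (auto intro: Linf_diff)
      then obtain g where g: "g \<in> L1_c0 J" "norm (x - y) / 2 \<le> norm (pairing (x - y) g)"
        using exists_norming_pairing[of "x - y" J "norm (x - y) / 2"] by auto
      with \<open>0 < norm (x - y)\<close> have "pairing x g \<noteq> pairing y g" by (auto simp: pairing_diff)
      then obtain U V where UV: "open U" "open V" "pairing x g \<in> U" "pairing y g \<in> V" "U \<inter> V = {}"
        using hausdorff[of "pairing x g" "pairing y g"] by blast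
      show "\<exists>U V. openin (weak_star J) U \<and> openin (weak_star J) V \<and> x \<in> U \<and> y \<in> V \<and> disjnt U V"
        using xy UV by (intro exI[of _ "{h \<in> Linf J. pairing h g \<in> U}"] exI[of _ "{h \<in> Linf J. pairing h g \<in> V}"])
          (auto simp: disjnt_def openin_weak_star_basic[OF g(1)])
    qed
    show "norm x = (SUP \<phi> \<in> {\<phi>. linear_functional \<phi> \<and> continuous_map (weak_star J) euclidean \<phi> \<and>
        (\<forall>y\<in>Linf J. norm (\<phi> y) \<le> norm y)}. norm (\<phi> x))" if x: "x \<in> Linf J" for x :: "'k linf"
    proof -
      let ?S = "{\<phi> :: 'k linf \<Rightarrow> 'k. linear_functional \<phi> \<and> continuous_map (weak_star J) euclidean \<phi> \<and>
        (\<forall>y\<in>Linf J. norm (\<phi> y) \<le> norm y)}"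
      have inS: "(\<lambda>f. pairing f g) \<in> ?S" if g: "g \<in> L1_c0 J" "(LINT s|unit_leb. norm (g s)) \<le> 1" for g
      proof -
        have "norm (pairing y g) \<le> norm y" for y :: "'k linf"
          by (rule order_trans[OF norm_pairing_le[OF g(1)] mult_right_le_one_le[OF _ _ g(2)]]) auto
        then show ?thesis
          by (auto simp: linear_functional_def pairing_add[OF g(1)] pairing_scale[OF g(1)] continuous_map_pairing[OF g(1)])
      qed
      have ne: "?S \<noteq> {}" using inS[OF zero_in_L1_c0] by auto
      have bdd: "bdd_above ((\<lambda>\<phi>. norm (\<phi> x)) ` ?S)" using x by (intro bdd_aboveI2[of _ _ "norm x"]) blast
      show ?thesis
      proof (rule antisym)
        show "(SUP \<phi>\<in>?S. norm (\<phi> x)) \<le> norm x" using x by (intro cSUP_least[OF ne]) blast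
        show "norm x \<le> (SUP \<phi>\<in>?S. norm (\<phi> x))"
        proof (rule dense_le)
          fix c assume c: "c < norm x"
          show "c \<le> (SUP \<phi>\<in>?S. norm (\<phi> x))"
          proof (cases "0 \<le> c")
            case True
            obtain g where g: "g \<in> L1_c0 J" "(LINT s|unit_leb. norm (g s)) \<le> 1" "c \<le> norm (pairing x g)"
              using exists_norming_pairing[OF x True c] by blast
            show ?thesis by (rule order_trans[OF g(3) cSUP_upper[OF inS[OF g(1,2)] bdd]])
          next
            case False
            have "0 \<le> norm (pairing x (\<lambda>_. 0))" by simp
            also have "\<dots> \<le> (SUP \<phi>\<in>?S. norm (\<phi> x))"
              by (rule cSUP_upper[OF inS[OF zero_in_L1_c0] bdd]) simp
            finally show ?thesis using False by simp
          qed
        qed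
      qed
    qed
  qed (simp_all add: weak_star_add weak_star_scale weak_star_locally_convex weak_star_coarser
      weak_star_sequentially_complete)
qed

section \<open>Indefinite integrals of bounded Borel functions\<close>

text \<open>
  The indefinite integral from \<open>0\<close>, intended for \<open>x \<ge> 0\<close>; for negative \<open>x\<close> the interval is empty and the value is \<open>0\<close>.
\<close>

definition bint :: "(real \<Rightarrow> 'b::{banach, second_countable_topology}) \<Rightarrow> real \<Rightarrow> 'b" where
  "bint u x = (LINT y|lborel. indicator {0..x} y *\<^sub>R u y)"

text \<open>
  Borel functions on the line bounded by \<open>C\<close> at every point.
\<close>

definition bounded_borel :: "(real \<Rightarrow> 'b::{banach, second_countable_topology}) \<Rightarrow> real \<Rightarrow> bool" where
  "bounded_borel u C \<longleftrightarrow> u \<in> borel_measurable borel \<and> (\<forall>x. norm (u x) \<le> C)"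

lemma bounded_borelD:
  assumes "bounded_borel u C"
  shows "u \<in> borel_measurable borel" "norm (u x) \<le> C" "0 \<le> C"
  using assms norm_ge_zero[of "u 0"] unfolding bounded_borel_def by (blast intro: order_trans)+

lemma integrable_lborel_interval: "integrable lborel (\<lambda>y. indicator {a..b::real} y *\<^sub>R (C :: real))"
  by (intro integrable_scaleR_left integrable_real_indicator) (simp_all add: emeasure_lborel_Icc_eq)

lemma bounded_borel_integrable:
  assumes u: "bounded_borel u C"
  shows "integrable lborel (\<lambda>y. indicator {a..b} y *\<^sub>R u y)"
proof (rule Bochner_Integration.integrable_bound)
  show "integrable lborel (\<lambda>y. indicator {a..b} y *\<^sub>R C)" by (rule integrable_lborel_interval)
  show "(\<lambda>y. indicator {a..b} y *\<^sub>R u y) \<in> borel_measurable lborel"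
    using bounded_borelD(1)[OF u] by (intro borel_measurable_scaleR) auto
  show "AE y in lborel. norm (indicator {a..b} y *\<^sub>R u y) \<le> norm (indicator {a..b} y *\<^sub>R C)"
    using bounded_borelD(2,3)[OF u] by (intro AE_I2) (auto split: split_indicator)
qed

lemma bint_diff:
  assumes u: "bounded_borel u C" and ab: "0 \<le> a" "a \<le> b"
  shows "bint u b - bint u a = (LINT y|lborel. indicator {a..b} y *\<^sub>R u y)"
proof -
  have "bint u b - bint u a = (LINT y|lborel. indicator {0..b} y *\<^sub>R u y - indicator {0..a} y *\<^sub>R u y)"
    unfolding bint_def by (rule Bochner_Integration.integral_diff[symmetric]; rule bounded_borel_integrable[OF u])
  also have "\<dots> = (LINT y|lborel. indicator {a..b} y *\<^sub>R u y)"
  proof (rule integral_cong_AE)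
    show "AE y in lborel. indicator {0..b} y *\<^sub>R u y - indicator {0..a} y *\<^sub>R u y = indicator {a..b} y *\<^sub>R u y"
      using AE_lborel_singleton[of a] by eventually_elim (use ab in \<open>auto split: split_indicator\<close>)
  qed (use bounded_borelD(1)[OF u] in measurable)
  finally show ?thesis .
qed

lemma bint_0 [simp]: "bint u 0 = 0"
proof -
  have "AE y in lborel. indicator {0..0} y *\<^sub>R u y = 0"
    using AE_lborel_singleton[of 0] by eventually_elim (auto split: split_indicator)
  then show ?thesis unfolding bint_def by (rule integral_eq_zero_AE)
qed

lemma bint_Lipschitz:
  assumes u: "bounded_borel u C" and ab: "0 \<le> a" "0 \<le> b"
  shows "norm (bint u b - bint u a) \<le> C * \<bar>b - a\<bar>"
proof -
  have le: "norm (bint u b - bint u a) \<le> C * (b - a)" if "0 \<le> a" "a \<le> b" for a b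
  proof -
    have "norm (bint u b - bint u a) \<le> (LINT y|lborel. indicator {a..b} y *\<^sub>R C)"
      unfolding bint_diff[OF u that]
    proof (rule order_trans[OF integral_norm_bound], rule integral_mono)
      show "integrable lborel (\<lambda>y. norm (indicator {a..b} y *\<^sub>R u y))"
        by (rule integrable_norm[OF bounded_borel_integrable[OF u]])
      show "integrable lborel (\<lambda>y. indicator {a..b} y *\<^sub>R C)" by (rule integrable_lborel_interval)
      show "norm (indicator {a..b} y *\<^sub>R u y) \<le> indicator {a..b} y *\<^sub>R C" for y
        using bounded_borelD(2,3)[OF u] by (auto split: split_indicator)
    qed
    then show ?thesis using that by (simp add: mult.commute)
  qed
  show ?thesis
    using le[of a b] le[of b a] ab by (cases "a \<le> b") (auto simp: norm_minus_commute)
qed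

lemma bint_shift:
  assumes u: "bounded_borel u C" and ab: "0 \<le> a" "0 \<le> x"
  shows "(LINT y|lborel. indicator {0..x} y *\<^sub>R u (a + y)) = bint u (a + x) - bint u a"
proof -
  have "bint u (a + x) - bint u a = (LINT y|lborel. indicator {a..a + x} y *\<^sub>R u y)"
    using ab by (intro bint_diff[OF u]) auto
  also have "\<dots> = (LINT y|lborel. indicator {a..a + x} (a + 1 * y) *\<^sub>R u (a + 1 * y))"
    by (subst lborel_integral_real_affine[of 1 _ a]) simp_all
  also have "\<dots> = (LINT y|lborel. indicator {0..x} y *\<^sub>R u (a + y))"
    by (intro Bochner_Integration.integral_cong) (auto split: split_indicator)
  finally show ?thesis by simp
qed

lemma bint_bounded_linear:
  assumes u: "bounded_borel u C" and h: "bounded_linear h"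
  shows "bint (\<lambda>x. h (u x)) x = h (bint u x)"
  unfolding bint_def using integral_bounded_linear[OF h bounded_borel_integrable[OF u, of 0 x]]
  by (simp add: linear_scale[OF bounded_linear.linear[OF h]])

lemma bint_cong_AE:
  assumes "bounded_borel u C" "bounded_borel v D"
    and "AE y in lborel. 0 \<le> y \<longrightarrow> y \<le> x \<longrightarrow> u y = v y"
  shows "bint u x = bint v x"
  unfolding bint_def
proof (rule integral_cong_AE)
  show "AE y in lborel. indicator {0..x} y *\<^sub>R u y = indicator {0..x} y *\<^sub>R v y"
    using assms(3) by eventually_elim (auto split: split_indicator)
qed (use bounded_borelD(1)[OF assms(1)] bounded_borelD(1)[OF assms(2)] in measurable)

lemma integral_unit_leb_eq:
  fixes u :: "real \<Rightarrow> 'b::{banach, second_countable_topology}"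
  assumes [measurable]: "u \<in> borel_measurable borel"
  shows "(LINT s|unit_leb. u s) = (LINT s|lborel. indicator {0..1} s *\<^sub>R u s)"
  by (subst integral_restrict_space) (auto simp: integral_completion)

lemma unit_leb_interval_integral:
  fixes u :: "real \<Rightarrow> 'b::{banach, second_countable_topology}"
  assumes u [measurable]: "u \<in> borel_measurable borel" and x: "x \<in> {0..1}"
  shows "(LINT s|unit_leb. indicator {0..x} s *\<^sub>R u s) = bint u x"
proof -
  have "(LINT s|unit_leb. indicator {0..x} s *\<^sub>R u s)
      = (LINT s|lborel. indicator {0..1} s *\<^sub>R (indicator {0..x} s *\<^sub>R u s))"
    by (rule integral_unit_leb_eq) measurable
  also have "\<dots> = bint u x" unfolding bint_def
    using x by (intro Bochner_Integration.integral_cong) (auto split: split_indicator)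
  finally show ?thesis .
qed

section \<open>The adjacency operator\<close>

context weighted_network
begin

abbreviation B :: "'k::{real_normed_field, euclidean_space} ell1 \<Rightarrow> 'k ell1" where
  "B \<equiv> adjacency_op G w"

text \<open>By local finiteness every row of the adjacency matrix has finitely many nonzero entries.\<close>

definition row :: "nat \<Rightarrow> nat set" where
  "row i = {j. adjacency G w i j \<noteq> 0}"

lemma finite_row: "finite (row i)"
proof (cases "i \<in> arcs G")
  case True
  have "row i \<subseteq> in_arcs G (tail G i)" by (auto simp: row_def adjacency_def split: if_splits)
  moreover have "finite (in_arcs G (tail G i))" using locally_finite[of "tail G i"] True tail_in_verts by blast
  ultimately show ?thesis by (rule finite_subset)
qed (simp add: row_def adjacency_def)

lemma B_nth: "ell1_nth (B x) i = (\<Sum>j\<in>row i. of_real (adjacency G w i j) * ell1_nth x j)"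
  unfolding adjacency_op_nth by (rule suminf_finite[OF finite_row]) (simp add: row_def)

lemma B_outside: "i \<notin> arcs G \<Longrightarrow> ell1_nth (B x) i = 0"
  by (simp add: B_nth adjacency_def)

lemma norm_B_le: "norm (B x) \<le> norm x"
proof (rule norm_ell1_le)
  fix N
  have fin: "finite (\<Union>i<N. row i)" by (simp add: finite_row)
  have "(\<Sum>i<N. norm (ell1_nth (B x) i))
      \<le> (\<Sum>i<N. \<Sum>j\<in>(\<Union>i<N. row i). adjacency G w i j * norm (ell1_nth x j))"
  proof (rule sum_mono)
    fix i assume "i \<in> {..<N}"
    then have sub: "row i \<subseteq> (\<Union>i<N. row i)" by auto
    have "norm (ell1_nth (B x) i) \<le> (\<Sum>j\<in>row i. adjacency G w i j * norm (ell1_nth x j))"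
      unfolding B_nth by (rule sum_norm_le) (simp add: norm_mult adjacency_nonneg)
    also have "\<dots> \<le> (\<Sum>j\<in>(\<Union>i<N. row i). adjacency G w i j * norm (ell1_nth x j))"
      by (rule sum_mono2[OF fin sub]) (simp add: adjacency_nonneg)
    finally show "norm (ell1_nth (B x) i) \<le> (\<Sum>j\<in>(\<Union>i<N. row i). adjacency G w i j * norm (ell1_nth x j))" .
  qed
  also have "\<dots> = (\<Sum>j\<in>(\<Union>i<N. row i). (\<Sum>i<N. adjacency G w i j) * norm (ell1_nth x j))"
    by (subst sum.swap) (simp add: sum_distrib_right)
  also have "\<dots> \<le> (\<Sum>j\<in>(\<Union>i<N. row i). norm (ell1_nth x j))"
    by (intro sum_mono mult_left_le_one_le sum_adjacency_le_1 sum_nonneg adjacency_nonneg) auto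
  also have "\<dots> \<le> norm x"
    unfolding norm_ell1.rep_eq by (rule sum_le_suminf[OF summable_ell1 fin]) simp
  finally show "(\<Sum>i<N. norm (ell1_nth (B x) i)) \<le> norm x" .
qed

lemma bounded_linear_B: "bounded_linear (B :: 'k::{real_normed_field, euclidean_space} ell1 \<Rightarrow> _)"
proof (rule bounded_linear_intro[where K = 1])
  show "norm (B x) \<le> norm x * 1" for x :: "'k ell1" using norm_B_le by simp
qed (auto intro!: ell1_eqI simp: B_nth distrib_left sum.distrib scaleR_sum_right)

lemma B_scale: "B (scale_ell1 c x) = scale_ell1 c (B x)"
  by (rule ell1_eqI) (simp add: B_nth sum_distrib_left mult.left_commute)

lemma bounded_linear_Bpow: "bounded_linear ((B :: 'k::{real_normed_field, euclidean_space} ell1 \<Rightarrow> _) ^^ n)"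
proof (induct n)
  case 0
  show ?case by (simp add: id_def bounded_linear_ident)
next
  case (Suc n)
  then show ?case using bounded_linear_compose[OF bounded_linear_B Suc] by (simp add: o_def)
qed

lemma norm_Bpow_le: "norm ((B ^^ n) x) \<le> norm x"
  by (induct n) (auto intro: order_trans[OF norm_B_le])

lemma Bpow_scale: "(B ^^ n) (scale_ell1 c x) = scale_ell1 c ((B ^^ n) x)"
  by (induct n) (simp_all add: B_scale)

section \<open>Extension of the initial value along the half-line\<close>

text \<open>
  A Borel representative of an element of the space that is bounded by its norm and vanishes
  outside the index set everywhere, not merely almost everywhere.
\<close>

definition hat :: "'k::{real_normed_field, euclidean_space} linf \<Rightarrow> real \<Rightarrow> 'k ell1" where
  "hat f = (SOME h. h \<in> borel_measurable borel \<and> (\<forall>x. norm (h x) \<le> norm f) \<and>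
    (\<forall>x. \<forall>n. n \<notin> arcs G \<longrightarrow> ell1_nth (h x) n = 0) \<and> (AE s in unit_leb. rep_linf f s = h s))"

lemma
  assumes "f \<in> Linf (arcs G)"
  shows hat_measurable: "hat f \<in> borel_measurable borel"
    and norm_hat: "norm (hat f x) \<le> norm f"
    and hat_outside: "n \<notin> arcs G \<Longrightarrow> ell1_nth (hat f x) n = 0"
    and hat_AE: "AE s in unit_leb. rep_linf f s = hat f s"
  using someI_ex[OF ex_borel_representative[OF assms]] unfolding hat_def by blast+

text \<open>
  The function on the half-line whose translates, restricted to the unit interval, form the orbit of \<open>f\<close>.
  On the negative half-line, where it is irrelevant, the exponent is \<open>0\<close>.
\<close>

definition ext :: "'k::{real_normed_field, euclidean_space} linf \<Rightarrow> real \<Rightarrow> 'k ell1" where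
  "ext f x = (B ^^ nat \<lfloor>x\<rfloor>) (hat f (frac x))"

lemma ext_bounded_borel:
  assumes f: "f \<in> Linf (arcs G)"
  shows "bounded_borel (ext f) (norm f)"
  unfolding bounded_borel_def
proof
  have [measurable]: "(\<lambda>x::real. hat f (frac x)) \<in> borel_measurable borel"
    using hat_measurable[OF f] unfolding frac_def by measurable
  have "(\<lambda>x. (B ^^ n) (hat f (frac x))) \<in> borel_measurable borel" for n
    by (rule measurable_compose[OF _ borel_measurable_continuous_onI[OF linear_continuous_on[OF bounded_linear_Bpow]]]) measurable
  then show "ext f \<in> borel_measurable borel"
    unfolding ext_def[abs_def] by (rule measurable_compose_countable) measurable
  show "\<forall>x. norm (ext f x) \<le> norm f"
    unfolding ext_def using norm_Bpow_le norm_hat[OF f] order_trans by blast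
qed

lemma ext_outside:
  assumes "f \<in> Linf (arcs G)" "n \<notin> arcs G"
  shows "ell1_nth (ext f x) n = 0"
  unfolding ext_def using hat_outside[OF assms] B_outside[OF assms(2)] by (cases "nat \<lfloor>x\<rfloor>") simp_all

lemma ext_plus_one: "0 \<le> x \<Longrightarrow> ext f (1 + x) = B (ext f x)"
proof -
  assume "0 \<le> x"
  then have "nat \<lfloor>1 + x\<rfloor> = Suc (nat \<lfloor>x\<rfloor>)" by (simp add: nat_add_distrib)
  moreover have "frac (1 + x) = frac x" by (simp add: frac_def)
  ultimately show ?thesis by (simp add: ext_def)
qed

lemma ext_plus_nat: "0 \<le> x \<Longrightarrow> ext f (real n + x) = (B ^^ n) (ext f x)"
proof (induct n)
  case (Suc n)
  then show ?case using ext_plus_one[of "real n + x" f] by (simp add: add.assoc)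
qed simp

lemma ext_unit_interval:
  assumes f: "f \<in> Linf (arcs G)"
  shows "AE s in unit_leb. rep_linf f s = ext f s"
proof -
  have "AE s in unit_leb. s < 1"
    unfolding AE_unit_leb_iff using AE_lborel_singleton[of 1] by eventually_elim auto
  with hat_AE[OF f] AE_space show ?thesis
  proof eventually_elim
    case (elim s)
    then have "\<lfloor>s\<rfloor> = 0" by (simp add: floor_eq_iff)
    with elim show ?case by (simp add: ext_def frac_def)
  qed
qed

text \<open>
  A property that holds almost everywhere on the unit interval holds almost everywhere for its periodic continuation.
\<close>

lemma AE_frac:
  assumes "AE s in unit_leb. P s"
  shows "AE x in lborel. P (frac x)"
proof -
  obtain N where N: "N \<in> null_sets lborel" "{s. s \<in> {0..1} \<and> \<not> P s} \<subseteq> N"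
    using assms unfolding AE_unit_leb_iff by (auto elim!: AE_E simp: null_sets_def)
  have "AE x in lborel. \<forall>n::int. x - of_int n \<notin> N"
  proof (subst AE_all_countable, rule allI)
    fix n :: int
    have "Measurable.pred borel (\<lambda>x. x \<notin> N)" using N(1) by (auto simp: null_sets_def)
    from AE_borel_affine[OF _ this AE_not_in[OF N(1)], of 1 "- of_int n"]
    show "AE x in lborel. x - of_int n \<notin> N" by simp
  qed
  then show ?thesis
  proof eventually_elim
    case (elim x)
    then have "frac x \<notin> N" by (simp add: frac_def)
    moreover have "frac x \<in> {0..1}" using frac_lt_1[of x] by (simp add: less_imp_le)
    ultimately show ?case using N(2) by blast
  qed
qed

lemma AE_lborel_shift:
  fixes P :: "real \<Rightarrow> bool"
  assumes "AE x in lborel. P x"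
  shows "AE x in lborel. P (t + x)"
proof -
  obtain N where N: "N \<in> null_sets lborel" "{x. \<not> P x} \<subseteq> N"
    using assms by (auto elim!: AE_E simp: null_sets_def)
  have "Measurable.pred borel (\<lambda>x. x \<notin> N)" using N(1) by (auto simp: null_sets_def)
  from AE_borel_affine[OF _ this AE_not_in[OF N(1)], of 1 t]
  have "AE x in lborel. t + x \<notin> N" by simp
  then show ?thesis by eventually_elim (use N(2) in auto)
qed

lemma ext_cong:
  assumes "f \<in> Linf (arcs G)" and "AE s in unit_leb. rep_linf f s = h s"
  shows "AE x in lborel. ext f x = (B ^^ nat \<lfloor>x\<rfloor>) (h (frac x))"
proof -
  have "AE s in unit_leb. hat f s = h s" using hat_AE[OF assms(1)] assms(2) by eventually_elim simp
  from AE_frac[OF this] show ?thesis by eventually_elim (simp add: ext_def)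
qed

section \<open>The translation semigroup\<close>

text \<open>
  The translation semigroup, on classes of functions.
\<close>

definition T :: "real \<Rightarrow> 'k::{real_normed_field, euclidean_space} linf \<Rightarrow> 'k linf" where
  "T t f = abs_linf (\<lambda>s. ext f (t + s))"

lemma
  assumes f: "f \<in> Linf (arcs G)"
  shows rep_T: "AE s in unit_leb. rep_linf (T t f) s = ext f (t + s)"
    and T_in_Linf: "T t f \<in> Linf (arcs G)"
    and norm_T_le: "norm (T t f) \<le> norm f"
proof -
  note b = ext_bounded_borel[OF f]
  have "(\<lambda>s. ext f (t + s)) \<in> borel_measurable lborel"
    using bounded_borelD(1)[OF b] by measurable
  then have "(\<lambda>s. ext f (t + s)) \<in> borel_measurable unit_leb"
    by (rule measurable_restrict_space1[OF measurable_completion])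
  then have "ess_bounded (\<lambda>s. ext f (t + s))"
    by (rule ess_boundedI[where C = "norm f"]) (simp add: bounded_borelD(2)[OF b])
  from rep_abs_linf[OF this] show ae: "AE s in unit_leb. rep_linf (T t f) s = ext f (t + s)"
    by (simp add: T_def)
  show "T t f \<in> Linf (arcs G)" unfolding Linf_def mem_Collect_eq
    using ae by eventually_elim (simp add: ext_outside[OF f])
  show "norm (T t f) \<le> norm f"
    using ae by (intro norm_linf_le) (auto elim!: eventually_mono simp: bounded_borelD(2)[OF b])
qed

lemma T_formula:
  assumes f: "f \<in> Linf (arcs G)" and t: "0 \<le> t"
  shows "AE s in unit_leb. \<forall>n::nat. real n \<le> t + s \<and> t + s < real n + 1 \<longrightarrow>
    rep_linf (T t f) s = (B ^^ n) (rep_linf f (t + s - real n))"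
proof -
  have "AE x in lborel. rep_linf f (frac (t + x)) = hat f (frac (t + x))"
    by (rule AE_lborel_shift[OF AE_frac[OF hat_AE[OF f]]])
  then have "AE s in unit_leb. rep_linf f (frac (t + s)) = hat f (frac (t + s))"
    unfolding AE_unit_leb_iff by eventually_elim simp
  with rep_T[OF f, of t] show ?thesis
  proof eventually_elim
    case (elim s)
    show ?case
    proof (intro allI impI)
      fix n :: nat assume n: "real n \<le> t + s \<and> t + s < real n + 1"
      then have "\<lfloor>t + s\<rfloor> = int n" by (simp add: floor_eq_iff)
      with elim show "rep_linf (T t f) s = (B ^^ n) (rep_linf f (t + s - real n))"
        by (simp add: ext_def frac_def)
    qed
  qed
qed

lemma T_zero: "f \<in> Linf (arcs G) \<Longrightarrow> T 0 f = f"
proof (rule linf_eqI)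
  assume f: "f \<in> Linf (arcs G)"
  show "AE s in unit_leb. rep_linf (T 0 f) s = rep_linf f s"
    using rep_T[OF f, of 0] ext_unit_interval[OF f] by eventually_elim simp
qed

lemma ext_T:
  assumes f: "f \<in> Linf (arcs G)" and t: "0 \<le> t"
  shows "AE x in lborel. 0 \<le> x \<longrightarrow> ext (T t f) x = ext f (t + x)"
  using ext_cong[OF T_in_Linf[OF f] rep_T[OF f], of t]
proof eventually_elim
  case (elim x)
  show ?case
  proof
    assume "0 \<le> x"
    then have "t + x = real (nat \<lfloor>x\<rfloor>) + (t + frac x)" by (simp add: frac_def)
    then have "ext f (t + x) = ext f (real (nat \<lfloor>x\<rfloor>) + (t + frac x))" by (rule arg_cong)
    also have "\<dots> = (B ^^ nat \<lfloor>x\<rfloor>) (ext f (t + frac x))"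
      using t by (intro ext_plus_nat) simp
    finally show "ext (T t f) x = ext f (t + x)" using elim by simp
  qed
qed

lemma T_add:
  assumes f: "f \<in> Linf (arcs G)" and t: "0 \<le> t" "0 \<le> s"
  shows "T (t + s) f = T t (T s f)"
proof (rule linf_eqI)
  have "AE x in unit_leb. ext (T s f) (t + x) = ext f (s + (t + x))"
    unfolding AE_unit_leb_iff using AE_lborel_shift[OF ext_T[OF f t(2)], of t]
    by eventually_elim (use t(1) in auto)
  then show "AE x in unit_leb. rep_linf (T (t + s) f) x = rep_linf (T t (T s f)) x"
    using rep_T[OF f, of "t + s"] rep_T[OF T_in_Linf[OF f], of t s]
    by eventually_elim (simp add: ac_simps)
qed

lemma T_plus:
  assumes f: "f \<in> Linf (arcs G)" and g: "g \<in> Linf (arcs G)"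
  shows "T t (f + g) = T t f + T t g"
proof (rule linf_eqI)
  have "AE s in unit_leb. rep_linf (f + g) s = hat f s + hat g s"
    using rep_linf_plus[of f g] hat_AE[OF f] hat_AE[OF g] by eventually_elim simp
  from ext_cong[OF Linf_add[OF f g] this]
  have "AE x in lborel. ext (f + g) x = ext f x + ext g x"
    by eventually_elim (simp add: ext_def linear_add[OF bounded_linear.linear[OF bounded_linear_Bpow]])
  from AE_lborel_shift[OF this, of t]
  have "AE s in unit_leb. ext (f + g) (t + s) = ext f (t + s) + ext g (t + s)"
    unfolding AE_unit_leb_iff by eventually_elim simp
  then show "AE s in unit_leb. rep_linf (T t (f + g)) s = rep_linf (T t f + T t g) s"
    using rep_T[OF f, of t] rep_T[OF g, of t] rep_T[OF Linf_add[OF f g], of t] rep_linf_plus[of "T t f" "T t g"]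
    by eventually_elim simp
qed

lemma T_scale:
  assumes f: "f \<in> Linf (arcs G)"
  shows "T t (scale_linf c f) = scale_linf c (T t f)"
proof (rule linf_eqI)
  have "AE s in unit_leb. rep_linf (scale_linf c f) s = scale_ell1 c (hat f s)"
    using rep_linf_scale[of c f] hat_AE[OF f] by eventually_elim simp
  from ext_cong[OF Linf_scale[OF f] this]
  have "AE x in lborel. ext (scale_linf c f) x = scale_ell1 c (ext f x)"
    by eventually_elim (simp add: ext_def Bpow_scale)
  from AE_lborel_shift[OF this, of t]
  have "AE s in unit_leb. ext (scale_linf c f) (t + s) = scale_ell1 c (ext f (t + s))"
    unfolding AE_unit_leb_iff by eventually_elim simp
  then show "AE s in unit_leb. rep_linf (T t (scale_linf c f)) s = rep_linf (scale_linf c (T t f)) s"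
    using rep_T[OF f, of t] rep_T[OF Linf_scale[OF f, of c], of t] rep_linf_scale[of c "T t f"]
    by eventually_elim simp
qed

subsection \<open>Primitives along the orbit\<close>

text \<open>
  The primitive of the \<open>i\<close>-th coordinate of the extension of \<open>f\<close>.
\<close>

definition prim :: "'k::{real_normed_field, euclidean_space} linf \<Rightarrow> nat \<Rightarrow> real \<Rightarrow> 'k" where
  "prim f i = bint (\<lambda>x. ell1_nth (ext f x) i)"

lemma ext_coord_bounded_borel:
  assumes f: "f \<in> Linf (arcs G)"
  shows "bounded_borel (\<lambda>x. ell1_nth (ext f x) i) (norm f)"
  using bounded_borelD[OF ext_bounded_borel[OF f]] unfolding bounded_borel_def
  by (auto intro: order_trans[OF norm_ell1_nth_le])

lemma coord_integral_T:
  assumes f: "f \<in> Linf (arcs G)" and t: "0 \<le> t" and x: "x \<in> {0..1}"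
  shows "coord_integral (T t f) i {0..x} = prim f i (t + x) - prim f i t"
proof -
  note b = ext_coord_bounded_borel[OF f, of i]
  have m: "(\<lambda>s. ell1_nth (ext f (t + s)) i) \<in> borel_measurable borel"
    using bounded_borelD(1)[OF ext_bounded_borel[OF f]] by measurable
  have m': "(\<lambda>s. ell1_nth (ext f (t + s)) i) \<in> borel_measurable unit_leb"
    by (rule measurable_restrict_space1[OF measurable_completion]) (use m in simp)
  have "coord_integral (T t f) i {0..x} = (LINT s|unit_leb. indicator {0..x} s *\<^sub>R ell1_nth (ext f (t + s)) i)"
    unfolding coord_integral_def
  proof (rule integral_cong_AE)
    show "AE s in unit_leb. indicator {0..x} s *\<^sub>R ell1_nth (rep_linf (T t f) s) i =
        indicator {0..x} s *\<^sub>R ell1_nth (ext f (t + s)) i"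
      using rep_T[OF f, of t] by eventually_elim simp
    show "(\<lambda>s. indicator {0..x} s *\<^sub>R ell1_nth (ext f (t + s)) i) \<in> borel_measurable unit_leb"
      using m' interval_in_unit_leb[OF x] by measurable
  qed (rule coord_measurable[OF interval_in_unit_leb[OF x]])
  also have "\<dots> = bint (\<lambda>s. ell1_nth (ext f (t + s)) i) x"
    by (rule unit_leb_interval_integral[OF m x])
  also have "\<dots> = (LINT s|lborel. indicator {0..x} s *\<^sub>R ell1_nth (ext f (t + s)) i)"
    by (simp add: bint_def)
  also have "\<dots> = prim f i (t + x) - prim f i t"
    unfolding prim_def using x by (intro bint_shift[OF b t]) simp
  finally show ?thesis .
qed

lemma coord_integral_prim:
  assumes f: "f \<in> Linf (arcs G)" and x: "x \<in> {0..1}"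
  shows "coord_integral f i {0..x} = prim f i x"
  using coord_integral_T[OF f _ x, of 0 i] by (simp add: T_zero[OF f] prim_def)

lemma prim_Lipschitz:
  "f \<in> Linf (arcs G) \<Longrightarrow> 0 \<le> a \<Longrightarrow> 0 \<le> b \<Longrightarrow> norm (prim f i b - prim f i a) \<le> norm f * \<bar>b - a\<bar>"
  unfolding prim_def by (rule bint_Lipschitz[OF ext_coord_bounded_borel])

text \<open>
  The recursion for primitives across integers; finiteness of the rows makes the sum finite, so it is
  compatible with pointwise limits.
\<close>

lemma prim_plus_one:
  assumes f: "f \<in> Linf (arcs G)" and x: "0 \<le> x"
  shows "prim f i (1 + x) = prim f i 1 + (\<Sum>j\<in>row i. of_real (adjacency G w i j) * prim f j x)"
proof -
  note b = ext_coord_bounded_borel[OF f]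
  have "prim f i (1 + x) - prim f i 1 = (LINT y|lborel. indicator {0..x} y *\<^sub>R ell1_nth (ext f (1 + y)) i)"
    unfolding prim_def by (rule bint_shift[OF b _ x, symmetric]) simp
  also have "\<dots> = (LINT y|lborel. (\<Sum>j\<in>row i. of_real (adjacency G w i j) * (indicator {0..x} y *\<^sub>R ell1_nth (ext f y) j)))"
    by (rule Bochner_Integration.integral_cong[OF refl])
       (auto simp: ext_plus_one B_nth scaleR_sum_right split: split_indicator)
  also have "\<dots> = (\<Sum>j\<in>row i. LINT y|lborel. of_real (adjacency G w i j) * (indicator {0..x} y *\<^sub>R ell1_nth (ext f y) j))"
    by (rule Bochner_Integration.integral_sum) (rule integrable_mult_right, rule bounded_borel_integrable[OF b])
  also have "\<dots> = (\<Sum>j\<in>row i. of_real (adjacency G w i j) * prim f j x)"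
    unfolding prim_def bint_def by (simp only: integral_mult_right_zero)
  finally show ?thesis by (simp add: algebra_simps)
qed

end

section \<open>The semigroup axioms\<close>

text \<open>
  Equi-Lipschitz functions that converge to zero pointwise do so uniformly on compact intervals. Uniformity
  is expressed by convergence along arbitrary bounded sequences of points.
\<close>

lemma Lipschitz_tendsto_uniform:
  fixes p :: "nat \<Rightarrow> real \<Rightarrow> 'a::real_normed_vector"
  assumes lip: "\<And>n a b. 0 \<le> a \<Longrightarrow> 0 \<le> b \<Longrightarrow> norm (p n b - p n a) \<le> C * \<bar>b - a\<bar>" and C: "0 \<le> C"
    and lim: "\<And>x. 0 \<le> x \<Longrightarrow> (\<lambda>n. p n x) \<longlonglongrightarrow> 0"
    and y: "\<And>n. 0 \<le> y n" "\<And>n. y n \<le> R"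
  shows "(\<lambda>n. p n (y n)) \<longlonglongrightarrow> 0"
proof (rule tendstoI)
  fix e :: real assume e: "e > 0"
  \<comment> \<open>The mesh of a grid on which the Lipschitz bound costs at most \<open>e/2\<close>.\<close>
  define d where "d = e / (2 * (C + 1))"
  have d: "d > 0" "C * d \<le> e / 2" using e C by (simp_all add: d_def field_simps)
  have "\<forall>\<^sub>F n in sequentially. \<forall>k\<in>{..nat \<lfloor>R / d\<rfloor>}. norm (p n (real k * d)) < e / 2"
  proof (rule eventually_ball_finite[OF finite_atMost], rule ballI)
    fix k
    have "0 \<le> real k * d" "e / 2 > 0" using d(1) e by simp_all
    from tendstoD[OF lim[OF this(1)] this(2)]
    show "\<forall>\<^sub>F n in sequentially. norm (p n (real k * d)) < e / 2" by (simp add: dist_norm)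
  qed
  then show "\<forall>\<^sub>F n in sequentially. dist (p n (y n)) 0 < e"
  proof eventually_elim
    case (elim n)
    define k where "k = nat \<lfloor>y n / d\<rfloor>"
    have k: "real k = of_int \<lfloor>y n / d\<rfloor>" using y(1)[of n] d(1) by (simp add: k_def)
    have "real k \<le> y n / d" "y n / d < real k + 1" unfolding k by linarith+
    then have "real k * d \<le> y n" "y n - real k * d \<le> d" using d(1) by (simp_all add: field_simps)
    then have "norm (p n (y n) - p n (real k * d)) \<le> C * d"
      using lip[of "real k * d" "y n" n] y(1)[of n] d(1) C
      by (intro order_trans[OF lip mult_left_mono]) auto
    moreover have "k \<le> nat \<lfloor>R / d\<rfloor>"
      unfolding k_def using y(2)[of n] d(1) by (intro nat_mono floor_mono divide_right_mono) auto
    ultimately show ?case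
      using elim d(2) norm_triangle_sub[of "p n (y n)" "p n (real k * d)"] by force
  qed
qed

context weighted_network
begin

lemma prim_tendsto_zero:
  fixes F :: "nat \<Rightarrow> 'k::{real_normed_field, euclidean_space} linf"
  assumes F: "\<And>n. F n \<in> Linf (arcs G)" and lim: "limitin (weak_star (arcs G)) F 0 sequentially"
    and x: "0 \<le> x"
  shows "(\<lambda>n. prim (F n) i x) \<longlonglongrightarrow> 0"
proof -
  have unit: "(\<lambda>n. prim (F n) i x) \<longlonglongrightarrow> 0" if "x \<in> {0..1}" for i x
    using limitin_weak_star_coord[OF lim interval_in_unit_leb[OF that], of i]
    by (simp add: coord_integral_prim[OF F that] coord_integral_zero[OF interval_in_unit_leb[OF that]])
  have all: "\<forall>i x. 0 \<le> x \<and> x \<le> real m + 1 \<longrightarrow> (\<lambda>n. prim (F n) i x) \<longlonglongrightarrow> 0" for m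
  proof (induct m)
    case 0
    show ?case using unit by simp
  next
    case (Suc m)
    show ?case
    proof (intro allI impI)
      fix i and x :: real assume x: "0 \<le> x \<and> x \<le> real (Suc m) + 1"
      show "(\<lambda>n. prim (F n) i x) \<longlonglongrightarrow> 0"
      proof (cases "x \<le> 1")
        case False
        have "(\<lambda>n. prim (F n) i 1 + (\<Sum>j\<in>row i. of_real (adjacency G w i j) * prim (F n) j (x - 1))) \<longlonglongrightarrow>
            0 + (\<Sum>j\<in>row i. of_real (adjacency G w i j) * 0)"
        proof (intro tendsto_add tendsto_sum tendsto_mult tendsto_const)
          show "(\<lambda>n. prim (F n) j (x - 1)) \<longlonglongrightarrow> 0" for j using Suc x False by simp
          show "(\<lambda>n. prim (F n) i 1) \<longlonglongrightarrow> 0" by (rule unit) simp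
        qed
        then show ?thesis using False prim_plus_one[OF F, of "x - 1" _ i] by simp
      qed (use unit x in auto)
    qed
  qed
  have "x \<le> real (nat \<lceil>x\<rceil>) + 1" by linarith
  with all[of "nat \<lceil>x\<rceil>"] x show ?thesis by blast
qed

lemma T_contraction_semigroup:
  "contraction_bicontinuous_semigroup scale_linf
    (Linf (arcs G) :: 'k::{real_normed_field, euclidean_space} linf set) (weak_star (arcs G)) T"
proof -
  interpret bicontinuous_space scale_linf "Linf (arcs G) :: 'k linf set" "weak_star (arcs G)"
    by (rule bicontinuous_space_Linf)
  show ?thesis
  proof unfold_locales
    fix t :: real assume "0 \<le> t"
    show "bounded_operator (T t :: 'k linf \<Rightarrow> _)"
      unfolding bounded_operator_def
      by (auto intro!: T_in_Linf T_plus T_scale exI[of _ 1] norm_T_le)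
  next
    fix f :: "'k linf" assume f: "f \<in> Linf (arcs G)"
    show "continuous_map (top_of_set {0..}) (weak_star (arcs G)) (\<lambda>t. T t f)"
    proof (rule continuous_map_weak_star)
      fix g :: "real \<Rightarrow> 'k c0" assume g: "g \<in> L1_c0 (arcs G)"
      have "((\<lambda>t. pairing (T t f) g) \<longlongrightarrow> pairing (T t0 f) g) (at t0 within {0..})" if t0: "t0 \<in> {0..}" for t0
      proof -
        have "limitin (weak_star (arcs G)) (\<lambda>t. T t f) (T t0 f) (at t0 within {0..})"
        proof (rule limitin_weak_starI[where C = "norm f"])
          show "\<forall>\<^sub>F t in at t0 within {0..}. T t f \<in> Linf (arcs G) \<and> norm (T t f) \<le> norm f"
            by (simp add: T_in_Linf[OF f] norm_T_le[OF f])
          fix i and x :: real assume x: "x \<in> {0..1}"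
          have pos: "\<forall>\<^sub>F t in at t0 within {0..}. 0 \<le> t" by (simp add: eventually_at_filter)
          have cont: "((\<lambda>t. prim f i (t + a)) \<longlongrightarrow> prim f i (t0 + a)) (at t0 within {0..})" if "0 \<le> a" for a
          proof (rule LIM_zero_cancel, rule Lim_null_comparison)
            show "\<forall>\<^sub>F t in at t0 within {0..}. norm (prim f i (t + a) - prim f i (t0 + a)) \<le> norm f * \<bar>t - t0\<bar>"
              using pos
            proof eventually_elim
              case (elim t)
              then show ?case using prim_Lipschitz[OF f, of "t0 + a" "t + a" i] t0 that by simp
            qed
            have "((\<lambda>t. norm f * \<bar>t - t0\<bar>) \<longlongrightarrow> norm f * \<bar>t0 - t0\<bar>) (at t0 within {0..})"
              by (intro tendsto_intros)
            then show "((\<lambda>t. norm f * \<bar>t - t0\<bar>) \<longlongrightarrow> 0) (at t0 within {0..})" by simp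
          qed
          have "((\<lambda>t. prim f i (t + x) - prim f i (t + 0)) \<longlongrightarrow> coord_integral (T t0 f) i {0..x}) (at t0 within {0..})"
            using t0 x by (subst coord_integral_T[OF f]) (auto intro!: tendsto_diff cont cont[of 0, simplified])
          then show "((\<lambda>t. coord_integral (T t f) i {0..x}) \<longlongrightarrow> coord_integral (T t0 f) i {0..x}) (at t0 within {0..})"
            by (rule Lim_transform_eventually)
               (use pos in \<open>eventually_elim, simp add: coord_integral_T[OF f _ x]\<close>)
        qed (rule T_in_Linf[OF f])
        then show ?thesis using g by (simp add: limitin_weak_star)
      qed
      then show "continuous_map (top_of_set {0..}) euclidean (\<lambda>t. pairing (T t f) g)"
        by (simp add: continuous_on_def)
    qed (simp add: T_in_Linf[OF f])
  next
    show "\<exists>M\<ge>1. \<exists>\<omega>. \<forall>t\<ge>0. \<forall>f\<in>(Linf (arcs G) :: 'k linf set). norm (T t f) \<le> M * exp (\<omega> * t) * norm f"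
      by (rule exI[of _ 1], simp, rule exI[of _ 0]) (simp add: norm_T_le)
  next
    fix F :: "nat \<Rightarrow> 'k linf" and t0 :: real and U :: "'k linf set"
    assume F: "range F \<subseteq> Linf (arcs G)" and bF: "bounded (range F)"
      and lim: "limitin (weak_star (arcs G)) F 0 sequentially" and t0: "0 \<le> t0"
      and U: "openin (weak_star (arcs G)) U" "0 \<in> U"
    have FJ: "F n \<in> Linf (arcs G)" for n using F by auto
    obtain C where C: "\<And>n. norm (F n) \<le> C" using bF by (auto simp: bounded_iff)
    have C0: "0 \<le> C" using C[of 0] norm_ge_zero order_trans by blast
    \<comment> \<open>For each \<open>n\<close> a time at which \<open>T s (F n)\<close> leaves \<open>U\<close> is selected, if there is one.\<close>
    have "\<forall>n. \<exists>s. s \<in> {0..t0} \<and> ((\<exists>s\<in>{0..t0}. T s (F n) \<notin> U) \<longrightarrow> T s (F n) \<notin> U)"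
    proof
      fix n
      show "\<exists>s. s \<in> {0..t0} \<and> ((\<exists>s\<in>{0..t0}. T s (F n) \<notin> U) \<longrightarrow> T s (F n) \<notin> U)"
        using t0 by (cases "\<exists>s\<in>{0..t0}. T s (F n) \<notin> U") (blast, intro exI[of _ 0], simp)
    qed
    from choice[OF this] obtain s where s: "\<And>n. s n \<in> {0..t0}"
      "\<And>n. (\<exists>s\<in>{0..t0}. T s (F n) \<notin> U) \<Longrightarrow> T (s n) (F n) \<notin> U" by blast
    have "limitin (weak_star (arcs G)) (\<lambda>n. T (s n) (F n)) 0 sequentially"
    proof (rule limitin_weak_starI[where C = C])
      show "\<forall>\<^sub>F n in sequentially. T (s n) (F n) \<in> Linf (arcs G) \<and> norm (T (s n) (F n)) \<le> C"
        by (simp add: T_in_Linf[OF FJ] order_trans[OF norm_T_le[OF FJ] C])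
      fix i and x :: real assume x: "x \<in> {0..1}"
      have lip: "norm (prim (F n) i b - prim (F n) i a) \<le> C * \<bar>b - a\<bar>" if "0 \<le> a" "0 \<le> b" for n a b
        by (rule order_trans[OF prim_Lipschitz[OF FJ that] mult_right_mono[OF C]]) simp
      have s0: "0 \<le> s n" "s n \<le> t0" for n using s(1)[of n] by auto
      have "(\<lambda>n. prim (F n) i (s n + x)) \<longlonglongrightarrow> 0"
        using s0 x by (intro Lipschitz_tendsto_uniform[OF lip C0 prim_tendsto_zero[OF FJ lim], of _ "t0 + 1"])
          (auto intro: add_mono)
      moreover have "(\<lambda>n. prim (F n) i (s n)) \<longlonglongrightarrow> 0"
        using s0 by (intro Lipschitz_tendsto_uniform[OF lip C0 prim_tendsto_zero[OF FJ lim], of _ t0]) auto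
      ultimately have "(\<lambda>n. prim (F n) i (s n + x) - prim (F n) i (s n)) \<longlonglongrightarrow> 0"
        using tendsto_diff by fastforce
      then show "(\<lambda>n. coord_integral (T (s n) (F n)) i {0..x}) \<longlonglongrightarrow> coord_integral 0 i {0..x}"
        by (simp add: coord_integral_T[OF FJ s0(1) x] coord_integral_zero[OF interval_in_unit_leb[OF x]])
    qed (rule Linf_0)
    then have "\<forall>\<^sub>F n in sequentially. T (s n) (F n) \<in> U"
      using U by (auto simp: limitin_def)
    then show "\<forall>\<^sub>F n in sequentially. \<forall>s\<in>{0..t0}. T s (F n) \<in> U"
      by eventually_elim (use s(2) in blast)
  qed (simp_all add: T_zero T_add norm_T_le)
qed

end

section \<open>Differentiation of indefinite integrals and uniqueness\<close>

lemma bint_local_bound: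
  fixes k :: "'b::{banach, second_countable_topology}"
  assumes u: "bounded_borel u C" and ab: "0 \<le> a" "a \<le> b"
    and le: "\<And>y. a \<le> y \<Longrightarrow> y \<le> b \<Longrightarrow> norm (u y - k) \<le> e"
  shows "norm (bint u b - bint u a - (b - a) *\<^sub>R k) \<le> e * (b - a)"
proof -
  have const: "bounded_borel (\<lambda>_. k) (norm k)" by (simp add: bounded_borel_def)
  have "(b - a) *\<^sub>R k = (LINT y|lborel. indicator {a..b} y *\<^sub>R k)"
    using ab by simp
  then have "bint u b - bint u a - (b - a) *\<^sub>R k = (LINT y|lborel. indicator {a..b} y *\<^sub>R (u y - k))"
    unfolding bint_diff[OF u ab]
    using Bochner_Integration.integral_diff[OF bounded_borel_integrable[OF u, of a b] bounded_borel_integrable[OF const, of a b]]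
    by (simp add: scaleR_right_diff_distrib)
  also have "norm \<dots> \<le> (LINT y|lborel. indicator {a..b} y *\<^sub>R e)"
  proof (rule order_trans[OF integral_norm_bound], rule integral_mono)
    have "integrable lborel (\<lambda>y. indicator {a..b} y *\<^sub>R u y - indicator {a..b} y *\<^sub>R k)"
      by (rule Bochner_Integration.integrable_diff; rule bounded_borel_integrable, rule u const)
    then show "integrable lborel (\<lambda>y. norm (indicator {a..b} y *\<^sub>R (u y - k)))"
      by (intro integrable_norm) (simp add: scaleR_right_diff_distrib)
    show "integrable lborel (\<lambda>y. indicator {a..b} y *\<^sub>R e)" by (rule integrable_lborel_interval)
    show "norm (indicator {a..b} y *\<^sub>R (u y - k)) \<le> indicator {a..b} y *\<^sub>R e" for y
      using le[of y] by (auto split: split_indicator)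
  qed
  finally show ?thesis using ab by (simp add: mult.commute)
qed

lemma bint_right_derivative:
  fixes u :: "real \<Rightarrow> 'b::{banach, second_countable_topology}"
  assumes u: "bounded_borel u C" and c: "0 \<le> c" and lim: "(u \<longlongrightarrow> u c) (at_right c)"
  shows "((\<lambda>t. (1 / t) *\<^sub>R (bint u (c + t) - bint u c)) \<longlongrightarrow> u c) (at_right 0)"
proof (rule tendstoI)
  fix e :: real assume e: "e > 0"
  then have "\<forall>\<^sub>F y in at_right c. dist (u y) (u c) < e / 2" using tendstoD[OF lim, of "e/2"] by simp
  then obtain d where d: "d > c" "\<And>y. c < y \<Longrightarrow> y < d \<Longrightarrow> dist (u y) (u c) < e / 2"
    unfolding eventually_at_right_field by blast
  have "dist ((1 / t) *\<^sub>R (bint u (c + t) - bint u c)) (u c) < e" if t: "0 < t" "t < d - c" for t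
  proof -
    have "norm (bint u (c + t) - bint u c - (c + t - c) *\<^sub>R u c) \<le> e / 2 * (c + t - c)"
    proof (rule bint_local_bound[OF u c])
      fix y assume y: "c \<le> y" "y \<le> c + t"
      show "norm (u y - u c) \<le> e / 2"
        using d(2)[of y] y t e by (cases "y = c") (auto simp: dist_norm less_imp_le)
    qed (use t in simp)
    then have "(1 / t) * norm (bint u (c + t) - bint u c - t *\<^sub>R u c) \<le> (1 / t) * (e / 2 * t)"
      using t by (intro mult_left_mono) auto
    then have "norm ((1 / t) *\<^sub>R (bint u (c + t) - bint u c - t *\<^sub>R u c)) \<le> e / 2"
      using t by simp
    then show ?thesis using t e by (simp add: dist_norm scaleR_right_diff_distrib)
  qed
  then show "\<forall>\<^sub>F t in at_right 0. dist ((1 / t) *\<^sub>R (bint u (c + t) - bint u c)) (u c) < e"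
    using d(1) unfolding eventually_at_right_field by (intro exI[of _ "d - c"]) auto
qed

text \<open>
  Bounded Borel functions with equal primitives on the unit interval agree there almost everywhere.
\<close>

lemma AE_eq_of_bint_eq:
  fixes u v :: "real \<Rightarrow> 'k::{real_normed_field, euclidean_space}"
  assumes u: "bounded_borel u C" and v: "bounded_borel v D"
    and eq: "\<And>x. x \<in> {0..1} \<Longrightarrow> bint u x = bint v x"
  shows "AE s in unit_leb. u s = v s"
proof -
  let ?d = "\<lambda>s. u s - v s"
  have [measurable]: "u \<in> borel_measurable borel" "v \<in> borel_measurable borel"
    using bounded_borelD(1)[OF u] bounded_borelD(1)[OF v] by auto
  have dm [measurable]: "?d \<in> borel_measurable unit_leb"
    by (rule measurable_restrict_space1[OF measurable_completion]) simp
  have bd: "norm (?d s) \<le> C + D" for s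
    by (rule order_trans[OF norm_triangle_ineq4 add_mono[OF bounded_borelD(2)[OF u] bounded_borelD(2)[OF v]]])
  have di: "integrable unit_leb ?d"
    by (rule unit_leb.integrable_const_bound[of _ "C + D", OF _ dm]) (simp add: bd)
  have prim: "(\<lambda>n::nat. LINT s|unit_leb. indicator {0..x} s *\<^sub>R ?d s) \<longlonglongrightarrow> 0" if x: "x \<in> {0..1}" for x
  proof -
    have "(LINT s|unit_leb. indicator {0..x} s *\<^sub>R ?d s) = bint ?d x"
      by (rule unit_leb_interval_integral[OF _ x]) measurable
    also have "\<dots> = bint u x - bint v x"
      unfolding bint_def using Bochner_Integration.integral_diff[OF bounded_borel_integrable[OF u, of 0 x] bounded_borel_integrable[OF v, of 0 x]]
      by (simp add: scaleR_right_diff_distrib)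
    finally show ?thesis using eq[OF x] by simp
  qed
  have nn: "0 \<le> C + D" using bounded_borelD(3)[OF u] bounded_borelD(3)[OF v] by simp
  have hi: "integrable unit_leb (\<lambda>s. cphase (?d s))"
  proof (rule unit_leb.integrable_const_bound[of _ 1])
    show "AE s in unit_leb. norm (cphase (?d s)) \<le> 1" by (simp add: norm_cphase_le)
  qed measurable
  have "(\<lambda>n::nat. LINT s|unit_leb. ?d s * cphase (?d s)) \<longlonglongrightarrow> 0"
  proof (rule bounded_tendsto_L1[where C = "C + D", OF dm _ nn _ hi])
    fix A assume "A \<in> sets unit_leb"
    then show "(\<lambda>n::nat. LINT s|unit_leb. indicator A s *\<^sub>R ?d s) \<longlonglongrightarrow> 0"
      by (intro bounded_tendsto_sets[where C = "C + D", OF dm _ nn prim]) (simp_all add: bd)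
  qed (simp add: bd)
  then have "(LINT s|unit_leb. (of_real (norm (?d s)) :: 'k)) = 0"
    by (simp add: cphase_mult LIMSEQ_const_iff)
  then have "of_real (LINT s|unit_leb. norm (?d s)) = (0 :: 'k)"
    by (simp only: integral_bounded_linear[OF bounded_linear_of_real integrable_norm[OF di]])
  then have "(LINT s|unit_leb. norm (?d s)) = 0" by simp
  then have "AE s in unit_leb. norm (?d s) = 0"
    by (subst (asm) integral_nonneg_eq_0_iff_AE[OF integrable_norm[OF di]]) simp_all
  then show ?thesis by eventually_elim simp
qed

lemma bint_continuous:
  assumes u: "bounded_borel u C"
  shows "continuous_on {0..} (bint u)"
proof (rule continuous_onI)
  fix x e :: real assume x: "x \<in> {0..}" and e: "0 < e"
  have "dist (bint u y) (bint u x) \<le> e" if "y \<in> {0..}" "dist y x < e / (C + 1)" for y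
  proof -
    have "norm (bint u y - bint u x) \<le> C * \<bar>y - x\<bar>" using that x by (intro bint_Lipschitz[OF u]) auto
    also have "\<dots> \<le> (C + 1) * (e / (C + 1))"
      using that bounded_borelD(3)[OF u] by (intro mult_mono) (auto simp: dist_real_def)
    finally show ?thesis using bounded_borelD(3)[OF u] by (simp add: dist_norm)
  qed
  moreover have "e / (C + 1) > 0" using e bounded_borelD(3)[OF u] by simp
  ultimately show "\<exists>d>0. \<forall>x'\<in>{0..}. dist x' x < d \<longrightarrow> dist (bint u x') (bint u x) \<le> e" by blast
qed

text \<open>The indefinite integral frozen outside \<open>[0, R]\<close>, which makes it bounded on the whole line.\<close>

lemma clamped_bint_bounded_borel:
  assumes u: "bounded_borel u C" and R: "0 \<le> R"
  shows "\<exists>D. bounded_borel (\<lambda>x. k + bint u (max 0 (min x R))) D"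
    and "continuous_on UNIV (\<lambda>x. k + bint u (max 0 (min x R)))"
proof -
  have "continuous_on UNIV (\<lambda>x. bint u (max 0 (min x R)))"
    by (rule continuous_on_compose2[OF bint_continuous[OF u]]) (auto intro!: continuous_intros)
  then show c: "continuous_on UNIV (\<lambda>x. k + bint u (max 0 (min x R)))" by (intro continuous_intros)
  have "norm (k + bint u (max 0 (min x R))) \<le> norm k + C * R" for x
  proof -
    have "norm (bint u (max 0 (min x R))) \<le> C * \<bar>max 0 (min x R)\<bar>"
      using bint_Lipschitz[OF u, of 0 "max 0 (min x R)"] by simp
    also have "\<dots> \<le> C * R" using bounded_borelD(3)[OF u] R by (intro mult_left_mono) auto
    finally show ?thesis by (rule order_trans[OF norm_triangle_ineq add_left_mono])
  qed
  then show "\<exists>D. bounded_borel (\<lambda>x. k + bint u (max 0 (min x R))) D"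
    unfolding bounded_borel_def using borel_measurable_continuous_onI[OF c] by blast
qed

section \<open>The weak derivative of an indefinite integral\<close>

lemma test_function_properties:
  assumes "test_function \<phi>"
  shows "(\<phi> has_real_derivative deriv \<phi> x) (at x)" "isCont (deriv \<phi>) x"
    "x \<le> 0 \<or> 1 \<le> x \<Longrightarrow> \<phi> x = 0"
proof -
  have d: "(deriv ^^ n) \<phi> field_differentiable at x" for n using assms by (simp add: test_function_def)
  show "(\<phi> has_real_derivative deriv \<phi> x) (at x)"
    using d[of 0] by (simp add: DERIV_deriv_iff_field_differentiable)
  show "isCont (deriv \<phi>) x"
    using d[of 1] by (simp add: field_differentiable_imp_continuous_at)
  assume x: "x \<le> 0 \<or> 1 \<le> x"
  show "\<phi> x = 0"
  proof (rule ccontr)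
    assume "\<phi> x \<noteq> 0"
    then have "x \<in> closure {x. \<phi> x \<noteq> 0}" by (intro subsetD[OF closure_subset]) simp
    moreover have "closure {x. \<phi> x \<noteq> 0} \<subseteq> {0<..<1}" using assms unfolding test_function_def by (rule conjunct2)
    ultimately have "x \<in> {0<..<1}" by (rule rev_subsetD)
    with x show False by auto
  qed
qed

lemma integral_deriv_test_function:
  assumes \<phi>: "test_function \<phi>" and y: "y \<le> 1"
  shows "(LINT s|lborel. indicator {y..1} s *\<^sub>R deriv \<phi> s) = - \<phi> y"
proof -
  have "(LINT s|lborel. deriv \<phi> s * indicator {y..1} s) = \<phi> 1 - \<phi> y"
    by (rule integral_FTC_Icc_real[OF y test_function_properties(1,2)[OF \<phi>]])
  then show ?thesis using test_function_properties(3)[OF \<phi>, of 1] by (simp add: mult.commute)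
qed

text \<open>
  Integration by parts for an indefinite integral, which need not be differentiable everywhere: exchange the
  order of integration over the triangle \<open>0 \<le> y \<le> s \<le> 1\<close>.
\<close>

lemma weak_derivative_of_bint:
  fixes h :: "real \<Rightarrow> 'b::{banach, second_countable_topology}"
  assumes h: "bounded_borel h C" and \<phi>: "test_function \<phi>"
  shows "(LINT s|lborel. indicator {0..1} s *\<^sub>R (deriv \<phi> s *\<^sub>R (L + bint h s)))
    = - (LINT s|lborel. indicator {0..1} s *\<^sub>R (\<phi> s *\<^sub>R h s))"
proof -
  note tf = test_function_properties[OF \<phi>]
  have cont': "continuous_on A (deriv \<phi>)" for A
    using tf(2) by (simp add: continuous_at_imp_continuous_on)
  have [measurable]: "deriv \<phi> \<in> borel_measurable lborel" "h \<in> borel_measurable lborel"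
    using borel_measurable_continuous_onI[OF cont'] bounded_borelD(1)[OF h] by auto
  obtain K where K: "\<And>s. s \<in> {0..1} \<Longrightarrow> norm (deriv \<phi> s) \<le> K" "0 \<le> K"
  proof -
    have "bounded (deriv \<phi> ` {0..1})" by (intro compact_imp_bounded compact_continuous_image cont' compact_Icc)
    then obtain K where "\<forall>s\<in>{0..1}. norm (deriv \<phi> s) \<le> K" unfolding bounded_iff by blast
    then show ?thesis by (intro that[of "max K 0"]) (auto simp: le_max_iff_disj)
  qed
  let ?f = "\<lambda>s y. (indicator {0..1} s * indicator {0..s} y * deriv \<phi> s) *\<^sub>R h y"
  have C: "0 \<le> C" "\<And>y. norm (h y) \<le> C" using bounded_borelD[OF h] by auto
  have int2: "integrable (lborel \<Otimes>\<^sub>M lborel) (\<lambda>(s, y). ?f s y)"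
  proof (rule Bochner_Integration.integrable_bound)
    have "emeasure (lborel \<Otimes>\<^sub>M lborel) ({0..1::real} \<times> {0..1::real}) = 1"
      by (subst lborel.emeasure_pair_measure_Times) simp_all
    then show "integrable (lborel \<Otimes>\<^sub>M lborel) (\<lambda>p. indicator ({0..1::real} \<times> {0..1::real}) p *\<^sub>R (K * C))"
      by (intro integrable_scaleR_left integrable_real_indicator) auto
    show "(\<lambda>(s, y). ?f s y) \<in> borel_measurable (lborel \<Otimes>\<^sub>M lborel)"
      unfolding indicator_def atLeastAtMost_iff case_prod_beta by measurable
    show "AE p in lborel \<Otimes>\<^sub>M lborel. norm (case p of (s, y) \<Rightarrow> ?f s y)
        \<le> norm (indicator ({0..1::real} \<times> {0..1::real}) p *\<^sub>R (K * C))"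
    proof (rule AE_I2, clarify)
      fix s y :: real
      show "norm (?f s y) \<le> norm (indicator ({0..1} \<times> {0..1}) (s, y) *\<^sub>R (K * C))"
      proof (cases "s \<in> {0..1} \<and> y \<in> {0..s}")
        case True
        have "norm (deriv \<phi> s) * norm (h y) \<le> K * C" using True K C by (intro mult_mono) auto
        then show ?thesis using True K(2) C(1) by (simp add: abs_mult)
      next
        case False
        then have n: "?f s y = 0" by (auto simp: indicator_def)
        show ?thesis unfolding n norm_zero by (rule norm_ge_zero)
      qed
    qed
  qed
  have fub: "(LINT s|lborel. LINT y|lborel. ?f s y) = (LINT y|lborel. LINT s|lborel. ?f s y)"
    by (rule lborel_pair.Fubini_integral[OF int2, symmetric])
  have in1: "(LINT y|lborel. ?f s y) = indicator {0..1} s *\<^sub>R (deriv \<phi> s *\<^sub>R bint h s)" for s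
  proof -
    have "(LINT y|lborel. ?f s y) = (LINT y|lborel. (indicator {0..1} s * deriv \<phi> s) *\<^sub>R (indicator {0..s} y *\<^sub>R h y))"
      by (simp add: ac_simps)
    also have "\<dots> = (indicator {0..1} s * deriv \<phi> s) *\<^sub>R bint h s"
      unfolding bint_def by (rule integral_scaleR_right)
    finally show ?thesis by simp
  qed
  have in2: "(LINT s|lborel. ?f s y) = - (indicator {0..1} y *\<^sub>R (\<phi> y *\<^sub>R h y))" for y
  proof (cases "y \<in> {0..1}")
    case True
    have i: "integrable lborel (\<lambda>s. indicator {y..1} s *\<^sub>R deriv \<phi> s)"
      using borel_integrable_compact[of "{y..1}" "deriv \<phi>"] cont' by (simp add: set_integrable_def)
    have "(LINT s|lborel. ?f s y) = (LINT s|lborel. (indicator {y..1} s *\<^sub>R deriv \<phi> s) *\<^sub>R h y)"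
      using True by (intro Bochner_Integration.integral_cong) (auto split: split_indicator)
    also have "\<dots> = (LINT s|lborel. indicator {y..1} s *\<^sub>R deriv \<phi> s) *\<^sub>R h y"
      by (rule integral_scaleR_left) (rule i)
    also have "\<dots> = - (\<phi> y *\<^sub>R h y)" using integral_deriv_test_function[OF \<phi>, of y] True by simp
    finally show ?thesis using True by simp
  next
    case False
    then have n: "?f s y = 0" for s by (auto split: split_indicator)
    show ?thesis unfolding n using False by simp
  qed
  have main: "(LINT s|lborel. indicator {0..1} s *\<^sub>R (deriv \<phi> s *\<^sub>R bint h s))
      = - (LINT s|lborel. indicator {0..1} s *\<^sub>R (\<phi> s *\<^sub>R h s))"
    using fub unfolding in1 in2 Bochner_Integration.integral_minus .
  have i1: "integrable lborel (\<lambda>s. indicator {0..1} s *\<^sub>R deriv \<phi> s)"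
    using borel_integrable_compact[of "{0..1}" "deriv \<phi>"] cont' by (simp add: set_integrable_def)
  have iL: "integrable lborel (\<lambda>s. (indicator {0..1} s *\<^sub>R deriv \<phi> s) *\<^sub>R L)"
    by (rule integrable_scaleR_left) (rule i1)
  have L0: "(LINT s|lborel. (indicator {0..1} s *\<^sub>R deriv \<phi> s) *\<^sub>R L) = 0"
    using integral_deriv_test_function[OF \<phi>, of 0] tf(3)[of 0] by (subst integral_scaleR_left[OF i1]) simp
  have "integrable lborel (\<lambda>s. indicator {0..1} s *\<^sub>R (deriv \<phi> s *\<^sub>R bint h s))"
  proof -
    have "continuous_on {0..1} (\<lambda>s. deriv \<phi> s *\<^sub>R bint h s)"
      by (intro continuous_intros cont' continuous_on_subset[OF bint_continuous[OF h]]) auto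
    from borel_integrable_compact[OF compact_Icc this] show ?thesis .
  qed
  from Bochner_Integration.integral_add[OF iL this]
  have "(LINT s|lborel. (indicator {0..1} s *\<^sub>R deriv \<phi> s) *\<^sub>R L + indicator {0..1} s *\<^sub>R (deriv \<phi> s *\<^sub>R bint h s))
      = - (LINT s|lborel. indicator {0..1} s *\<^sub>R (\<phi> s *\<^sub>R h s))"
    unfolding main L0 add_0 .
  moreover have "(indicator {0..1} s *\<^sub>R deriv \<phi> s) *\<^sub>R L + indicator {0..1} s *\<^sub>R (deriv \<phi> s *\<^sub>R bint h s)
      = indicator {0..1} s *\<^sub>R (deriv \<phi> s *\<^sub>R (L + bint h s))" for s :: real
    by (simp add: scaleR_right_distrib)
  ultimately show ?thesis by (simp only:)
qed

section \<open>Smooth approximations of intervals\<close>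

text \<open>
  The flat functions \<open>p(1/x) exp(-1/x)\<close>, extended by zero to the negative half-line,
  form a class that is closed under differentiation.
\<close>

definition flat :: "real poly \<Rightarrow> real \<Rightarrow> real" where
  "flat p x = (if 0 < x then poly p (1 / x) * exp (- (1 / x)) else 0)"

text \<open>
  The polynomial of the derivative: differentiating \<open>p(1/x) exp(-1/x)\<close> multiplies \<open>p(y) - p'(y)\<close> by $y^2$, where \<open>y = 1/x\<close>.
\<close>

definition flat_deriv :: "real poly \<Rightarrow> real poly" where
  "flat_deriv p = [:0, 0, 1:] * (p - pderiv p)"

lemma poly_exp_tendsto_0: "((\<lambda>x::real. poly p x * exp (- x)) \<longlongrightarrow> 0) at_top"
proof -
  have "((\<lambda>x::real. \<Sum>i\<le>degree p. coeff p i * (x ^ i / exp x)) \<longlongrightarrow> (\<Sum>i\<le>degree p. coeff p i * 0)) at_top"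
    by (intro tendsto_sum tendsto_mult tendsto_const tendsto_power_div_exp_0)
  then show ?thesis by (simp add: poly_altdef sum_distrib_right exp_minus divide_inverse mult.assoc)
qed

lemma flat_has_derivative: "(flat p has_real_derivative flat (flat_deriv p) x) (at x)"
proof -
  consider "x > 0" | "x < 0" | "x = 0" by linarith
  then show ?thesis
  proof cases
    case 1
    have "((\<lambda>x. poly p (1 / x) * exp (- (1 / x))) has_real_derivative flat (flat_deriv p) x) (at x)"
      using 1 by (auto intro!: derivative_eq_intros simp: flat_def flat_deriv_def field_simps power2_eq_square)
    then show ?thesis
      by (rule has_field_derivative_transform_within_open[of _ _ _ "{0<..}"]) (use 1 in \<open>auto simp: flat_def\<close>)
  next
    case 2
    have "((\<lambda>x. 0) has_real_derivative flat (flat_deriv p) x) (at x)"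
      using 2 by (simp add: flat_def)
    then show ?thesis
      by (rule has_field_derivative_transform_within_open[of _ _ _ "{..<0}"]) (use 2 in \<open>auto simp: flat_def\<close>)
  next
    case 3
    have "((\<lambda>y. poly ([:0, 1:] * p) (1 / y) * exp (- (1 / y))) \<longlongrightarrow> 0) (at_right 0)"
    proof -
      have "filterlim (\<lambda>y::real. 1 / y) at_top (at_right 0)"
        using filterlim_inverse_at_top_right by (simp add: inverse_eq_divide)
      from filterlim_compose[OF poly_exp_tendsto_0 this] show ?thesis .
    qed
    moreover have "\<forall>\<^sub>F y in at_right 0. poly ([:0, 1:] * p) (1 / y) * exp (- (1 / y)) = (flat p y - flat p 0) / (y - 0)"
      unfolding eventually_at_filter by (rule always_eventually) (auto simp: flat_def)
    ultimately have r: "((\<lambda>y. (flat p y - flat p 0) / (y - 0)) \<longlongrightarrow> 0) (at_right 0)"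
      by (rule Lim_transform_eventually)
    have "\<forall>\<^sub>F y in at_left 0. 0 = (flat p y - flat p 0) / (y - 0)"
      unfolding eventually_at_filter by (rule always_eventually) (auto simp: flat_def)
    then have l: "((\<lambda>y. (flat p y - flat p 0) / (y - 0)) \<longlongrightarrow> 0) (at_left 0)"
      by (rule Lim_transform_eventually[OF tendsto_const])
    have "flat (flat_deriv p) 0 = 0" by (simp add: flat_def)
    then show ?thesis
      using filterlim_split_at[OF l r] 3 unfolding has_field_derivative_iff by simp
  qed
qed

text \<open>
  Membership in a class of functions closed under differentiation yields smoothness.
\<close>

lemma higher_derivatives_of_closed_class:
  assumes S: "\<And>f. f \<in> S \<Longrightarrow> \<exists>f'\<in>S. \<forall>x::real. (f has_real_derivative f' x) (at x)"
    and f: "f \<in> S"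
  shows "(deriv ^^ n) f field_differentiable at x"
proof -
  have closed: "deriv f \<in> S" if fS: "f \<in> S" for f
  proof -
    obtain f' where f': "f' \<in> S" "\<And>x. (f has_real_derivative f' x) (at x)" using S[OF fS] by blast
    have "deriv f = f'" using DERIV_imp_deriv[OF f'(2)] by (rule ext)
    then show ?thesis using f'(1) by simp
  qed
  have "(deriv ^^ n) f \<in> S" by (induct n) (simp_all add: f closed)
  from S[OF this] show ?thesis unfolding field_differentiable_def by blast
qed

text \<open>
  The differences generated by products of two flat functions, a class of smooth functions vanishing off the unit interval.
\<close>

inductive_set bumps :: "(real \<Rightarrow> real) set" where
  base: "(\<lambda>x. flat p x * flat q (1 - x)) \<in> bumps"
| diff: "f \<in> bumps \<Longrightarrow> g \<in> bumps \<Longrightarrow> (\<lambda>x. f x - g x) \<in> bumps"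

lemma bumps_derivative:
  "f \<in> bumps \<Longrightarrow> \<exists>f'\<in>bumps. \<forall>x. (f has_real_derivative f' x) (at x)"
proof (induct rule: bumps.induct)
  case (base p q)
  have "((\<lambda>x. flat p x * flat q (1 - x)) has_real_derivative
      flat (flat_deriv p) x * flat q (1 - x) - flat p x * flat (flat_deriv q) (1 - x)) (at x)" for x
  proof -
    have "((\<lambda>x. flat q (1 - x)) has_real_derivative flat (flat_deriv q) (1 - x) * (- 1)) (at x)"
      by (rule DERIV_chain2[OF flat_has_derivative]) (auto intro!: derivative_eq_intros)
    from DERIV_mult[OF flat_has_derivative this] show ?thesis by (simp add: algebra_simps)
  qed
  then show ?case by (intro bexI[OF _ bumps.diff[OF bumps.base bumps.base]] allI)
next
  case (diff f g)
  then obtain f' g' where "f' \<in> bumps" "g' \<in> bumps" "\<And>x. (f has_real_derivative f' x) (at x)"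
    "\<And>x. (g has_real_derivative g' x) (at x)" by blast
  then show ?case by (intro bexI[OF _ bumps.diff[of f' g']] allI DERIV_diff)
qed

text \<open>A nonnegative smooth bump supported in the unit interval.\<close>

definition bump :: "real \<Rightarrow> real" where
  "bump x = flat 1 x * flat 1 (1 - x)"

lemma bump_in_bumps: "bump \<in> bumps"
  unfolding bump_def[abs_def] by (rule bumps.base)

lemma bump_props: "0 \<le> bump x" "x \<le> 0 \<or> 1 \<le> x \<Longrightarrow> bump x = 0" "0 < x \<Longrightarrow> x < 1 \<Longrightarrow> 0 < bump x"
  by (auto simp: bump_def flat_def)

lemma bump_continuous: "continuous_on A bump"
proof -
  obtain f' where "\<forall>x. (bump has_real_derivative f' x) (at x)"
    using bumps_derivative[OF bump_in_bumps] by blast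
  then show ?thesis by (intro continuous_at_imp_continuous_on ballI DERIV_isCont) blast
qed

text \<open>
  The normalised primitive of the bump: it is \<open>0\<close> left of \<open>0\<close> and \<open>1\<close> right of \<open>1\<close>. The lower limit
  \<open>-1\<close> leaves room for two-sided differentiation at \<open>0\<close>.
\<close>

definition step :: "real \<Rightarrow> real" where
  "step x = integral {-1..x} bump / integral {0..1} bump"

lemma bump_mass_pos: "0 < integral {0..1} bump"
proof -
  have "integral {0..1} bump \<noteq> 0"
  proof
    assume "integral {0..1} bump = 0"
    then have "bump (1/2) = 0"
      using integral_eq_0_iff[OF bump_continuous, of 0 1] bump_props(1) by simp
    then show False using bump_props(3)[of "1/2"] by simp
  qed
  moreover have "0 \<le> integral {0..1} bump"
    by (rule Henstock_Kurzweil_Integration.integral_nonneg)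
       (rule integrable_continuous_interval[OF bump_continuous], rule bump_props(1))
  ultimately show ?thesis by simp
qed

lemma step_values: "x \<le> 0 \<Longrightarrow> step x = 0" "1 \<le> x \<Longrightarrow> step x = 1"
proof -
  have zero: "integral {a..b} bump = 0" if "b \<le> 0 \<or> 1 \<le> a" for a b
  proof -
    have "integral {a..b} bump = integral {a..b} (\<lambda>_. 0)"
      using that bump_props(2) by (intro Henstock_Kurzweil_Integration.integral_cong) auto
    then show ?thesis by simp
  qed
  have int: "bump integrable_on {a..b}" for a b by (rule integrable_continuous_interval[OF bump_continuous])
  show "x \<le> 0 \<Longrightarrow> step x = 0" by (simp add: step_def zero)
  assume x: "1 \<le> x"
  have "integral {-1..0} bump + integral {0..x} bump = integral {-1..x} bump"
    using x by (intro Henstock_Kurzweil_Integration.integral_combine int) auto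
  moreover have "integral {0..1} bump + integral {1..x} bump = integral {0..x} bump"
    using x by (intro Henstock_Kurzweil_Integration.integral_combine int) auto
  ultimately have "integral {-1..x} bump = integral {0..1} bump"
    using zero[of 0 "-1"] zero[of x 1] by simp
  then show "step x = 1" using bump_mass_pos by (simp add: step_def)
qed

lemma step_derivative: "(step has_real_derivative bump x / integral {0..1} bump) (at x)"
proof (cases "-1 < x")
  case True
  have "((\<lambda>y. integral {-1..y} bump) has_real_derivative bump x) (at x within {-1..x + 1})"
    by (rule integral_has_real_derivative[OF bump_continuous]) (use True in simp)
  moreover have "at x within {-1..x + 1} = at x"
    by (rule at_within_interior) (use True in simp)
  ultimately have "((\<lambda>y. integral {-1..y} bump) has_real_derivative bump x) (at x)"
    by (simp only:)
  then show ?thesis unfolding step_def[abs_def] by (rule DERIV_cdivide)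
next
  case False
  have "((\<lambda>_. 0 :: real) has_real_derivative 0) (at x)" by (rule DERIV_const)
  then have "(step has_real_derivative 0) (at x)"
  proof (rule has_field_derivative_transform_within_open)
    show "open {..<0 :: real}" by simp
    show "x \<in> {..<0}" using False by simp
    show "0 = step y" if "y \<in> {..<0}" for y using that step_values(1)[of y] by simp
  qed
  moreover have "bump x = 0" using False by (intro bump_props(2)) simp
  ultimately show ?thesis by (simp only: div_0)
qed

lemma step_bounds: "0 \<le> step x" "step x \<le> 1"
proof -
  have mono: "step a \<le> step b" if "a \<le> b" for a b
  proof (rule DERIV_nonneg_imp_nondecreasing[OF that])
    fix x
    have "0 \<le> bump x / integral {0..1} bump" using bump_props(1) bump_mass_pos by simp
    with step_derivative[of x] show "\<exists>y. (step has_real_derivative y) (at x) \<and> 0 \<le> y" by blast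
  qed
  show "0 \<le> step x" using mono[of "min x 0" x] by (simp add: step_values)
  show "step x \<le> 1" using mono[of x "max x 1"] by (simp add: step_values)
qed

text \<open>
  A smooth version of the indicator function of \<open>(a, c]\<close>, whose transition zones have length \<open>1/k\<close>.
\<close>

definition plateau :: "real \<Rightarrow> real \<Rightarrow> real \<Rightarrow> real \<Rightarrow> real" where
  "plateau k a c x = step (k * (x - a)) - step (k * (x - c))"

lemma plateau_derivative:
  "(plateau k a c has_real_derivative
    k * bump (k * (x - a)) / integral {0..1} bump - k * bump (k * (x - c)) / integral {0..1} bump) (at x)"
proof -
  have "((\<lambda>x. step (k * (x - a))) has_real_derivative bump (k * (x - a)) / integral {0..1} bump * k) (at x)" for a
    by (rule DERIV_chain2[OF step_derivative]) (auto intro!: derivative_eq_intros)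
  from DERIV_diff[OF this[of a] this[of c]] show ?thesis
    unfolding plateau_def[abs_def] by (simp add: mult.commute)
qed

lemma plateau_test_function:
  assumes "0 < a" "a < c" "0 < k" "c + 1 / k < 1"
  shows "test_function (plateau k a c)"
  unfolding test_function_def
proof (intro conjI allI)
  \<comment> \<open>Rescaled and translated bumps, together with the function itself, are closed under differentiation.\<close>
  let ?S0 = "{\<lambda>x. A * f (k * (x - a)) - D * f (k * (x - c)) | A D f. f \<in> bumps}"
  let ?S = "insert (plateau k a c) ?S0"
  show "(deriv ^^ n) (plateau k a c) field_differentiable at x" for n x
  proof (rule higher_derivatives_of_closed_class[of ?S])
    fix f assume "f \<in> ?S"
    then consider "f = plateau k a c" | A D h where "f = (\<lambda>x. A * h (k * (x - a)) - D * h (k * (x - c)))" "h \<in> bumps"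
      by blast
    then show "\<exists>f'\<in>?S. \<forall>x. (f has_real_derivative f' x) (at x)"
    proof cases
      case 1
      let ?f' = "\<lambda>x. (k / integral {0..1} bump) * bump (k * (x - a)) - (k / integral {0..1} bump) * bump (k * (x - c))"
      have fm: "?f' \<in> ?S" using bump_in_bumps by blast
      have fd: "\<forall>x. (f has_real_derivative ?f' x) (at x)" using plateau_derivative[of k a c] 1 by simp
      show ?thesis by (rule bexI[where x = ?f', OF _ fm]) (rule fd)
    next
      case 2
      obtain h' where h': "h' \<in> bumps" "\<And>x. (h has_real_derivative h' x) (at x)"
        using bumps_derivative[OF 2(2)] by blast
      let ?f' = "\<lambda>x. (A * k) * h' (k * (x - a)) - (D * k) * h' (k * (x - c))"
      have fm: "?f' \<in> ?S" using h'(1) by blast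
      have fd: "\<forall>x. (f has_real_derivative ?f' x) (at x)"
      proof
        fix x
        have "((\<lambda>x. h (k * (x - b))) has_real_derivative h' (k * (x - b)) * k) (at x)" for b
          by (rule DERIV_chain2[OF h'(2)]) (auto intro!: derivative_eq_intros)
        from DERIV_diff[OF DERIV_cmult[OF this[of a], of A] DERIV_cmult[OF this[of c], of D]]
        show "(f has_real_derivative ?f' x) (at x)" unfolding 2(1) by (simp add: ac_simps)
      qed
      show ?thesis by (rule bexI[where x = ?f', OF _ fm]) (rule fd)
    qed
  qed simp
  have "plateau k a c x = 0" if "x < a \<or> c + 1 / k < x" for x
  proof (cases "x < a")
    case True
    then have "k * (x - a) \<le> 0" "k * (x - c) \<le> 0" using assms by (auto simp: mult_le_0_iff)
    then show ?thesis by (simp add: plateau_def step_values)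
  next
    case False
    then have "1 \<le> k * (x - c)" using that assms by (auto simp: field_simps)
    moreover have "k * (x - c) \<le> k * (x - a)" using assms by (intro mult_left_mono) auto
    ultimately show ?thesis by (simp add: plateau_def step_values)
  qed
  then have "{x. plateau k a c x \<noteq> 0} \<subseteq> {a..c + 1 / k}" by (auto simp: not_less[symmetric])
  then have "closure {x. plateau k a c x \<noteq> 0} \<subseteq> {a..c + 1 / k}" by (rule closure_minimal) simp
  then show "closure {x. plateau k a c x \<noteq> 0} \<subseteq> {0<..<1}" using assms by auto
qed

section \<open>Weak derivatives and continuous representatives\<close>

lemma has_weak_derivative_of_bint:
  fixes f g :: "'k::{real_normed_field, euclidean_space} linf"
  assumes h: "bounded_borel h C"
    and f: "AE s in unit_leb. rep_linf f s = L + bint h s"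
    and g: "AE s in unit_leb. rep_linf g s = h s"
  shows "has_weak_derivative f g"
  unfolding has_weak_derivative_def
proof (intro allI impI)
  fix \<phi> :: "real \<Rightarrow> real" assume \<phi>: "test_function \<phi>"
  obtain D where D: "bounded_borel (\<lambda>x. L + bint h (max 0 (min x 1))) D"
    using clamped_bint_bounded_borel(1)[OF h, of 1 L] by auto
  have cont: "continuous_on UNIV (deriv \<phi>)" "continuous_on UNIV \<phi>"
    using test_function_properties(2)[OF \<phi>] DERIV_isCont[OF test_function_properties(1)[OF \<phi>]]
    by (simp_all add: continuous_at_imp_continuous_on)
  have [measurable]: "\<phi> \<in> borel_measurable borel" "deriv \<phi> \<in> borel_measurable borel"
    using cont by (auto intro: borel_measurable_continuous_onI)
  have [measurable]: "h \<in> borel_measurable borel" "(\<lambda>x. L + bint h (max 0 (min x 1))) \<in> borel_measurable borel"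
    using bounded_borelD(1)[OF h] bounded_borelD(1)[OF D] by auto
  have unit: "(\<lambda>s. m s) \<in> borel_measurable unit_leb" if "m \<in> borel_measurable borel" for m :: "real \<Rightarrow> 'k ell1"
    by (rule measurable_restrict_space1[OF measurable_completion]) (use that in simp)
  have unit': "(\<lambda>s. m s) \<in> borel_measurable unit_leb" if "m \<in> borel_measurable borel" for m :: "real \<Rightarrow> real"
    by (rule measurable_restrict_space1[OF measurable_completion]) (use that in simp)
  have [measurable]: "\<phi> \<in> borel_measurable unit_leb" "deriv \<phi> \<in> borel_measurable unit_leb"
    by (rule unit', measurable)+
  have "(LINT s|unit_leb. deriv \<phi> s *\<^sub>R rep_linf f s)
      = (LINT s|unit_leb. deriv \<phi> s *\<^sub>R (L + bint h (max 0 (min s 1))))"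
  proof (rule integral_cong_AE)
    show "AE s in unit_leb. deriv \<phi> s *\<^sub>R rep_linf f s = deriv \<phi> s *\<^sub>R (L + bint h (max 0 (min s 1)))"
      using f AE_space by eventually_elim simp
    show "(\<lambda>s. deriv \<phi> s *\<^sub>R (L + bint h (max 0 (min s 1)))) \<in> borel_measurable unit_leb"
      by (rule unit) measurable
  qed measurable
  also have "\<dots> = (LINT s|lborel. indicator {0..1} s *\<^sub>R (deriv \<phi> s *\<^sub>R (L + bint h (max 0 (min s 1)))))"
    by (rule integral_unit_leb_eq) measurable
  also have "\<dots> = (LINT s|lborel. indicator {0..1} s *\<^sub>R (deriv \<phi> s *\<^sub>R (L + bint h s)))"
    by (rule Bochner_Integration.integral_cong) (auto split: split_indicator)
  also have "\<dots> = - (LINT s|lborel. indicator {0..1} s *\<^sub>R (\<phi> s *\<^sub>R h s))"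
    by (rule weak_derivative_of_bint[OF h \<phi>])
  also have "(LINT s|lborel. indicator {0..1} s *\<^sub>R (\<phi> s *\<^sub>R h s)) = (LINT s|unit_leb. \<phi> s *\<^sub>R h s)"
    by (rule integral_unit_leb_eq[symmetric]) measurable
  also have "\<dots> = (LINT s|unit_leb. \<phi> s *\<^sub>R rep_linf g s)"
  proof (rule integral_cong_AE)
    show "AE s in unit_leb. \<phi> s *\<^sub>R h s = \<phi> s *\<^sub>R rep_linf g s"
      using g by eventually_elim simp
    show "(\<lambda>s. \<phi> s *\<^sub>R h s) \<in> borel_measurable unit_leb" by (rule unit) measurable
  qed measurable
  finally show "(LINT s|unit_leb. deriv \<phi> s *\<^sub>R rep_linf f s) = - (LINT s|unit_leb. \<phi> s *\<^sub>R rep_linf g s)" .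
qed

lemma bump_mass_eq: "(LINT y|lborel. indicator {0..1} y *\<^sub>R bump y) = integral {0..1} bump"
proof -
  have "set_integrable lborel {0..1} bump"
    unfolding set_integrable_def by (rule borel_integrable_compact[OF compact_Icc bump_continuous])
  from set_borel_integral_eq_integral(2)[OF this] show ?thesis by (simp only: set_lebesgue_integral_def)
qed

text \<open>Rescaled bumps concentrate at a point.\<close>

lemma approximate_identity:
  fixes U :: "real \<Rightarrow> 'b::{banach, second_countable_topology}"
  assumes U: "continuous_on UNIV U" and bd: "\<And>x. norm (U x) \<le> K" and a: "0 < a" "a < 1"
  shows "(\<lambda>n. LINT s|lborel. indicator {0..1} s *\<^sub>R ((real n * bump (real n * (s - a)) / integral {0..1} bump) *\<^sub>R U s))
    \<longlonglongrightarrow> U a"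
proof -
  let ?m = "integral {0..1} bump"
  have [measurable]: "U \<in> borel_measurable borel" "bump \<in> borel_measurable borel"
    using borel_measurable_continuous_onI[OF U] borel_measurable_continuous_onI[OF bump_continuous] by auto
  have K: "0 \<le> K" using bd[of 0] norm_ge_zero order_trans by blast
  have wi: "integrable lborel (\<lambda>y. indicator {0..1} y *\<^sub>R bump y)"
    by (rule borel_integrable_compact[OF compact_Icc bump_continuous])
  have "(\<lambda>n. LINT y|lborel. (indicator {0..1} y *\<^sub>R bump y / ?m) *\<^sub>R U (a + y / real n)) \<longlonglongrightarrow>
      (LINT y|lborel. (indicator {0..1} y *\<^sub>R bump y / ?m) *\<^sub>R U a)"
  proof (rule integral_dominated_convergence[where w = "\<lambda>y. (indicator {0..1} y *\<^sub>R bump y) * (K / ?m)"])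
    show "integrable lborel (\<lambda>y. (indicator {0..1} y *\<^sub>R bump y) * (K / ?m))"
      by (rule integrable_mult_left) (rule wi)
    show "AE y in lborel. (\<lambda>n. (indicator {0..1} y *\<^sub>R bump y / ?m) *\<^sub>R U (a + y / real n)) \<longlonglongrightarrow>
        (indicator {0..1} y *\<^sub>R bump y / ?m) *\<^sub>R U a"
    proof (rule AE_I2)
      fix y :: real
      have "(\<lambda>n. a + y / real n) \<longlonglongrightarrow> a + 0" by (intro tendsto_add tendsto_const lim_const_over_n)
      then have "(\<lambda>n. a + y / real n) \<longlonglongrightarrow> a" by simp
      moreover have "isCont U a" using U by (simp add: continuous_on_eq_continuous_at)
      ultimately have "(\<lambda>n. U (a + y / real n)) \<longlonglongrightarrow> U a" by (rule isCont_tendsto_compose[rotated])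
      then show "(\<lambda>n. (indicator {0..1} y *\<^sub>R bump y / ?m) *\<^sub>R U (a + y / real n)) \<longlonglongrightarrow>
          (indicator {0..1} y *\<^sub>R bump y / ?m) *\<^sub>R U a" by (rule tendsto_scaleR[OF tendsto_const])
    qed
    show "AE y in lborel. norm ((indicator {0..1} y *\<^sub>R bump y / ?m) *\<^sub>R U (a + y / real n))
        \<le> (indicator {0..1} y *\<^sub>R bump y) * (K / ?m)" for n
    proof (rule AE_I2)
      fix y :: real
      have nn: "0 \<le> indicator {0..1} y *\<^sub>R bump y / ?m"
        using bump_props(1)[of y] bump_mass_pos by (simp add: less_imp_le)
      have "norm ((indicator {0..1} y *\<^sub>R bump y / ?m) *\<^sub>R U (a + y / real n)) \<le> (indicator {0..1} y *\<^sub>R bump y / ?m) * K"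
        unfolding norm_scaleR abs_of_nonneg[OF nn] by (rule mult_left_mono[OF bd nn])
      then show "norm ((indicator {0..1} y *\<^sub>R bump y / ?m) *\<^sub>R U (a + y / real n))
          \<le> (indicator {0..1} y *\<^sub>R bump y) * (K / ?m)" by (simp only: times_divide_eq_left times_divide_eq_right)
    qed
  qed measurable
  moreover have "(LINT y|lborel. (indicator {0..1} y *\<^sub>R bump y / ?m) *\<^sub>R U a) = U a"
  proof -
    have "(LINT y|lborel. (indicator {0..1} y *\<^sub>R bump y / ?m) *\<^sub>R U a)
        = (LINT y|lborel. indicator {0..1} y *\<^sub>R bump y / ?m) *\<^sub>R U a"
      by (rule integral_scaleR_left) (rule integrable_divide_zero, rule wi)
    also have "(LINT y|lborel. indicator {0..1} y *\<^sub>R bump y / ?m) = 1"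
      unfolding integral_divide_zero bump_mass_eq using bump_mass_pos by simp
    finally show ?thesis by simp
  qed
  moreover have "\<forall>\<^sub>F n in sequentially.
      (LINT y|lborel. (indicator {0..1} y *\<^sub>R bump y / ?m) *\<^sub>R U (a + y / real n))
      = (LINT s|lborel. indicator {0..1} s *\<^sub>R ((real n * bump (real n * (s - a)) / ?m) *\<^sub>R U s))"
  proof -
    \<comment> \<open>From this index on the rescaled bump is supported in the unit interval, and the substitution \<open>s = a + y/n\<close> applies.\<close>
    obtain N :: nat where N: "1 / (1 - a) < real N" using reals_Archimedean2 by blast
    have "(LINT y|lborel. (indicator {0..1} y *\<^sub>R bump y / ?m) *\<^sub>R U (a + y / real n))
        = (LINT s|lborel. indicator {0..1} s *\<^sub>R ((real n * bump (real n * (s - a)) / ?m) *\<^sub>R U s))" if n: "n \<ge> N" for n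
    proof -
      have "0 < 1 / (1 - a)" using a by simp
      then have n0: "0 < real n" using N n by linarith
      have "1 / (1 - a) \<le> real n" using N n by linarith
      then have n1: "1 / real n \<le> 1 - a" using a n0 by (simp add: field_simps)
      have "(LINT s|lborel. indicator {0..1} s *\<^sub>R ((real n * bump (real n * (s - a)) / ?m) *\<^sub>R U s))
          = \<bar>1 / real n\<bar> *\<^sub>R (LINT y|lborel. indicator {0..1} (a + 1 / real n * y) *\<^sub>R
              ((real n * bump (real n * (a + 1 / real n * y - a)) / ?m) *\<^sub>R U (a + 1 / real n * y)))"
        by (rule lborel_integral_real_affine) (use n0 in simp)
      also have "\<dots> = (LINT y|lborel. \<bar>1 / real n\<bar> *\<^sub>R (indicator {0..1} (a + 1 / real n * y) *\<^sub>R
              ((real n * bump (real n * (a + 1 / real n * y - a)) / ?m) *\<^sub>R U (a + 1 / real n * y))))"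
        by (rule integral_scaleR_right[symmetric])
      also have "\<dots> = (LINT y|lborel. (indicator {0..1} y *\<^sub>R bump y / ?m) *\<^sub>R U (a + y / real n))"
      proof (rule Bochner_Integration.integral_cong[OF refl])
        fix y :: real
        show "\<bar>1 / real n\<bar> *\<^sub>R (indicator {0..1} (a + 1 / real n * y) *\<^sub>R
              ((real n * bump (real n * (a + 1 / real n * y - a)) / ?m) *\<^sub>R U (a + 1 / real n * y)))
            = (indicator {0..1} y *\<^sub>R bump y / ?m) *\<^sub>R U (a + y / real n)"
        proof (cases "0 < y \<and> y < 1")
          case True
          have "y / real n \<le> 1 / real n" using True n0 by (intro divide_right_mono) auto
          moreover have "0 \<le> y / real n" using True n0 by simp
          ultimately have "a + y / real n \<in> {0..1}" using a n1 by auto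
          then show ?thesis using True n0 by simp
        next
          case False
          then have "bump y = 0" by (intro bump_props(2)) auto
          then show ?thesis using n0 by simp
        qed
      qed
      finally show ?thesis by simp
    qed
    then show ?thesis unfolding eventually_sequentially by blast
  qed
  ultimately show ?thesis by (simp add: Lim_transform_eventually)
qed

lemma plateau_tendsto: "(\<lambda>n. plateau (real n) a c s) \<longlonglongrightarrow> (if a < s then 1 else 0) - (if c < s then 1 else 0)"
proof -
  have "(\<lambda>n. step (real n * (s - b))) \<longlonglongrightarrow> (if b < s then 1 else 0)" for b
  proof (cases "b < s")
    case True
    obtain N :: nat where N: "1 / (s - b) < real N" using reals_Archimedean2 by blast
    have "step (real n * (s - b)) = 1" if "n \<ge> N" for n
    proof (rule step_values(2))
      have "1 / (s - b) \<le> real n" using N that by linarith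
      then show "1 \<le> real n * (s - b)" using True by (simp add: field_simps)
    qed
    then have "\<forall>\<^sub>F n in sequentially. step (real n * (s - b)) = 1" unfolding eventually_sequentially by blast
    then show ?thesis using True by (simp add: tendsto_eventually)
  next
    case False
    then have "step (real n * (s - b)) = 0" for n
      by (intro step_values(1) mult_nonneg_nonpos) auto
    then show ?thesis using False by simp
  qed
  then show ?thesis unfolding plateau_def by (intro tendsto_diff)
qed

text \<open>
  A continuous representative is recovered from its weak derivative by integration: testing
  against smooth approximations of the indicator function of \<open>(a, c]\<close> gives the increment from \<open>a\<close> to \<open>c\<close>.
\<close>

lemma continuous_representative_eq_bint:
  fixes v v' :: "'k::{real_normed_field, euclidean_space} linf"
  assumes wd: "has_weak_derivative v v'" and u: "continuous_representative v u"
    and h: "bounded_borel h C" and v': "AE s in unit_leb. rep_linf v' s = h s"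
    and x: "x \<in> {0..1}"
  shows "u x = u 0 + bint h x"
proof -
  have cu: "continuous_on {0..1} u" and ae: "AE s in unit_leb. u s = rep_linf v s"
    using u by (auto simp: continuous_representative_def)
  define U where "U x = u (max 0 (min x 1))" for x
  have Uu: "U x = u x" if "x \<in> {0..1}" for x using that by (simp add: U_def)
  have cU: "continuous_on UNIV U" unfolding U_def[abs_def]
    by (rule continuous_on_compose2[OF cu]) (auto intro!: continuous_intros)
  obtain K where K: "\<And>x. norm (U x) \<le> K"
  proof -
    have "bounded (u ` {0..1})" by (intro compact_imp_bounded compact_continuous_image cu compact_Icc)
    then obtain K where "\<forall>x\<in>{0..1}. norm (u x) \<le> K" unfolding bounded_iff by blast
    then show ?thesis by (intro that[of K]) (simp add: U_def)
  qed
  have K0: "0 \<le> K" using K[of 0] norm_ge_zero order_trans by blast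
  let ?m = "integral {0..1} bump"
  have [measurable]: "U \<in> borel_measurable borel" "bump \<in> borel_measurable borel" "h \<in> borel_measurable borel"
    "step \<in> borel_measurable borel"
    using borel_measurable_continuous_onI[OF cU] borel_measurable_continuous_onI[OF bump_continuous]
      bounded_borelD(1)[OF h]
    by (auto intro!: borel_measurable_continuous_onI continuous_at_imp_continuous_on DERIV_isCont[OF step_derivative])
  have unit: "(\<lambda>s. m s) \<in> borel_measurable unit_leb" if "m \<in> borel_measurable borel" for m :: "real \<Rightarrow> 'k ell1"
    by (rule measurable_restrict_space1[OF measurable_completion]) (use that in simp)
  have unit': "(\<lambda>s. m s) \<in> borel_measurable unit_leb" if "m \<in> borel_measurable borel" for m :: "real \<Rightarrow> real"
    by (rule measurable_restrict_space1[OF measurable_completion]) (use that in simp)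
  have increment: "U c - U a = bint h c - bint h a" if ac: "0 < a" "a < c" "c < 1" for a c
  proof -
    define A where "A b n = (LINT s|lborel. indicator {0..1} s *\<^sub>R ((real n * bump (real n * (s - b)) / ?m) *\<^sub>R U s))" for b and n :: nat
    define H where "H n = (LINT s|lborel. indicator {0..1} s *\<^sub>R (plateau (real n) a c s *\<^sub>R h s))" for n :: nat
    have lA: "(\<lambda>n. A a n - A c n) \<longlonglongrightarrow> U a - U c"
      unfolding A_def using ac by (intro tendsto_diff approximate_identity[OF cU K]) auto
    have hi: "integrable lborel (\<lambda>s. indicator {0..1} s *\<^sub>R h s)" by (rule bounded_borel_integrable[OF h])
    have pm [measurable]: "plateau k a c \<in> borel_measurable borel" for k
      unfolding plateau_def[abs_def] by measurable
    have "H \<longlonglongrightarrow> (LINT s|lborel. indicator {0..1} s *\<^sub>R (((if a < s then 1 else 0) - (if c < s then 1 else 0)) *\<^sub>R h s))"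
      unfolding H_def
    proof (rule integral_dominated_convergence[where w = "\<lambda>s. norm (indicator {0..1} s *\<^sub>R h s)"])
      show "integrable lborel (\<lambda>s. norm (indicator {0..1} s *\<^sub>R h s))" by (rule integrable_norm[OF hi])
      show "AE s in lborel. (\<lambda>n. indicator {0..1} s *\<^sub>R (plateau (real n) a c s *\<^sub>R h s)) \<longlonglongrightarrow>
          indicator {0..1} s *\<^sub>R (((if a < s then 1 else 0) - (if c < s then 1 else 0)) *\<^sub>R h s)"
        by (rule AE_I2) (intro tendsto_scaleR tendsto_const plateau_tendsto)
      show "AE s in lborel. norm (indicator {0..1} s *\<^sub>R (plateau (real n) a c s *\<^sub>R h s)) \<le> norm (indicator {0..1} s *\<^sub>R h s)" for n
      proof (rule AE_I2)
        fix s :: real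
        have "\<bar>plateau (real n) a c s\<bar> \<le> 1"
          using step_bounds[of "real n * (s - a)"] step_bounds[of "real n * (s - c)"]
          unfolding plateau_def by linarith
        then show "norm (indicator {0..1} s *\<^sub>R (plateau (real n) a c s *\<^sub>R h s)) \<le> norm (indicator {0..1} s *\<^sub>R h s)"
          by (auto simp: mult_left_le_one_le split: split_indicator)
      qed
    qed measurable
    moreover have "(LINT s|lborel. indicator {0..1} s *\<^sub>R (((if a < s then 1 else 0) - (if c < s then 1 else 0)) *\<^sub>R h s))
        = bint h c - bint h a"
      unfolding bint_diff[OF h less_imp_le[OF ac(1)] less_imp_le[OF ac(2)]]
    proof (rule integral_cong_AE)
      show "AE s in lborel. indicator {0..1} s *\<^sub>R (((if a < s then 1 else 0) - (if c < s then 1 else 0)) *\<^sub>R h s)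
          = indicator {a..c} s *\<^sub>R h s"
        using AE_lborel_singleton[of a] by eventually_elim (use ac in \<open>auto split: split_indicator\<close>)
    qed measurable
    ultimately have lH: "H \<longlonglongrightarrow> bint h c - bint h a" by simp
    \<comment> \<open>For such \<open>n\<close> the support, which ends at \<open>c + 1/n\<close>, stays inside the open unit interval.\<close>
    obtain N :: nat where N: "1 / (1 - c) < real N" using reals_Archimedean2 by blast
    have eq: "A a n - A c n = - H n" if n: "n \<ge> N" for n
    proof -
      have "0 < 1 / (1 - c)" using ac by simp
      then have n0: "0 < real n" using N n by linarith
      have "1 / (1 - c) < real n" using N n by linarith
      then have "1 / real n < 1 - c" using ac n0 by (simp add: field_simps)
      then have test: "test_function (plateau (real n) a c)" using ac n0 by (intro plateau_test_function) auto
      let ?d = "\<lambda>s. real n * bump (real n * (s - a)) / ?m - real n * bump (real n * (s - c)) / ?m"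
      have der: "deriv (plateau (real n) a c) = ?d"
        by (rule HOL.ext) (rule DERIV_imp_deriv[OF plateau_derivative])
      have Ai: "integrable lborel (\<lambda>s. indicator {0..1} s *\<^sub>R ((real n * bump (real n * (s - b)) / ?m) *\<^sub>R U s))" for b
      proof (rule borel_integrable_compact[OF compact_Icc])
        have "continuous_on {0..1} (\<lambda>s. bump (real n * (s - b)))"
          by (rule continuous_on_compose2[OF bump_continuous[of UNIV]]) (auto intro!: continuous_intros)
        moreover have "continuous_on {0..1} U" by (rule continuous_on_subset[OF cU]) simp
        ultimately show "continuous_on {0..1} (\<lambda>s. (real n * bump (real n * (s - b)) / ?m) *\<^sub>R U s)"
          by (intro continuous_on_scaleR continuous_on_divide continuous_on_mult continuous_on_const)
             (use bump_mass_pos in auto)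
      qed
      have "(LINT s|unit_leb. ?d s *\<^sub>R rep_linf v s) = (LINT s|unit_leb. ?d s *\<^sub>R U s)"
      proof (rule integral_cong_AE)
        show "AE s in unit_leb. ?d s *\<^sub>R rep_linf v s = ?d s *\<^sub>R U s"
          using ae AE_space by eventually_elim (simp add: Uu)
        have "?d \<in> borel_measurable unit_leb" by (rule unit') measurable
        then show "(\<lambda>s. ?d s *\<^sub>R rep_linf v s) \<in> borel_measurable unit_leb"
          by (intro borel_measurable_scaleR rep_linf_measurable)
        show "(\<lambda>s. ?d s *\<^sub>R U s) \<in> borel_measurable unit_leb" by (rule unit) measurable
      qed
      also have "\<dots> = (LINT s|lborel. indicator {0..1} s *\<^sub>R (?d s *\<^sub>R U s))"
        by (rule integral_unit_leb_eq) measurable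
      also have "\<dots> = A a n - A c n"
        unfolding A_def Bochner_Integration.integral_diff[OF Ai Ai, symmetric]
        by (simp only: scaleR_left_diff_distrib scaleR_right_diff_distrib)
      finally have 1: "(LINT s|unit_leb. ?d s *\<^sub>R rep_linf v s) = A a n - A c n" .
      have "(LINT s|unit_leb. plateau (real n) a c s *\<^sub>R rep_linf v' s) = (LINT s|unit_leb. plateau (real n) a c s *\<^sub>R h s)"
      proof (rule integral_cong_AE)
        show "AE s in unit_leb. plateau (real n) a c s *\<^sub>R rep_linf v' s = plateau (real n) a c s *\<^sub>R h s"
          using v' by eventually_elim simp
        show "(\<lambda>s. plateau (real n) a c s *\<^sub>R rep_linf v' s) \<in> borel_measurable unit_leb"
          by (intro borel_measurable_scaleR rep_linf_measurable unit' pm)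
        show "(\<lambda>s. plateau (real n) a c s *\<^sub>R h s) \<in> borel_measurable unit_leb" by (rule unit) measurable
      qed
      also have "\<dots> = H n" unfolding H_def by (rule integral_unit_leb_eq) measurable
      finally have 2: "(LINT s|unit_leb. plateau (real n) a c s *\<^sub>R rep_linf v' s) = H n" .
      have "(LINT s|unit_leb. deriv (plateau (real n) a c) s *\<^sub>R rep_linf v s)
          = - (LINT s|unit_leb. plateau (real n) a c s *\<^sub>R rep_linf v' s)"
        using wd test unfolding has_weak_derivative_def by blast
      then show ?thesis unfolding der 1 2 .
    qed
    have "(\<lambda>n. - H n) \<longlonglongrightarrow> - (bint h c - bint h a)" by (rule tendsto_minus[OF lH])
    moreover have "\<forall>\<^sub>F n in sequentially. - H n = A a n - A c n"
      unfolding eventually_sequentially by (intro exI[of _ N] allI impI eq[symmetric])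
    ultimately have "(\<lambda>n. A a n - A c n) \<longlonglongrightarrow> - (bint h c - bint h a)" by (rule Lim_transform_eventually)
    from LIMSEQ_unique[OF lA this] have "- (U a - U c) = - (- (bint h c - bint h a))" by (rule arg_cong)
    then show ?thesis by simp
  qed
  let ?w = "\<lambda>x. u x - bint h x"
  have const: "?w x = ?w (1/2)" if "x \<in> {0<..<1}" for x
  proof -
    consider "x < 1/2" | "x = 1/2" | "1/2 < x" by linarith
    then show ?thesis
    proof cases
      case 1
      then show ?thesis using increment[of x "1/2"] that by (simp add: Uu algebra_simps)
    next
      case 3
      then show ?thesis using increment[of "1/2" x] that by (simp add: Uu algebra_simps)
    next
      case 2
      show ?thesis unfolding 2 ..
    qed
  qed
  have cl: "closure {0<..<1::real} = {0..1}" by simp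
  have cw: "continuous_on (closure {0<..<1}) ?w" unfolding cl
    by (intro continuous_on_diff cu continuous_on_subset[OF bint_continuous[OF h]]) auto
  have "?w y = ?w (1/2)" if "y \<in> {0..1}" for y
    by (rule continuous_constant_on_closure[OF cw const]) (use that cl in auto)
  from this[OF x] this[of 0] have "?w x = u 0" by simp
  then show ?thesis by (simp only: diff_eq_eq)
qed

section \<open>The generator\<close>

lemma coord_integral_scaleR:
  assumes "A \<in> sets unit_leb"
  shows "coord_integral (r *\<^sub>R f) i A = r *\<^sub>R coord_integral f i A"
proof -
  have "coord_integral (r *\<^sub>R f) i A = (LINT s|unit_leb. r *\<^sub>R (indicator A s *\<^sub>R ell1_nth (rep_linf f s) i))"
    unfolding coord_integral_def
  proof (rule integral_cong_AE)
    show "AE s in unit_leb. indicator A s *\<^sub>R ell1_nth (rep_linf (r *\<^sub>R f) s) i =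
        r *\<^sub>R (indicator A s *\<^sub>R ell1_nth (rep_linf f s) i)"
      using rep_linf_scaleR[of r f] by eventually_elim simp
    show "(\<lambda>s. r *\<^sub>R (indicator A s *\<^sub>R ell1_nth (rep_linf f s) i)) \<in> borel_measurable unit_leb"
      by (rule borel_measurable_scaleR[OF borel_measurable_const coord_measurable[OF assms]])
  qed (rule coord_measurable[OF assms])
  also have "\<dots> = r *\<^sub>R coord_integral f i A"
    unfolding coord_integral_def by (rule integral_scaleR_right)
  finally show ?thesis .
qed

lemma norm_coord_integral_le:
  assumes "x \<in> {0..1}"
  shows "norm (coord_integral f i {0..x}) \<le> norm f"
proof -
  have "norm (coord_integral f i {0..x}) \<le> norm f * measure unit_leb {0..x}"
    unfolding coord_integral_def
    by (rule norm_set_integral_le[OF _ interval_in_unit_leb[OF assms] rep_linf_coord_bound]) measurable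
  also have "\<dots> \<le> norm f * measure unit_leb {0..1}"
    by (intro mult_left_mono unit_leb.finite_measure_mono) (use assms sets.top[of unit_leb] in auto)
  finally show ?thesis by simp
qed

lemma bint_const_plus:
  assumes u: "bounded_borel u C" and x: "0 \<le> x"
  shows "bint (\<lambda>y. k + u y) x = x *\<^sub>R k + bint u x"
proof -
  have const: "bounded_borel (\<lambda>_. k) (norm k)" by (simp add: bounded_borel_def)
  have "bint (\<lambda>y. k + u y) x = (LINT y|lborel. indicator {0..x} y *\<^sub>R k + indicator {0..x} y *\<^sub>R u y)"
    unfolding bint_def by (simp add: scaleR_right_distrib)
  also have "\<dots> = (LINT y|lborel. indicator {0..x} y *\<^sub>R k) + bint u x"
    unfolding bint_def by (rule Bochner_Integration.integral_add; rule bounded_borel_integrable, rule const u)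
  finally show ?thesis using x by simp
qed

context weighted_network
begin

lemma coord_integral_quotient:
  assumes f: "f \<in> Linf (arcs G)" and t: "0 \<le> t" and x: "x \<in> {0..1}"
  shows "coord_integral ((1 / t) *\<^sub>R (T t f - f)) i {0..x}
    = (1 / t) *\<^sub>R (prim f i (t + x) - prim f i t - prim f i x)"
  by (simp add: coord_integral_scaleR[OF interval_in_unit_leb[OF x]] coord_integral_diff[OF interval_in_unit_leb[OF x]]
      coord_integral_T[OF f t x] coord_integral_prim[OF f x])

text \<open>
  Integrating the convergence of the difference quotients once more over \<open>[0, c]\<close> isolates the
  limit of \<open>prim f i t / t\<close>, which is the boundary value at zero, and exhibits \<open>f\<close> as an
  indefinite integral of \<open>g\<close>.
\<close>

lemma difference_quotient_limits:
  fixes f g :: "'k::{real_normed_field, euclidean_space} linf"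
  assumes f: "f \<in> Linf (arcs G)" and g: "g \<in> Linf (arcs G)"
    and lim: "\<And>x. x \<in> {0..1} \<Longrightarrow>
      (\<lambda>n. (1 / t n) *\<^sub>R (prim f i (t n + x) - prim f i (t n) - prim f i x)) \<longlonglongrightarrow> prim g i x"
    and bd: "\<And>n x. x \<in> {0..1} \<Longrightarrow> norm ((1 / t n) *\<^sub>R (prim f i (t n + x) - prim f i (t n) - prim f i x)) \<le> K"
    and t: "\<And>n. 0 < t n" "\<And>n. t n \<le> 1" "t \<longlonglongrightarrow> 0" and c: "c \<in> {0..1}"
  shows "(\<lambda>n. c *\<^sub>R ((1 / t n) *\<^sub>R prim f i (t n))) \<longlonglongrightarrow> prim f i c - bint (\<lambda>x. prim g i (max 0 (min x 1))) c"
proof -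
  \<comment> \<open>The primitive is only needed on \<open>[0, 2]\<close>; clamping its argument makes it bounded on the line.\<close>
  define p where "p x = prim f i (max 0 (min x 3))" for x
  have e: "bounded_borel (\<lambda>x. ell1_nth (ext f x) i) (norm f)" by (rule ext_coord_bounded_borel[OF f])
  obtain D where p: "bounded_borel p D" and cp: "continuous_on UNIV p"
    using clamped_bint_bounded_borel[OF e, of 3 0] by (auto simp: p_def[abs_def] prim_def)
  have p_eq: "p x = prim f i x" if "0 \<le> x" "x \<le> 3" for x using that by (simp add: p_def)
  have pc: "(p \<longlongrightarrow> p x) (at_right x)" for x
    using cp by (simp add: continuous_on_eq_continuous_at continuous_at_imp_continuous_at_within flip: continuous_within)
  have tr: "filterlim t (at_right 0) sequentially"
    by (rule tendsto_imp_filterlim_at_right[OF t(3)]) (simp add: t(1))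
  have quot: "(\<lambda>n. (1 / t n) *\<^sub>R (bint p (x + t n) - bint p x)) \<longlonglongrightarrow> p x" if "0 \<le> x" for x
    by (rule filterlim_compose[OF bint_right_derivative[OF p that pc] tr])
  have "(\<lambda>n. (1 / t n) *\<^sub>R (bint p (c + t n) - bint p c) - (1 / t n) *\<^sub>R (bint p (0 + t n) - bint p 0)) \<longlonglongrightarrow> p c - p 0"
    using c by (intro tendsto_diff quot) auto
  moreover have "p c - p 0 = prim f i c" using c by (simp add: p_def prim_def)
  ultimately have 1: "(\<lambda>n. (1 / t n) *\<^sub>R (bint p (c + t n) - bint p c) - (1 / t n) *\<^sub>R (bint p (0 + t n) - bint p 0)) \<longlonglongrightarrow> prim f i c"
    by simp
  define d where "d n x = (1 / t n) *\<^sub>R (p (t n + x) - prim f i (t n) - p x)" for n x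
  have pm: "p \<in> borel_measurable borel" by (rule bounded_borelD(1)[OF p])
  have 2: "(\<lambda>n. LINT x|lborel. indicator {0..c} x *\<^sub>R d n x) \<longlonglongrightarrow> (LINT x|lborel. indicator {0..c} x *\<^sub>R prim g i (max 0 (min x 1)))"
  proof (rule integral_dominated_convergence[where w = "\<lambda>x. indicator {0..c} x *\<^sub>R K"])
    show "integrable lborel (\<lambda>x. indicator {0..c} x *\<^sub>R K)" by (rule integrable_lborel_interval)
    have dp: "d n x = (1 / t n) *\<^sub>R (prim f i (t n + x) - prim f i (t n) - prim f i x)" if "x \<in> {0..1}" for n x
      using that t(1)[of n] t(2)[of n] by (simp add: d_def p_eq)
    show "AE x in lborel. (\<lambda>n. indicator {0..c} x *\<^sub>R d n x) \<longlonglongrightarrow> indicator {0..c} x *\<^sub>R prim g i (max 0 (min x 1))"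
    proof (rule AE_I2)
      fix x
      show "(\<lambda>n. indicator {0..c} x *\<^sub>R d n x) \<longlonglongrightarrow> indicator {0..c} x *\<^sub>R prim g i (max 0 (min x 1))"
      proof (cases "x \<in> {0..c}")
        case True
        then have x: "x \<in> {0..1}" using c by auto
        then show ?thesis using lim[OF x] True by (simp add: dp[OF x])
      qed simp
    qed
    show "AE x in lborel. norm (indicator {0..c} x *\<^sub>R d n x) \<le> indicator {0..c} x *\<^sub>R K" for n
    proof (rule AE_I2)
      fix x
      show "norm (indicator {0..c} x *\<^sub>R d n x) \<le> indicator {0..c} x *\<^sub>R K"
      proof (cases "x \<in> {0..c}")
        case True
        then have x: "x \<in> {0..1}" using c by auto
        have "norm (d n x) \<le> K" unfolding dp[OF x] by (rule bd[OF x])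
        with True show ?thesis by simp
      qed simp
    qed
    show "(\<lambda>x. indicator {0..c} x *\<^sub>R d n x) \<in> borel_measurable lborel" for n
      unfolding d_def using pm by measurable
    have "continuous_on UNIV (\<lambda>x. prim g i (max 0 (min x 1)))"
      using clamped_bint_bounded_borel(2)[OF ext_coord_bounded_borel[OF g, of i], of 1 0] by (simp add: prim_def)
    from borel_measurable_continuous_onI[OF this]
    show "(\<lambda>x. indicator {0..c} x *\<^sub>R prim g i (max 0 (min x 1))) \<in> borel_measurable lborel"
      by measurable
  qed
  have "(LINT x|lborel. indicator {0..c} x *\<^sub>R d n x)
      = (1 / t n) *\<^sub>R (bint p (c + t n) - bint p c) - (1 / t n) *\<^sub>R (bint p (0 + t n) - bint p 0)
        - c *\<^sub>R ((1 / t n) *\<^sub>R prim f i (t n))" for n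
  proof -
    have ps: "bounded_borel (\<lambda>x. p (t n + x)) D"
      unfolding bounded_borel_def
    proof
      show "(\<lambda>x. p (t n + x)) \<in> borel_measurable borel" using pm by measurable
    qed (simp add: bounded_borelD(2)[OF p])
    have const: "bounded_borel (\<lambda>_. prim f i (t n)) (norm (prim f i (t n)))" by (simp add: bounded_borel_def)
    note i = bounded_borel_integrable[OF ps, of 0 c] bounded_borel_integrable[OF const, of 0 c] bounded_borel_integrable[OF p, of 0 c]
    have "(LINT x|lborel. indicator {0..c} x *\<^sub>R d n x)
        = (LINT x|lborel. (1 / t n) *\<^sub>R (indicator {0..c} x *\<^sub>R p (t n + x) - indicator {0..c} x *\<^sub>R prim f i (t n) - indicator {0..c} x *\<^sub>R p x))"
      unfolding d_def by (intro Bochner_Integration.integral_cong refl) (auto split: split_indicator)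
    also have "\<dots> = (1 / t n) *\<^sub>R ((LINT x|lborel. indicator {0..c} x *\<^sub>R p (t n + x))
        - (LINT x|lborel. indicator {0..c} x *\<^sub>R prim f i (t n)) - (LINT x|lborel. indicator {0..c} x *\<^sub>R p x))"
      unfolding integral_scaleR_right
        Bochner_Integration.integral_diff[OF Bochner_Integration.integrable_diff[OF i(1,2)] i(3)]
        Bochner_Integration.integral_diff[OF i(1,2)] ..
    also have "(LINT x|lborel. indicator {0..c} x *\<^sub>R p (t n + x)) = bint p (t n + c) - bint p (t n)"
      using t(1)[of n] c by (intro bint_shift[OF p]) auto
    also have "(LINT x|lborel. indicator {0..c} x *\<^sub>R prim f i (t n)) = c *\<^sub>R prim f i (t n)"
      using c by simp
    also have "(LINT x|lborel. indicator {0..c} x *\<^sub>R p x) = bint p c" by (simp add: bint_def)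
    finally have *: "(LINT x|lborel. indicator {0..c} x *\<^sub>R d n x)
        = (1 / t n) *\<^sub>R (bint p (t n + c) - bint p (t n) - c *\<^sub>R prim f i (t n) - bint p c)" .
    have alg: "r *\<^sub>R (a1 - a2 - c *\<^sub>R a3 - a4) = r *\<^sub>R (a1 - a4) - r *\<^sub>R (a2 - 0) - c *\<^sub>R (r *\<^sub>R a3)" for r and a1 a2 a3 a4 :: 'k
      by (simp add: algebra_simps)
    show ?thesis unfolding * alg by (simp only: add.commute[of c] add_0 bint_0)
  qed
  then have 3: "c *\<^sub>R ((1 / t n) *\<^sub>R prim f i (t n))
      = ((1 / t n) *\<^sub>R (bint p (c + t n) - bint p c) - (1 / t n) *\<^sub>R (bint p (0 + t n) - bint p 0))
        - (LINT x|lborel. indicator {0..c} x *\<^sub>R d n x)" for n by simp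
  show ?thesis unfolding 3 using tendsto_diff[OF 1 2] unfolding bint_def .
qed

text \<open>
  The limits \<open>L i\<close> of the preceding lemma are the boundary values at zero. The endpoint \<open>x = 1\<close>
  of the difference quotients, read through the recursion for primitives, yields the boundary condition.
\<close>

lemma generator_subset:
  "bicontinuous_generator (Linf (arcs G)) (weak_star (arcs G)) T
    \<subseteq> (flow_operator G w :: ('k::{real_normed_field, euclidean_space} linf \<times> 'k linf) set)"
proof clarify
  fix f g :: "'k linf"
  assume "(f, g) \<in> bicontinuous_generator (Linf (arcs G)) (weak_star (arcs G)) T"
  then have f: "f \<in> Linf (arcs G)"
    and lim: "limitin (weak_star (arcs G)) (\<lambda>t. (1 / t) *\<^sub>R (T t f - f)) g (at_right 0)"
    and bdd: "bdd_above ((\<lambda>t. norm (T t f - f) / t) ` {0<..1})"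
    by (auto simp: bicontinuous_generator_def)
  have g: "g \<in> Linf (arcs G)" using lim by (simp add: limitin_weak_star)
  obtain K where "\<forall>t\<in>{0<..1}. norm (T t f - f) / t \<le> K"
    using bdd by (auto simp: bdd_above_def)
  then have K: "norm (T t f - f) / t \<le> K" if "0 < t" "t \<le> 1" for t using that by simp
  define t where "t n = inverse (real (Suc n))" for n
  have t: "0 < t n" "t n \<le> 1" for n by (auto simp: t_def inverse_le_1_iff)
  have t0: "t \<longlonglongrightarrow> 0" unfolding t_def by (rule LIMSEQ_inverse_real_of_nat)
  have tr: "filterlim t (at_right 0) sequentially"
    by (rule tendsto_imp_filterlim_at_right[OF t0]) (simp add: t(1))
  have Q: "(\<lambda>n. (1 / t n) *\<^sub>R (prim f i (t n + x) - prim f i (t n) - prim f i x)) \<longlonglongrightarrow> prim g i x"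
    if x: "x \<in> {0..1}" for i x
  proof -
    have "(\<lambda>n. coord_integral ((1 / t n) *\<^sub>R (T (t n) f - f)) i {0..x}) \<longlonglongrightarrow> coord_integral g i {0..x}"
      by (rule filterlim_compose[OF limitin_weak_star_coord[OF lim interval_in_unit_leb[OF x]] tr])
    then show ?thesis by (simp only: coord_integral_quotient[OF f less_imp_le[OF t(1)] x] coord_integral_prim[OF g x])
  qed
  have Qb: "norm ((1 / t n) *\<^sub>R (prim f i (t n + x) - prim f i (t n) - prim f i x)) \<le> K" if x: "x \<in> {0..1}" for n i x
  proof -
    have "norm ((1 / t n) *\<^sub>R (prim f i (t n + x) - prim f i (t n) - prim f i x)) \<le> norm ((1 / t n) *\<^sub>R (T (t n) f - f))"
      unfolding coord_integral_quotient[OF f less_imp_le[OF t(1)] x, symmetric] by (rule norm_coord_integral_le[OF x])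
    also have "\<dots> = norm (T (t n) f - f) / t n" using t(1)[of n] by simp
    also have "\<dots> \<le> K" by (rule K[OF t])
    finally show ?thesis .
  qed
  let ?h = "ext g"
  have h: "bounded_borel ?h (norm g)" by (rule ext_bounded_borel[OF g])
  define W where "W i x = prim g i (max 0 (min x 1))" for i x
  define L where "L i = prim f i 1 - bint (W i) 1" for i
  have DQ: "(\<lambda>n. c *\<^sub>R ((1 / t n) *\<^sub>R prim f i (t n))) \<longlonglongrightarrow> prim f i c - bint (W i) c" if c: "c \<in> {0..1}" for i c
    unfolding W_def[abs_def] by (rule difference_quotient_limits[OF f g Q Qb t t0 c])
  have L: "(\<lambda>n. (1 / t n) *\<^sub>R prim f i (t n)) \<longlonglongrightarrow> L i" for i
    using DQ[of 1 i] by (simp add: L_def)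
  have prim_f: "prim f i c = c *\<^sub>R L i + bint (W i) c" if c: "c \<in> {0..1}" for i c
    using LIMSEQ_unique[OF DQ[OF c] tendsto_scaleR[OF tendsto_const L]] by (simp add: algebra_simps)
  have coord: "AE s in unit_leb. ell1_nth (ext f s) i = L i + W i s" for i
  proof -
    obtain D where D: "bounded_borel (\<lambda>x. L i + W i x) D"
      using clamped_bint_bounded_borel(1)[OF ext_coord_bounded_borel[OF g, of i], of 1 "L i"]
      by (auto simp: W_def prim_def)
    obtain D' where D': "bounded_borel (W i) D'"
      using clamped_bint_bounded_borel(1)[OF ext_coord_bounded_borel[OF g, of i], of 1 0]
      by (auto simp: W_def[abs_def] prim_def)
    show ?thesis
    proof (rule AE_eq_of_bint_eq[OF ext_coord_bounded_borel[OF f] D])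
      fix x :: real assume x: "x \<in> {0..1}"
      then show "bint (\<lambda>x. ell1_nth (ext f x) i) x = bint (\<lambda>x. L i + W i x) x"
        using prim_f[OF x, of i] by (simp add: bint_const_plus[OF D'] prim_def)
    qed
  qed
  have W_nth: "W i x = ell1_nth (bint ?h x) i" if "x \<in> {0..1}" for i x
    unfolding W_def prim_def using that
    by (simp add: bint_bounded_linear[OF h bounded_linear_ell1_nth])
  have "AE s in unit_leb. \<forall>i. ell1_nth (ext f s) i = L i + W i s"
    using coord by (simp add: AE_all_countable)
  then have aef: "AE s in unit_leb. \<forall>i. ell1_nth (ext f s) i = L i + ell1_nth (bint ?h s) i"
    using AE_space by eventually_elim (simp add: W_nth)
  \<comment> \<open>The boundary values form an element of the sequence space, being the difference of two such.\<close>
  obtain s0 where s0: "\<forall>i. ell1_nth (ext f s0) i = L i + ell1_nth (bint ?h s0) i"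
  proof -
    have "\<not> (AE s in unit_leb. False)"
    proof
      assume "AE s in unit_leb. False"
      then have "emeasure unit_leb (space unit_leb) = 0"
        using ae_filter_eq_bot_iff[of unit_leb] by (simp add: trivial_limit_def)
      then show False by (simp add: emeasure_restrict_space)
    qed
    then have "\<exists>s. \<forall>i. ell1_nth (ext f s) i = L i + ell1_nth (bint ?h s) i"
      using eventually_mono[OF aef, of "\<lambda>_. False"] by blast
    then show ?thesis using that by blast
  qed
  define L' where "L' = ext f s0 - bint ?h s0"
  have L'_nth: "ell1_nth L' i = L i" for i using s0 by (simp add: L'_def)
  have f_eq: "AE s in unit_leb. rep_linf f s = L' + bint ?h s"
    using aef ext_unit_interval[OF f] by eventually_elim (auto intro!: ell1_eqI simp: L'_nth)
  have wd: "has_weak_derivative f g"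
    by (rule has_weak_derivative_of_bint[OF h f_eq ext_unit_interval[OF g]])
  let ?u = "\<lambda>s. L' + bint ?h s"
  have "continuous_representative f ?u"
    unfolding continuous_representative_def
  proof
    show "continuous_on {0..1} ?u"
      by (intro continuous_on_add continuous_on_const continuous_on_subset[OF bint_continuous[OF h]]) auto
    show "AE s in unit_leb. ?u s = rep_linf f s" using f_eq by eventually_elim simp
  qed
  moreover have "?u 1 = B (?u 0)"
  proof (rule ell1_eqI)
    fix i
    have "(\<lambda>n. (\<Sum>j\<in>row i. of_real (adjacency G w i j) * ((1 / t n) *\<^sub>R prim f j (t n))) - (1 / t n) *\<^sub>R prim f i (t n))
        \<longlonglongrightarrow> (\<Sum>j\<in>row i. of_real (adjacency G w i j) * L j) - L i"
      by (intro tendsto_diff tendsto_sum tendsto_mult tendsto_const L)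
    moreover have "(\<Sum>j\<in>row i. of_real (adjacency G w i j) * ((1 / t n) *\<^sub>R prim f j (t n))) - (1 / t n) *\<^sub>R prim f i (t n)
        = (1 / t n) *\<^sub>R (prim f i (t n + 1) - prim f i (t n) - prim f i 1)" for n
    proof -
      have "prim f i (t n + 1) - prim f i (t n) - prim f i 1
          = (\<Sum>j\<in>row i. of_real (adjacency G w i j) * prim f j (t n)) - prim f i (t n)"
        unfolding add.commute[of "t n" 1] prim_plus_one[OF f less_imp_le[OF t(1)]] by simp
      then show ?thesis by (simp only: scaleR_right_diff_distrib scaleR_sum_right mult_scaleR_right)
    qed
    ultimately have "prim g i 1 = (\<Sum>j\<in>row i. of_real (adjacency G w i j) * L j) - L i"
      using LIMSEQ_unique[OF Q[of 1 i]] by simp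
    moreover have "ell1_nth (bint ?h 1) i = prim g i 1"
      using W_nth[of 1 i] by (simp add: W_def)
    ultimately show "ell1_nth (?u 1) i = ell1_nth (B (?u 0)) i"
      by (simp add: B_nth L'_nth)
  qed
  ultimately show "(f, g) \<in> flow_operator G w"
    using f g wd unfolding flow_operator_def flow_domain_def W1inf_def by blast
qed

text \<open>
  The boundary condition continues the identity \<open>ext v x = u 0 + bint (ext v') x\<close> from \<open>[0, 1]\<close> to \<open>[0, 2]\<close>.
  The Lipschitz bound of the indefinite integral then bounds the difference quotients, and its right
  derivatives identify their limit.
\<close>

lemma generator_superset:
  "(flow_operator G w :: ('k::{real_normed_field, euclidean_space} linf \<times> 'k linf) set)
    \<subseteq> bicontinuous_generator (Linf (arcs G)) (weak_star (arcs G)) T"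
proof clarify
  fix v v' :: "'k linf"
  assume "(v, v') \<in> flow_operator G w"
  then obtain u where v: "v \<in> Linf (arcs G)" and v': "v' \<in> Linf (arcs G)" and wd: "has_weak_derivative v v'"
    and u: "continuous_representative v u" and bc: "u 1 = B (u 0)"
    unfolding flow_operator_def flow_domain_def W1inf_def by blast
  let ?h = "ext v'"
  have h: "bounded_borel ?h (norm v')" by (rule ext_bounded_borel[OF v'])
  have u_eq: "u x = u 0 + bint ?h x" if "x \<in> {0..1}" for x
    by (rule continuous_representative_eq_bint[OF wd u h ext_unit_interval[OF v'] that])
  have ae1: "AE x in lborel. x \<in> {0..1} \<longrightarrow> ext v x = u 0 + bint ?h x"
  proof -
    have "AE s in unit_leb. u s = rep_linf v s" using u by (simp add: continuous_representative_def)
    then have "AE s in unit_leb. ext v s = u 0 + bint ?h s"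
      using ext_unit_interval[OF v] AE_space by eventually_elim (simp add: u_eq[symmetric])
    then show ?thesis unfolding AE_unit_leb_iff .
  qed
  have step: "B (u 0 + bint ?h y) = u 0 + bint ?h (1 + y)" if y: "0 \<le> y" for y
  proof -
    have "B (bint ?h y) = bint (\<lambda>z. B (?h z)) y"
      by (rule bint_bounded_linear[OF h bounded_linear_B, symmetric])
    also have "\<dots> = (LINT z|lborel. indicator {0..y} z *\<^sub>R ?h (1 + z))"
      unfolding bint_def by (rule Bochner_Integration.integral_cong) (auto simp: ext_plus_one split: split_indicator)
    also have "\<dots> = bint ?h (1 + y) - bint ?h 1" by (rule bint_shift[OF h _ y]) simp
    finally have "B (bint ?h y) = bint ?h (1 + y) - bint ?h 1" .
    moreover have "B (u 0) = u 0 + bint ?h 1" using bc u_eq[of 1] by simp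
    ultimately show ?thesis by (simp add: linear_add[OF bounded_linear.linear[OF bounded_linear_B]])
  qed
  have ae2: "AE x in lborel. x \<in> {0..2} \<longrightarrow> ext v x = u 0 + bint ?h x"
    using ae1 AE_lborel_shift[OF ae1, of "-1"]
  proof eventually_elim
    case (elim x)
    show ?case
    proof
      assume x: "x \<in> {0..2}"
      show "ext v x = u 0 + bint ?h x"
      proof (cases "x \<le> 1")
        case False
        then have "ext v x = B (ext v (x - 1))" using ext_plus_one[of "x - 1" v] by simp
        also have "ext v (x - 1) = u 0 + bint ?h (x - 1)" using elim(2) x False by simp
        also have "B \<dots> = u 0 + bint ?h x" using step[of "x - 1"] False by simp
        finally show ?thesis .
      qed (use elim(1) x in auto)
    qed
  qed
  have bound: "norm (T t v - v) \<le> norm v' * t" if t: "0 < t" "t \<le> 1" for t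
  proof (rule norm_linf_le)
    have "AE s in unit_leb. ext v (t + s) = u 0 + bint ?h (t + s)"
      unfolding AE_unit_leb_iff using AE_lborel_shift[OF ae2, of t] by eventually_elim (use t in auto)
    moreover have "AE s in unit_leb. ext v s = u 0 + bint ?h s"
      unfolding AE_unit_leb_iff by (rule ae1)
    ultimately show "AE s in unit_leb. norm (rep_linf (T t v - v) s) \<le> norm v' * t"
      using rep_linf_minus[of "T t v" v] rep_T[OF v, of t] ext_unit_interval[OF v] AE_space
    proof eventually_elim
      case (elim s)
      have "norm (bint ?h (t + s) - bint ?h s) \<le> norm v' * \<bar>t + s - s\<bar>"
        using elim t by (intro bint_Lipschitz[OF h]) auto
      with elim t show ?case by simp
    qed
  qed
  have "limitin (weak_star (arcs G)) (\<lambda>t. (1 / t) *\<^sub>R (T t v - v)) v' (at_right 0)"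
  proof (rule limitin_weak_starI[OF v', where C = "norm v'"])
    have "norm ((1 / t) *\<^sub>R (T t v - v)) \<le> norm v'" if "0 < t" "t < 1" for t
      using bound[of t] that by (simp add: divide_le_eq)
    then show "\<forall>\<^sub>F t in at_right 0. (1 / t) *\<^sub>R (T t v - v) \<in> Linf (arcs G) \<and> norm ((1 / t) *\<^sub>R (T t v - v)) \<le> norm v'"
      unfolding eventually_at_right_field
      by (intro exI[of _ 1]) (simp add: Linf_scaleR Linf_diff T_in_Linf[OF v] v del: norm_scaleR)
    fix i and x :: real assume x: "x \<in> {0..1}"
    have e': "bounded_borel (\<lambda>x. ell1_nth (?h x) i) (norm v')" by (rule ext_coord_bounded_borel[OF v'])
    define q where "q y = ell1_nth (u 0) i + bint (\<lambda>x. ell1_nth (?h x) i) (max 0 (min y 2))" for y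
    obtain D where q: "bounded_borel q D" and cq: "continuous_on UNIV q"
      using clamped_bint_bounded_borel[OF e', of 2 "ell1_nth (u 0) i"] by (auto simp: q_def[abs_def])
    have qc: "(q \<longlongrightarrow> q y) (at_right y)" for y
      using cq by (simp add: continuous_on_eq_continuous_at continuous_at_imp_continuous_at_within flip: continuous_within)
    have prim_q: "prim v i y = bint q y" if y: "0 \<le> y" "y \<le> 2" for y
      unfolding prim_def
    proof (rule bint_cong_AE[OF ext_coord_bounded_borel[OF v] q])
      show "AE z in lborel. 0 \<le> z \<longrightarrow> z \<le> y \<longrightarrow> ell1_nth (ext v z) i = q z"
        using ae2 by eventually_elim
          (use y in \<open>auto simp: q_def bint_bounded_linear[OF h bounded_linear_ell1_nth]\<close>)
    qed
    have "((\<lambda>t. (1 / t) *\<^sub>R (bint q (x + t) - bint q x) - (1 / t) *\<^sub>R (bint q (0 + t) - bint q 0)) \<longlongrightarrow> q x - q 0) (at_right 0)"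
      using x by (intro tendsto_diff bint_right_derivative[OF q _ qc]) auto
    moreover have "q x - q 0 = coord_integral v' i {0..x}"
      using x by (simp add: q_def coord_integral_prim[OF v' x] prim_def)
    moreover have "\<forall>\<^sub>F t in at_right 0. (1 / t) *\<^sub>R (bint q (x + t) - bint q x) - (1 / t) *\<^sub>R (bint q (0 + t) - bint q 0)
        = coord_integral ((1 / t) *\<^sub>R (T t v - v)) i {0..x}"
    proof -
      have "(1 / t) *\<^sub>R (bint q (x + t) - bint q x) - (1 / t) *\<^sub>R (bint q (0 + t) - bint q 0)
          = coord_integral ((1 / t) *\<^sub>R (T t v - v)) i {0..x}" if t: "0 < t" "t < 1" for t
      proof -
        have "coord_integral ((1 / t) *\<^sub>R (T t v - v)) i {0..x} = (1 / t) *\<^sub>R (bint q (t + x) - bint q t - bint q x)"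
          using t x by (subst coord_integral_quotient[OF v _ x]) (auto simp: prim_q)
        then show ?thesis by (simp add: add.commute algebra_simps)
      qed
      then show ?thesis unfolding eventually_at_right_field by (intro exI[of _ 1]) auto
    qed
    ultimately show "((\<lambda>t. coord_integral ((1 / t) *\<^sub>R (T t v - v)) i {0..x}) \<longlongrightarrow> coord_integral v' i {0..x}) (at_right 0)"
      by (simp add: Lim_transform_eventually)
  qed
  moreover have "bdd_above ((\<lambda>t. norm (T t v - v) / t) ` {0<..1})"
    by (rule bdd_aboveI2[of _ _ "norm v'"]) (use bound in \<open>auto simp: divide_le_eq\<close>)
  ultimately show "(v, v') \<in> bicontinuous_generator (Linf (arcs G)) (weak_star (arcs G)) T"
    using v by (simp add: bicontinuous_generator_def)
qed

end

section \<open>Generation of the contraction semigroup\<close>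

theorem theorem3p7:
  fixes G :: "('v, nat) pre_digraph" and w :: "nat \<Rightarrow> nat \<Rightarrow> real"
  assumes "weighted_network G w"
  shows "\<exists>T :: real \<Rightarrow> ('k::{real_normed_field, euclidean_space}) linf \<Rightarrow> 'k linf.
    contraction_bicontinuous_semigroup scale_linf (Linf (arcs G)) (weak_star (arcs G)) T \<and>
    bicontinuous_generator (Linf (arcs G)) (weak_star (arcs G)) T = flow_operator G w \<and>
    (\<forall>t\<ge>0. \<forall>f\<in>Linf (arcs G). AE s in lebesgue_on {0..1}. \<forall>n::nat.
       real n \<le> t + s \<and> t + s < real n + 1 \<longrightarrow>
       rep_linf (T t f) s = (adjacency_op G w ^^ n) (rep_linf f (t + s - real n)))"
proof -
  interpret weighted_network G w by (rule assms)
  show ?thesis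
    using T_contraction_semigroup subset_antisym[OF generator_subset generator_superset] T_formula
    by (intro exI[of _ T]) blast
qed

end
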